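(* Let $\omega_0\in C_c^\infty(\Omega^c)$ be nonnegative, let $\alpha\in\mathbb{R}$, let $m=\int_{\Omega^c}\omega_0\,dx$, and let $\omega(x,t)$ be the solution of the exterior vorticity problem (described in the context) with initial data $\omega_0$ and harmonic coefficient $\alpha$. Define the modified logarithmic moment $$L(t)=\frac1{2\pi}\int_{\Omega^c}\bigl(\log|T(y)|\bigr)\,\omega(y,t)\,dy.$$ If either $\alpha<0$ or $\alpha>m$, then there exists a constant $M>0$ such that $L(t)\le M$ for all $t\ge 0$.
   Context: Let $\Gamma\subset\mathbb{R}^2$ be a smooth Jordan curve, $\Omega$ the bounded and $\Omega^c$ the unbounded connected component of $\mathbb{R}^2\setminus\Gamma$ (both open). Identify $\mathbb{R}^2$ with $\mathbb{C}$. There is a conformal (biholomorphic) map $T:\Omega^c\to\{|z|>1\}$, extending continuously to the boundary and mapping $\Gamma$ to the unit circle, with $T(z)=\beta z+h(z)$, $\beta>0$, $h$ bounded holomorphic on $\Omega^c$; it satisfies $|h'(z)|\le C/|z|^2$, $|h''(z)|\le C/|z|^3$, and $DT$, $DT^{-1}$ are bounded. Fix this $T$. Write $z^*=z/|z|^2$, $(a,b)^\perp=(-b,a)$, $\nabla^\perp=(-\partial_2,\partial_1)$. The Green's function of the Laplacian in $\Omega^c$ is $$G_{\Omega^c}(x,y)=\frac1{2\pi}\log\frac{|T(x)-T(y)|}{|T(x)-T(y)^*|\,|T(y)|},$$ and the normalized harmonic vector field is $H_{\Omega^c}(x)=\frac1{2\pi}\nabla^\perp\log|T(x)|$. The exterior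 vorticity problem (vorticity form of the incompressible 2D Euler equations in $\Omega^c$) with initial vorticity $\omega_0$ and harmonic coefficient $\alpha\in\mathbb{R}$ (a constant in time) is $$\omega_t+u\cdot\nabla\omega=0 \text{ in }\Omega^c\times(0,\infty),\quad u=\nabla^\perp\psi+\alpha H_{\Omega^c},\quad \psi(x,t)=\int_{\Omega^c}G_{\Omega^c}(x,y)\omega(y,t)\,dy,\quad \omega(\cdot,0)=\omega_0.$$ For $\omega_0\in C_c^\infty(\Omega^c)$ it has a global smooth solution, with $\omega(\cdot,t)$ compactly supported for each $t$, and $L^p$ norms of $\omega(\cdot,t)$ are conserved. Constants may depend on $\Omega$, $\omega_0$, $\alpha$ but not on $t$. *)

theory Defs
  imports "HOL-Complex_Analysis.Complex_Analysis"
begin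

text \<open>The plane is \<^typ>\<open>complex\<close>; \<open>D\<close> below always stands for the exterior domain
  \<open>outside \<Gamma>\<close>. Functions on \<open>D\<close> are total functions whose values off \<open>D\<close> are irrelevant.\<close>

text \<open>Meant for open \<open>S\<close>: all partial derivatives up to order \<open>k\<close> exist and are continuous.\<close>

primrec Ck_on :: "nat \<Rightarrow> 'a::euclidean_space set \<Rightarrow> ('a \<Rightarrow> 'b::real_normed_vector) \<Rightarrow> bool" where
  "Ck_on 0 S f \<longleftrightarrow> continuous_on S f"
| "Ck_on (Suc k) S f \<longleftrightarrow>
     f differentiable_on S \<and> (\<forall>v\<in>Basis. Ck_on k S (\<lambda>x. frechet_derivative f (at x) v))"

definition smooth_on :: "'a::euclidean_space set \<Rightarrow> ('a \<Rightarrow> 'b::real_normed_vector) \<Rightarrow> bool" where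
  "smooth_on S f \<longleftrightarrow> (\<forall>k. Ck_on k S f)"

definition compactly_supported_in :: "complex set \<Rightarrow> (complex \<Rightarrow> real) \<Rightarrow> bool" where
  "compactly_supported_in D f \<longleftrightarrow> (\<exists>K. compact K \<and> K \<subseteq> D \<and> (\<forall>x\<in>D - K. f x = 0))"

text \<open>Periodicity makes the curve smooth across its base point as well.\<close>

definition smooth_Jordan_curve :: "complex set \<Rightarrow> bool" where
  "smooth_Jordan_curve \<Gamma> \<longleftrightarrow>
     (\<exists>\<gamma>::real \<Rightarrow> complex.
        smooth_on UNIV \<gamma> \<and> (\<forall>s. \<gamma> (s + 1) = \<gamma> s) \<and>
        (\<forall>s. vector_derivative \<gamma> (at s) \<noteq> 0) \<and>
        simple_path \<gamma> \<and> \<Gamma> = path_image \<gamma>)"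

definition biholomorphic :: "(complex \<Rightarrow> complex) \<Rightarrow> complex set \<Rightarrow> complex set \<Rightarrow> bool" where
  "biholomorphic T A B \<longleftrightarrow>
     bij_betw T A B \<and> T holomorphic_on A \<and> inv_into A T holomorphic_on B"

text \<open>On \<open>\<Gamma>\<close> the function \<open>T\<close> is the continuous extension. The decay bounds exclude \<open>z = 0\<close>, which may
  lie in \<open>D\<close> and where the right-hand sides would read \<open>0\<close> instead of infinity. As \<open>T\<close> is
  holomorphic, boundedness of the Jacobian matrices of \<open>T\<close> and its inverse is boundedness of the
  complex derivatives.\<close>

definition exterior_conformal_map :: "complex set \<Rightarrow> (complex \<Rightarrow> complex) \<Rightarrow> bool" where
  "exterior_conformal_map \<Gamma> T \<longleftrightarrow>
     (let D = outside \<Gamma> in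
        biholomorphic T D {z. 1 < cmod z} \<and>
        continuous_on (D \<union> \<Gamma>) T \<and> T ` \<Gamma> = sphere 0 1 \<and>
        (\<exists>(\<beta>::real) h C. 0 < \<beta> \<and> h holomorphic_on D \<and> bounded (h ` D) \<and>
           (\<forall>z\<in>D. T z = of_real \<beta> * z + h z) \<and>
           (\<forall>z\<in>D - {0}. cmod (deriv h z) \<le> C / cmod z ^ 2 \<and>
                        cmod (deriv (deriv h) z) \<le> C / cmod z ^ 3)) \<and>
        bounded (deriv T ` D) \<and>
        bounded (deriv (inv_into D T) ` {z. 1 < cmod z}))"

definition grad :: "(complex \<Rightarrow> real) \<Rightarrow> complex \<Rightarrow> complex" where
  "grad f x = Complex (frechet_derivative f (at x) 1) (frechet_derivative f (at x) \<i>)"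

definition perp :: "complex \<Rightarrow> complex" where
  "perp z = Complex (- Im z) (Re z)"

definition nabla_perp :: "(complex \<Rightarrow> real) \<Rightarrow> complex \<Rightarrow> complex" where
  "nabla_perp f x = perp (grad f x)"

definition reflect :: "complex \<Rightarrow> complex" where
  "reflect z = z / of_real (cmod z ^ 2)"

definition green :: "(complex \<Rightarrow> complex) \<Rightarrow> complex \<Rightarrow> complex \<Rightarrow> real" where
  "green T x y =
     1 / (2 * pi) * ln (cmod (T x - T y) / (cmod (T x - reflect (T y)) * cmod (T y)))"

definition harmonic_field :: "(complex \<Rightarrow> complex) \<Rightarrow> complex \<Rightarrow> complex" where
  "harmonic_field T x = (1 / (2 * pi)) *\<^sub>R nabla_perp (\<lambda>y. ln (cmod (T y))) x"

definition stream ::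
  "complex set \<Rightarrow> (complex \<Rightarrow> complex) \<Rightarrow> (complex \<Rightarrow> real \<Rightarrow> real) \<Rightarrow> complex \<Rightarrow> real \<Rightarrow> real" where
  "stream D T \<omega> x t = (LINT y:D|lborel. green T x y * \<omega> y t)"

definition velocity ::
  "complex set \<Rightarrow> (complex \<Rightarrow> complex) \<Rightarrow> real \<Rightarrow> (complex \<Rightarrow> real \<Rightarrow> real) \<Rightarrow>
     complex \<Rightarrow> real \<Rightarrow> complex" where
  "velocity D T \<alpha> \<omega> x t =
     nabla_perp (\<lambda>y. stream D T \<omega> y t) x + \<alpha> *\<^sub>R harmonic_field T x"

definition exterior_vorticity_problem ::
  "complex set \<Rightarrow> (complex \<Rightarrow> complex) \<Rightarrow> real \<Rightarrow> (complex \<Rightarrow> real) \<Rightarrow>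
     (complex \<Rightarrow> real \<Rightarrow> real) \<Rightarrow> bool" where
  "exterior_vorticity_problem D T \<alpha> \<omega>0 \<omega> \<longleftrightarrow>
     (\<forall>x\<in>D. \<forall>t>0. deriv (\<omega> x) t + velocity D T \<alpha> \<omega> x t \<bullet> grad (\<lambda>y. \<omega> y t) x = 0) \<and>
     (\<forall>x\<in>D. \<omega> x 0 = \<omega>0 x)"

definition Lp_norm :: "complex set \<Rightarrow> real \<Rightarrow> (complex \<Rightarrow> real) \<Rightarrow> real" where
  "Lp_norm D p f = (LINT x:D|lborel. \<bar>f x\<bar> powr p) powr (1 / p)"

text \<open>At \<open>t = 0\<close> only continuity is required, so solutions that are smooth up to \<open>t = 0\<close> are
  included. Conservation of the supremum norm follows from the case of finite \<open>p\<close>.\<close>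

definition global_smooth_solution ::
  "complex set \<Rightarrow> (complex \<Rightarrow> complex) \<Rightarrow> real \<Rightarrow> (complex \<Rightarrow> real) \<Rightarrow>
     (complex \<Rightarrow> real \<Rightarrow> real) \<Rightarrow> bool" where
  "global_smooth_solution D T \<alpha> \<omega>0 \<omega> \<longleftrightarrow>
     smooth_on (D \<times> {0<..}) (\<lambda>(x, t). \<omega> x t) \<and>
     continuous_on (D \<times> {0..}) (\<lambda>(x, t). \<omega> x t) \<and>
     exterior_vorticity_problem D T \<alpha> \<omega>0 \<omega> \<and>
     (\<forall>t\<ge>0. compactly_supported_in D (\<lambda>x. \<omega> x t)) \<and>
     (\<forall>t\<ge>0. \<forall>p\<ge>1. Lp_norm D p (\<lambda>x. \<omega> x t) = Lp_norm D p \<omega>0)"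

definition log_moment ::
  "complex set \<Rightarrow> (complex \<Rightarrow> complex) \<Rightarrow> (complex \<Rightarrow> real \<Rightarrow> real) \<Rightarrow> real \<Rightarrow> real" where
  "log_moment D T \<omega> t = 1 / (2 * pi) * (LINT y:D|lborel. ln (cmod (T y)) * \<omega> y t)"

end

theory Submission
  imports Defs
begin

text \<open>Let \<open>\<psi>(\<cdot>, t)\<close> be the Green potential of the vorticity and
\<open>\<Psi> = \<psi> + \<alpha> / (2 \<pi>) log |T|\<close>, so that the velocity is the rotated gradient of \<open>\<Psi>\<close>. Everything
rests on the conserved energy \<open>E = 1/2 \<integral> \<psi> \<omega> + \<alpha> L\<close>. Formally \<open>E' = \<integral> \<Psi> \<omega>\<^sub>t = \<integral> \<omega> u \<cdot> \<nabla>\<Psi>\<close>,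
and \<open>u\<close> is orthogonal to \<open>\<nabla>\<Psi>\<close>. Given conservation, the two cases are as follows.

Since \<open>G \<le> 0\<close> and \<open>\<omega> \<ge> 0\<close>, the self energy \<open>\<integral> \<psi> \<omega>\<close> is nonpositive, hence \<open>\<alpha> L \<ge> E\<close>; for \<open>\<alpha> < 0\<close>
this is an upper bound for \<open>L\<close>. In the other direction \<open>|T x - (T y)\<^sup>*| |T y| \<le> 2 |T x| |T y|\<close> gives
\<open>- G(x, y) \<le> (log |T x| + log |T y|) / (2 \<pi>) + O(1 + 1 / |x - y|)\<close>, and integration against
\<open>\<omega>(x) \<omega>(y)\<close> yields \<open>- 1/2 \<integral> \<psi> \<omega> \<le> m L + C\<close>, where \<open>C\<close> depends on the domain and on the \<open>L\<^sup>1\<close> and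
\<open>L\<^sup>\<infinity>\<close> norms of \<open>\<omega>\<close> only (\<open>self_energy_bounds\<close>). Thus \<open>(\<alpha> - m) L \<le> E + C\<close>, which settles
\<open>\<alpha> > m\<close> (\<open>log_moment_bounded\<close>).

The work lies in the conservation laws. For each time the vorticity has compact support, but nothing is known about
the support uniformly in time, so vorticity might conceivably leak to the boundary curve or to infinity.
The lemma \<open>moment_increment_le\<close> excludes this. It tests the equation with \<open>f\<close> times a cutoff
\<open>\<phi>\<^sub>n\<close> that lives on compact subsets of the exterior domain. The extra flux produced by \<open>\<nabla>\<phi>\<^sub>n\<close> is bounded
uniformly in \<open>n\<close> and \<open>t\<close>: near the curve \<open>|\<nabla>\<phi>\<^sub>n|\<close> is of size \<open>n\<close>, but only on a strip of area \<open>O(1/n)\<close>,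
while \<open>u\<close> and \<open>\<omega>\<close> are bounded in terms of the conserved norms. At each fixed time the extra flux even vanishes
for large \<open>n\<close>. Dominated convergence in time removes it.

With \<open>f = 1\<close> the total mass is conserved; as the \<open>L\<^sup>1\<close> norm is conserved too, \<open>\<omega>\<close> stays nonnegative.
For the energy the symmetry of \<open>G\<close> gives \<open>E(t) - E(s) = \<integral> f (\<omega>(t) - \<omega>(s))\<close> with
\<open>f = (\<Psi>(s) + \<Psi>(t)) / 2\<close>. For an intermediate time \<open>\<tau>\<close> the flux \<open>\<integral> \<omega>(\<tau>) u(\<tau>) \<cdot> \<nabla>f\<close> is small, because
\<open>u(\<tau>)\<close> is orthogonal to \<open>\<nabla>\<Psi>(\<tau>)\<close> and \<open>\<nabla>\<Psi>\<close> depends continuously on \<open>\<omega>\<close> in \<open>L\<^sup>1\<close> as long as \<open>\<omega>\<close> stays bounded; continuity in time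
of \<open>\<omega>\<close> in \<open>L\<^sup>1\<close> is Scheffe's lemma. So \<open>E\<close> has derivative zero (\<open>energy_conserved\<close>).

Two tools keep the regularity requirements low. The potential of a bounded density is differentiable under the integral
sign (\<open>GDERIV_potential\<close>), and \<open>\<integral> \<nabla>\<^sup>\<bottom>\<Psi> \<cdot> \<nabla>F = 0\<close> holds for functions that are merely
differentiable with bounded gradients, one of them of compact support (\<open>null_lagrangian\<close>), so second derivatives never occur.\<close>

section \<open>The kernel \<open>1 / |x - y|\<close> in the plane\<close>

lemma integral_nonpos:
  fixes f :: "'a \<Rightarrow> real"
  assumes "\<And>x. f x \<le> 0" shows "(\<integral>x. f x \<partial>M) \<le> 0"
  using Bochner_Integration.integral_nonneg[of M "\<lambda>x. - f x"] assms by simp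

lemma emeasure_ball_complex:
  fixes c :: complex assumes "0 \<le> r" shows "emeasure lborel (ball c r) = ennreal (pi * r\<^sup>2)"
  using emeasure_ball[OF assms, of c] by (simp add: unit_ball_vol_2)

text \<open>On the dyadic annulus of outer radius \<open>\<rho> / 2 ^ k\<close> the integrand is at most \<open>2 ^ (k + 1) / \<rho>\<close>,
  and the discs have area \<open>\<pi> \<rho>\<^sup>2 / 4 ^ k\<close>; the resulting geometric series has the sum \<open>4 \<pi> \<rho>\<close>.\<close>

lemma nn_integral_inverse_dist_ball:
  fixes x :: complex
  assumes "0 < \<rho>"
  shows "(\<integral>\<^sup>+y. ennreal (indicator (ball x \<rho>) y / cmod (x - y)) \<partial>lborel) \<le> ennreal (4 * pi * \<rho>)"
proof -
  let ?f = "\<lambda>k::nat. \<lambda>y. ennreal (2 ^ (k+1) / \<rho>) * indicator (ball x (\<rho> / 2 ^ k)) y"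
  have pointwise: "ennreal (indicator (ball x \<rho>) y / cmod (x - y)) \<le> (\<Sum>k. ?f k y)" for y
  proof (cases "y \<in> ball x \<rho> \<and> y \<noteq> x")
    case True
    define r where "r = cmod (x - y) / \<rho>"
    have r: "0 < r" "r < 1" using True assms by (auto simp: r_def dist_norm)
    obtain n where n: "(1/2) ^ n < r" using real_arch_pow_inv[OF r(1), of "1/2"] by auto
    define N where "N = (LEAST n. (1/2) ^ n \<le> r)"
    have N: "(1/2) ^ N \<le> r" unfolding N_def using less_imp_le[OF n] by (rule LeastI)
    have "N \<noteq> 0" using N r by (intro notI) auto
    then obtain k where k: "N = Suc k" using not0_implies_Suc by blast
    \<comment> \<open>Minimality places \<open>y\<close> inside the disc number \<open>k\<close>, but outside of the next one.\<close>
    have "r < (1/2) ^ k" using not_less_Least[of k "\<lambda>n. (1/2) ^ n \<le> r"] k by (auto simp: N_def)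
    hence "y \<in> ball x (\<rho> / 2 ^ k)" using assms by (auto simp: r_def dist_norm field_simps)
    moreover have "1 / cmod (x - y) \<le> 2 ^ (k+1) / \<rho>" using N assms r(1) unfolding k
      by (simp add: field_simps r_def)
    ultimately have "ennreal (indicator (ball x \<rho>) y / cmod (x - y)) \<le> ?f k y"
      using True by (auto intro!: ennreal_leI)
    also have "\<dots> = (\<Sum>k\<in>{k}. ?f k y)" by (simp only: sum.insert sum.empty finite.emptyI empty_iff not_False_eq_True add_0_right)
    also have "\<dots> \<le> (\<Sum>k. ?f k y)" by (rule sum_le_suminf) auto
    finally show ?thesis .
  next
    case False
    then show ?thesis by auto
  qed
  have "(\<integral>\<^sup>+y. ennreal (indicator (ball x \<rho>) y / cmod (x - y)) \<partial>lborel) \<le> (\<integral>\<^sup>+y. (\<Sum>k. ?f k y) \<partial>lborel)"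
    by (intro nn_integral_mono pointwise)
  also have "\<dots> = (\<Sum>k. \<integral>\<^sup>+y. ?f k y \<partial>lborel)"
  proof (rule nn_integral_suminf)
    fix k :: nat
    have [measurable]: "ball x (\<rho> / 2 ^ k) \<in> sets borel" by simp
    show "?f k \<in> borel_measurable lborel" by measurable
  qed
  also have "\<dots> = (\<Sum>k. ennreal (2 * pi * \<rho> * (1/2) ^ k))"
  proof (rule arg_cong[where f = suminf], rule ext)
    fix k :: nat
    have e: "2 ^ (k+1) / \<rho> * (pi * (\<rho> / 2 ^ k)\<^sup>2) = 2 * pi * \<rho> * (1/2) ^ k"
      using assms by (simp add: field_simps power2_eq_square power_divide)
    show "(\<integral>\<^sup>+y. ?f k y \<partial>lborel) = ennreal (2 * pi * \<rho> * (1/2) ^ k)"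
      using assms by (simp add: nn_integral_cmult_indicator emeasure_ball_complex e[simplified] flip: ennreal_mult)
  qed
  also have "\<dots> = ennreal (\<Sum>k. 2 * pi * \<rho> * (1/2) ^ k)"
    using assms by (intro suminf_ennreal2 summable_mult summable_geometric) auto
  also have "(\<Sum>k. 2 * pi * \<rho> * (1/2) ^ k) = 4 * pi * \<rho>"
    by (subst suminf_mult) (auto simp: suminf_geometric)
  finally show ?thesis by simp
qed

lemma
  fixes x :: complex
  assumes "0 < \<rho>"
  shows integrable_inverse_dist_ball:
      "integrable lborel (\<lambda>y. indicator (ball x \<rho>) y / cmod (x - y))"
    and integral_inverse_dist_ball:
      "(LBINT y. indicator (ball x \<rho>) y / cmod (x - y)) \<le> 4 * pi * \<rho>"
proof -
  have [measurable]: "ball x \<rho> \<in> sets borel" by simp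
  have [measurable]: "(\<lambda>y. indicator (ball x \<rho>) y / cmod (x - y)) \<in> borel_measurable lborel"
    by simp
  show i: "integrable lborel (\<lambda>y. indicator (ball x \<rho>) y / cmod (x - y))"
    using nn_integral_inverse_dist_ball[OF assms, of x]
    by (intro integrableI_nonneg) (auto intro: le_less_trans)
  show "(LBINT y. indicator (ball x \<rho>) y / cmod (x - y)) \<le> 4 * pi * \<rho>"
    using nn_integral_inverse_dist_ball[OF assms, of x] assms
    by (subst (asm) nn_integral_eq_integral[OF i]) (auto simp: ennreal_le_iff)
qed

text \<open>Up to a constant factor a majorant for the gradient of the Green function; it also absorbs the logarithmic
  singularity of the Green function itself.\<close>

definition riesz_kernel :: "complex \<Rightarrow> complex \<Rightarrow> real" where
  "riesz_kernel x y = 1 + 1 / cmod (x - y)"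

lemma riesz_kernel_ge_1: "1 \<le> riesz_kernel x y"
  by (simp add: riesz_kernel_def)

lemma riesz_kernel_measurable [measurable]: "(\<lambda>y. riesz_kernel x y) \<in> borel_measurable borel"
  unfolding riesz_kernel_def by measurable

text \<open>Close to \<open>x\<close> the density is bounded by \<open>M\<close>, away from \<open>x\<close> the kernel is bounded. The free
  radius \<open>\<rho>\<close> makes the bound small when \<open>g\<close> is small in \<open>L\<^sup>1\<close> and merely bounded in the supremum norm.\<close>

lemma
  fixes g :: "complex \<Rightarrow> real"
  assumes "integrable lborel g" "\<And>y. \<bar>g y\<bar> \<le> M" "0 < \<rho>"
  shows integrable_riesz_kernel: "integrable lborel (\<lambda>y. riesz_kernel x y * \<bar>g y\<bar>)"
    and integral_riesz_kernel_le:
      "(LBINT y. riesz_kernel x y * \<bar>g y\<bar>) \<le> (1 + 1 / \<rho>) * (LBINT y. \<bar>g y\<bar>) + 4 * pi * \<rho> * M"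
proof -
  have [measurable]: "g \<in> borel_measurable borel" using assms(1) by auto
  let ?b = "\<lambda>y. (1 + 1 / \<rho>) * \<bar>g y\<bar> + M * (indicator (ball x \<rho>) y / cmod (x - y))"
  have M: "0 \<le> M" using assms(2)[of 0] by linarith
  have le: "riesz_kernel x y * \<bar>g y\<bar> \<le> ?b y" for y
  proof (cases "y \<in> ball x \<rho>")
    case True
    have "1 / cmod (x - y) * \<bar>g y\<bar> \<le> 1 / cmod (x - y) * M"
      using assms(2) by (intro mult_left_mono) auto
    moreover have "0 \<le> \<bar>g y\<bar> / \<rho>" using assms(3) by auto
    ultimately show ?thesis using True unfolding riesz_kernel_def by (simp add: algebra_simps)
  next
    case False
    hence "1 / cmod (x - y) \<le> 1 / \<rho>" using assms(3) by (intro divide_left_mono) (auto simp: dist_norm intro!: mult_pos_pos)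
    hence "riesz_kernel x y * \<bar>g y\<bar> \<le> (1 + 1 / \<rho>) * \<bar>g y\<bar>"
      unfolding riesz_kernel_def by (intro mult_right_mono) auto
    thus ?thesis using False by simp
  qed
  have ib: "integrable lborel ?b"
    using assms by (intro Bochner_Integration.integrable_add integrable_mult_right integrable_inverse_dist_ball integrable_abs) auto
  show i: "integrable lborel (\<lambda>y. riesz_kernel x y * \<bar>g y\<bar>)"
  proof (rule Bochner_Integration.integrable_bound[OF ib])
    show "AE y in lborel. norm (riesz_kernel x y * \<bar>g y\<bar>) \<le> norm (?b y)"
    proof (rule AE_I2)
      fix y
      have "0 \<le> riesz_kernel x y * \<bar>g y\<bar>" using riesz_kernel_ge_1[of x y] by auto
      with le[of y] show "norm (riesz_kernel x y * \<bar>g y\<bar>) \<le> norm (?b y)" by auto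
    qed
  qed measurable
  have "(LBINT y. riesz_kernel x y * \<bar>g y\<bar>) \<le> integral\<^sup>L lborel ?b"
    by (intro integral_mono i ib le)
  also have "\<dots> = (1 + 1 / \<rho>) * (LBINT y. \<bar>g y\<bar>) + M * (LBINT y. indicator (ball x \<rho>) y / cmod (x - y))"
    using assms integrable_inverse_dist_ball[OF assms(3), of x]
    by (subst Bochner_Integration.integral_add)
      (auto simp del: times_divide_eq_right intro!: integrable_mult_right)
  also have "\<dots> \<le> (1 + 1 / \<rho>) * (LBINT y. \<bar>g y\<bar>) + M * (4 * pi * \<rho>)"
    using M assms(3) by (intro add_left_mono mult_left_mono integral_inverse_dist_ball) auto
  finally show "(LBINT y. riesz_kernel x y * \<bar>g y\<bar>) \<le> (1 + 1 / \<rho>) * (LBINT y. \<bar>g y\<bar>) + 4 * pi * \<rho> * M"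
    by (simp add: mult_ac)
qed

section \<open>Gradients and a null Lagrangian\<close>

lemma GDERIV_lipschitz:
  fixes f :: "complex \<Rightarrow> real"
  assumes "convex S" "\<And>x. x \<in> S \<Longrightarrow> GDERIV f x :> g x" "\<And>x. x \<in> S \<Longrightarrow> cmod (g x) \<le> B"
    "x \<in> S" "y \<in> S"
  shows "\<bar>f x - f y\<bar> \<le> B * cmod (x - y)"
proof -
  have "norm (f x - f y) \<le> B * norm (x - y)"
  proof (rule differentiable_bound[OF assms(1) _ _ assms(4,5)])
    fix z assume z: "z \<in> S"
    show "(f has_derivative (\<lambda>h. h \<bullet> g z)) (at z within S)"
      using assms(2)[OF z] by (auto simp: gderiv_def intro: has_derivative_at_withinI)
    show "onorm (\<lambda>h. h \<bullet> g z) \<le> B"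
      using assms(3)[OF z] by (intro onorm_le) (metis Cauchy_Schwarz_ineq2 mult.commute mult_left_mono norm_ge_zero order_trans real_norm_def)
  qed
  thus ?thesis by simp
qed

lemma GDERIV_imp_grad:
  assumes "GDERIV f x :> g" shows "grad f x = g"
proof -
  have "frechet_derivative f (at x) = (\<lambda>h. h \<bullet> g)"
    using assms frechet_derivative_at unfolding gderiv_def by metis
  thus ?thesis unfolding grad_def by (simp add: complex_eq_iff inner_complex_def)
qed

lemma GDERIV_diffquot:
  fixes f :: "complex \<Rightarrow> real"
  assumes "GDERIV f x :> g"
  shows "((\<lambda>h. (f (x + of_real h * v) - f x) / h) \<longlongrightarrow> v \<bullet> g) (at 0)"
proof -
  have "((\<lambda>t::real. f (x + of_real t * v)) has_derivative (\<lambda>t. (of_real t * v) \<bullet> g)) (at 0)"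
  proof (rule has_derivative_compose[where f = "\<lambda>t::real. x + of_real t * v" and g = f])
    show "((\<lambda>t::real. x + of_real t * v) has_derivative (\<lambda>t. of_real t * v)) (at 0)"
      by (auto intro!: derivative_eq_intros)
    show "(f has_derivative (\<lambda>h. h \<bullet> g)) (at (x + of_real 0 * v))"
      using assms by (simp add: gderiv_def)
  qed
  moreover have "(\<lambda>t::real. (of_real t * v) \<bullet> g) = (*) (v \<bullet> g)"
    by (auto simp: inner_complex_def algebra_simps)
  ultimately have "((\<lambda>t::real. f (x + of_real t * v)) has_field_derivative (v \<bullet> g)) (at 0)"
    by (simp add: has_field_derivative_def)
  thus ?thesis by (simp add: DERIV_def)
qed

lemma GDERIV_continuous:
  fixes f :: "complex \<Rightarrow> real"
  assumes "GDERIV f x :> g" shows "isCont f x"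
  using assms unfolding gderiv_def by (rule has_derivative_continuous)

text \<open>Extension by zero turns functions on \<open>D\<close> with compact support into functions on the plane, where translations are available.\<close>

lemma GDERIV_extend_by_0:
  assumes "open D" "\<And>x. x \<in> D \<Longrightarrow> GDERIV h x :> h' x" "compact K" "K \<subseteq> D" "\<And>x. x \<notin> K \<Longrightarrow> h x = 0"
  shows "GDERIV h x :> (if x \<in> D then h' x else 0)"
proof (cases "x \<in> D")
  case False
  have "(h has_derivative (\<lambda>v. v \<bullet> 0)) (at x)"
  proof (rule has_derivative_transform_within_open)
    show "((\<lambda>_. 0) has_derivative (\<lambda>v. v \<bullet> 0)) (at x)" by simp
    show "open (- K)" using assms(3) by (simp add: compact_imp_closed open_Compl)
  qed (use False assms in auto)
  thus ?thesis using False by (simp add: gderiv_def)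
qed (use assms in auto)

lemma cmod_perp [simp]: "cmod (perp z) = cmod z"
  by (simp add: perp_def cmod_def add.commute)

lemma perp_inner: "perp u \<bullet> v = Re u * Im v - Im u * Re v"
  by (simp add: perp_def inner_complex_def)

text \<open>For smooth functions this is integration by parts and the symmetry of second derivatives. With one
  derivative only, the same cancellation is exact for difference quotients, provided that those of \<open>\<Psi>\<close> point
  forward and those of \<open>F\<close> point backward: after translation both products involve only
  \<open>a z = \<integral> \<Psi> (x + z) F x\<close> at \<open>h\<close>, \<open>h \<i>\<close>, \<open>h + h \<i>\<close> and \<open>0\<close>. The Lipschitz bounds then allow the passage to the limit.\<close>

lemma null_lagrangian:
  fixes \<Psi> F :: "complex \<Rightarrow> real"
  assumes \<Psi>: "\<And>x. GDERIV \<Psi> x :> p x" "\<And>x. cmod (p x) \<le> A"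
    and F: "\<And>x. GDERIV F x :> f x" "\<And>x. cmod (f x) \<le> B"
    and supp: "\<And>x. R < cmod x \<Longrightarrow> F x = 0"
  shows "integrable lborel (\<lambda>x. perp (p x) \<bullet> f x)" "(LBINT x. perp (p x) \<bullet> f x) = 0"
proof -
  have cont: "continuous_on UNIV \<Psi>" "continuous_on UNIV F"
    using GDERIV_continuous[OF \<Psi>(1)] GDERIV_continuous[OF F(1)]
    by (auto intro!: continuous_at_imp_continuous_on)
  hence [measurable]: "\<Psi> \<in> borel_measurable borel" "F \<in> borel_measurable borel"
    by (auto intro: borel_measurable_continuous_onI)
  have AB: "0 \<le> A" "0 \<le> B" using \<Psi>(2)[of 0] F(2)[of 0] norm_ge_zero order_trans by blast+
  have lip\<Psi>: "\<bar>\<Psi> x - \<Psi> y\<bar> \<le> A * cmod (x - y)" for x y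
    by (rule GDERIV_lipschitz[OF convex_UNIV, where g = p]) (use \<Psi> in auto)
  have lipF: "\<bar>F x - F y\<bar> \<le> B * cmod (x - y)" for x y
    by (rule GDERIV_lipschitz[OF convex_UNIV, where g = f]) (use F in auto)
  have int: "integrable lborel (\<lambda>x. \<Psi> (x + a) * F (x + b))" for a b
  proof -
    have "integrable lborel (\<lambda>x. indicator (cball (-b) R) x *\<^sub>R (\<Psi> (x + a) * F (x + b)))"
      by (intro borel_integrable_compact continuous_intros continuous_on_compose2[OF cont(1)] continuous_on_compose2[OF cont(2)]) auto
    moreover have "indicator (cball (-b) R) x *\<^sub>R (\<Psi> (x + a) * F (x + b)) = \<Psi> (x + a) * F (x + b)" for x
      using supp[of "x + b"] by (auto simp: indicator_def dist_norm norm_minus_commute)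
    ultimately show ?thesis by (simp only:)
  qed
  define a where "a z = (LBINT x. \<Psi> (x + z) * F x)" for z
  have shift: "(LBINT x. \<Psi> (x + z) * F (x - b)) = a (z + b)" for z b
  proof -
    have "a (z + b) = (\<integral>x. \<Psi> (x + (z + b)) * F x \<partial>distr lborel borel ((+) (-b)))"
      unfolding a_def by (simp add: lborel_distr_plus)
    also have "\<dots> = (LBINT x. \<Psi> (x + z) * F (x - b))"
      by (subst integral_distr) (auto simp: algebra_simps)
    finally show ?thesis by simp
  qed
  \<comment> \<open>A product of a forward increment of \<open>\<Psi>\<close> and a backward increment of \<open>F\<close>; its integral is symmetric in
    \<open>u\<close> and \<open>v\<close>.\<close>
  define P where "P u v x = (\<Psi> (x + u) - \<Psi> x) * (F x - F (x - v))" for u v x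
  have expand: "integrable lborel (P u v)" "integral\<^sup>L lborel (P u v) = a u - a (u + v) - a 0 + a v" for u v
  proof -
    have e: "P u v = (\<lambda>x. \<Psi> (x + u) * F x - \<Psi> (x + u) * F (x - v) - \<Psi> x * F x + \<Psi> x * F (x - v))"
      by (auto simp: P_def algebra_simps)
    note i = int[of u 0] int[of u "-v"] int[of 0 0] int[of 0 "-v"]
    show "integrable lborel (P u v)" unfolding e using i by auto
    show "integral\<^sup>L lborel (P u v) = a u - a (u + v) - a 0 + a v"
      unfolding e using i shift[of u v] shift[of 0 v] by (simp add: a_def)
  qed
  define Q where "Q n x = (P (of_real (1 / real (Suc n)) * 1) (of_real (1 / real (Suc n)) * \<i>) x
      - P (of_real (1 / real (Suc n)) * \<i>) (of_real (1 / real (Suc n)) * 1) x) * (real (Suc n))\<^sup>2" for n x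
  have Q0: "integral\<^sup>L lborel (Q n) = 0" for n
    unfolding Q_def using expand by (simp add: add.commute)
  have hn: "filterlim (\<lambda>n. 1 / real (Suc n)) (at 0) sequentially"
    unfolding filterlim_at using LIMSEQ_Suc[OF lim_1_over_n] by auto
  have lim\<Psi>: "(\<lambda>n. (\<Psi> (x + of_real (1 / real (Suc n)) * v) - \<Psi> x) * real (Suc n)) \<longlonglongrightarrow> v \<bullet> p x" for x v
    using filterlim_compose[OF GDERIV_diffquot[OF \<Psi>(1)] hn, of x v] by simp
  have limF: "(\<lambda>n. (F x - F (x - of_real (1 / real (Suc n)) * v)) * real (Suc n)) \<longlonglongrightarrow> v \<bullet> f x" for x v
    using tendsto_minus[OF filterlim_compose[OF GDERIV_diffquot[OF F(1)] hn, of x "-v"]]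
    by (simp add: algebra_simps)
  have "(\<lambda>n. Q n x) \<longlonglongrightarrow> (1 \<bullet> p x) * (\<i> \<bullet> f x) - (\<i> \<bullet> p x) * (1 \<bullet> f x)" for x
    using tendsto_diff[OF tendsto_mult[OF lim\<Psi>[of x 1] limF[of x \<i>]] tendsto_mult[OF lim\<Psi>[of x \<i>] limF[of x 1]]]
    by (rule Lim_transform_eventually) (auto simp: Q_def P_def algebra_simps power2_eq_square)
  hence limQ: "(\<lambda>n. Q n x) \<longlonglongrightarrow> perp (p x) \<bullet> f x" for x
    by (simp only: perp_inner) (simp add: inner_complex_def)
  have Pb: "\<bar>P u v x\<bar> \<le> (A * B * cmod u * cmod v) * indicator (cball 0 (R + 1)) x" if "cmod v \<le> 1" for u v x
  proof (cases "x \<in> cball 0 (R + 1)")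
    case True
    have "\<bar>\<Psi> (x + u) - \<Psi> x\<bar> * \<bar>F x - F (x - v)\<bar> \<le> (A * cmod u) * (B * cmod v)"
      using lip\<Psi>[of "x + u" x] lipF[of x "x - v"] AB by (intro mult_mono) auto
    thus ?thesis using True by (simp add: P_def abs_mult mult_ac)
  next
    case False
    hence "R < cmod x" "R < cmod (x - v)" using norm_triangle_ineq2[of x v] that by auto
    thus ?thesis using supp AB by (simp add: P_def)
  qed
  let ?w = "\<lambda>x. (2 * A * B) * indicator (cball (0::complex) (R + 1)) x"
  have dom: "AE x in lborel. (\<lambda>n. Q n x) \<longlonglongrightarrow> perp (p x) \<bullet> f x" "\<And>n. Q n \<in> borel_measurable lborel"
    "(\<lambda>x. perp (p x) \<bullet> f x) \<in> borel_measurable lborel" "integrable lborel ?w"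
    "\<And>n. AE x in lborel. norm (Q n x) \<le> ?w x"
  proof -
    show "AE x in lborel. (\<lambda>n. Q n x) \<longlonglongrightarrow> perp (p x) \<bullet> f x" using limQ by simp
    show "Q n \<in> borel_measurable lborel" for n unfolding Q_def P_def by measurable
    show "(\<lambda>x. perp (p x) \<bullet> f x) \<in> borel_measurable lborel"
      by (rule borel_measurable_LIMSEQ_real[OF limQ]) (auto simp: Q_def P_def)
    show "integrable lborel (\<lambda>x. 2 * A * B * indicator (cball (0::complex) (R + 1)) x)"
      by (intro integrable_mult_right integrable_real_indicator emeasure_compact_finite[OF compact_cball]) simp
    show "AE x in lborel. norm (Q n x) \<le> 2 * A * B * indicator (cball 0 (R + 1)) x" for n
    proof (rule AE_I2)
      fix x :: complex
      define h where "h = 1 / real (Suc n)"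
      have h: "0 < h" "h \<le> 1" "real (Suc n) = 1 / h" by (auto simp: h_def)
      have "\<bar>P (of_real h * 1) (of_real h * \<i>) x - P (of_real h * \<i>) (of_real h * 1) x\<bar>
         \<le> 2 * (A * B * h * h) * indicator (cball 0 (R + 1)) x"
        using Pb[of "of_real h * \<i>" "of_real h * 1" x] Pb[of "of_real h * 1" "of_real h * \<i>" x] h
        by (simp add: norm_mult)
      hence "\<bar>P (of_real h * 1) (of_real h * \<i>) x - P (of_real h * \<i>) (of_real h * 1) x\<bar> / h\<^sup>2
         \<le> (2 * (A * B * h * h) * indicator (cball 0 (R + 1)) x) / h\<^sup>2"
        by (intro divide_right_mono) auto
      moreover have "norm (Q n x) = \<bar>P (of_real h * 1) (of_real h * \<i>) x - P (of_real h * \<i>) (of_real h * 1) x\<bar> / h\<^sup>2"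
        unfolding Q_def h_def[symmetric] unfolding h(3) by (simp add: abs_mult power_divide)
      moreover have "(2 * (A * B * h * h) * indicator (cball 0 (R + 1)) x) / h\<^sup>2 = 2 * A * B * indicator (cball 0 (R + 1)) x"
        using h(1) by (simp add: power2_eq_square)
      ultimately show "norm (Q n x) \<le> 2 * A * B * indicator (cball 0 (R + 1)) x" by (simp only:)
    qed
  qed
  show "integrable lborel (\<lambda>x. perp (p x) \<bullet> f x)"
    by (rule integrable_dominated_convergence[OF dom(3,2,4,1,5)])
  have "(\<lambda>n. integral\<^sup>L lborel (Q n)) \<longlonglongrightarrow> (LBINT x. perp (p x) \<bullet> f x)"
    by (rule integral_dominated_convergence[OF dom(3,2,4,1,5)])
  thus "(LBINT x. perp (p x) \<bullet> f x) = 0" unfolding Q0 by (simp add: LIMSEQ_const_iff)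
qed

section \<open>Cutoff profiles\<close>

text \<open>The square of the positive part is differentiable and vanishes on a half line; composing it with a
  reflected copy of itself gives a differentiable transition from \<open>0\<close> to \<open>1\<close> on the unit interval.\<close>

definition smoothstep :: "real \<Rightarrow> real" where
  "smoothstep s = 1 - (max 0 (1 - (max 0 s)\<^sup>2))\<^sup>2"

lemma DERIV_max_0_square: "((\<lambda>s::real. (max 0 s)\<^sup>2) has_real_derivative 2 * max 0 s) (at s)"
proof -
  consider "s < 0" | "s = 0" | "s > 0" by linarith
  thus ?thesis
  proof cases
    case 1
    have "((\<lambda>s::real. 0) has_real_derivative 2 * max 0 s) (at s)" using 1 by simp
    thus ?thesis
      by (rule has_field_derivative_transform_within_open[where S = "{..<0}"]) (use 1 in auto)
  next
    case 2
    have "((\<lambda>h. (max 0 h)\<^sup>2 / h) \<longlongrightarrow> 0) (at (0::real))"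
    proof (rule tendsto_rabs_zero_cancel, rule tendsto_sandwich)
      show "((\<lambda>h::real. 0) \<longlongrightarrow> 0) (at 0)" "((\<lambda>h::real. \<bar>h\<bar>) \<longlongrightarrow> 0) (at 0)"
        by (auto intro: tendsto_eq_intros)
      show "\<forall>\<^sub>F h in at (0::real). \<bar>(max 0 h)\<^sup>2 / h\<bar> \<le> \<bar>h\<bar>"
        by (rule always_eventually) (auto simp: max_def power2_eq_square)
    qed auto
    thus ?thesis using 2 by (simp add: DERIV_def)
  next
    case 3
    have "((\<lambda>s::real. s\<^sup>2) has_real_derivative 2 * max 0 s) (at s)"
      using 3 by (auto intro!: derivative_eq_intros)
    thus ?thesis
      by (rule has_field_derivative_transform_within_open[where S = "{0<..}"]) (use 3 in auto)
  qed
qed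

definition smoothstep' :: "real \<Rightarrow> real" where
  "smoothstep' s = 4 * max 0 (1 - (max 0 s)\<^sup>2) * max 0 s"

lemma DERIV_smoothstep: "(smoothstep has_real_derivative smoothstep' s) (at s)"
proof -
  have "((\<lambda>s. (max 0 (1 - (max 0 s)\<^sup>2))\<^sup>2) has_real_derivative (2 * max 0 (1 - (max 0 s)\<^sup>2)) * (0 - 2 * max 0 s)) (at s)"
    by (rule DERIV_chain2[where f = "\<lambda>s. (max 0 s)\<^sup>2" and g = "\<lambda>s. 1 - (max 0 s)\<^sup>2"])
      (intro DERIV_max_0_square DERIV_diff DERIV_const)+
  from DERIV_diff[OF DERIV_const[of 1] this] show ?thesis
    unfolding smoothstep_def[abs_def] smoothstep'_def by (simp add: algebra_simps)
qed

lemma smoothstep_0 [simp]: "s \<le> 0 \<Longrightarrow> smoothstep s = 0"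
  and smoothstep'_0 [simp]: "s \<le> 0 \<Longrightarrow> smoothstep' s = 0"
  by (auto simp: smoothstep_def smoothstep'_def max_def)

lemma smoothstep_1 [simp]: "1 \<le> s \<Longrightarrow> smoothstep s = 1"
  and smoothstep'_1 [simp]: "1 \<le> s \<Longrightarrow> smoothstep' s = 0"
    by (use one_le_power[of s 2] in \<open>auto simp: smoothstep_def smoothstep'_def max_absorb1\<close>)

lemma smoothstep_bounds: "0 \<le> smoothstep s" "smoothstep s \<le> 1"
proof -
  have "(max 0 (1 - (max 0 s)\<^sup>2))\<^sup>2 \<le> 1\<^sup>2" by (rule power_mono) auto
  thus "0 \<le> smoothstep s" by (simp add: smoothstep_def)
qed (auto simp: smoothstep_def)

lemma smoothstep'_bounds: "\<bar>smoothstep' s\<bar> \<le> 4"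
proof (cases "s \<le> 0 \<or> 1 \<le> s")
  case False
  hence "s\<^sup>2 \<le> 1" by (simp add: power_le_one)
  hence "(1 - s\<^sup>2) * s \<le> 1 * 1" using False by (intro mult_mono) auto
  thus ?thesis using False \<open>s\<^sup>2 \<le> 1\<close> by (auto simp: smoothstep'_def abs_mult max_def algebra_simps)
qed auto

text \<open>The cutoff as a function of \<open>s = log |T x|\<close>. The first factor switches on where \<open>|T x|\<^sup>2\<close> lies between
  \<open>1 + 1 / n\<close> and \<open>1 + 2 / n\<close>, the second one switches off where \<open>s\<close> lies between \<open>n\<close> and \<open>n + 1\<close>.\<close>

definition cutoff_profile :: "nat \<Rightarrow> real \<Rightarrow> real" where
  "cutoff_profile n s = smoothstep (real n * (exp (2 * s) - 1) - 1) * smoothstep (real n + 1 - s)"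

definition cutoff_profile' :: "nat \<Rightarrow> real \<Rightarrow> real" where
  "cutoff_profile' n s =
     smoothstep' (real n * (exp (2 * s) - 1) - 1) * (2 * real n * exp (2 * s)) * smoothstep (real n + 1 - s)
   - smoothstep (real n * (exp (2 * s) - 1) - 1) * smoothstep' (real n + 1 - s)"

lemma DERIV_cutoff_profile: "(cutoff_profile n has_real_derivative cutoff_profile' n s) (at s)"
proof -
  have 1: "((\<lambda>s. smoothstep (real n * (exp (2 * s) - 1) - 1)) has_real_derivative
      smoothstep' (real n * (exp (2 * s) - 1) - 1) * (2 * real n * exp (2 * s))) (at s)"
    by (rule DERIV_chain2[OF DERIV_smoothstep]) (auto intro!: derivative_eq_intros)
  have 2: "((\<lambda>s. smoothstep (real n + 1 - s)) has_real_derivative smoothstep' (real n + 1 - s) * (-1)) (at s)"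
    by (rule DERIV_chain2[OF DERIV_smoothstep]) (auto intro!: derivative_eq_intros)
  from DERIV_mult[OF 1 2] show ?thesis
    unfolding cutoff_profile_def[abs_def] cutoff_profile'_def by (simp add: algebra_simps)
qed

lemma cutoff_profile'_le:
  assumes "1 \<le> n"
  shows "\<bar>cutoff_profile' n s\<bar> \<le> 24 * real n * indicator {s. exp (2 * s) < 1 + 2 / real n} s + 4"
proof -
  let ?a = "real n * (exp (2 * s) - 1) - 1"
  have 1: "\<bar>smoothstep' ?a * (2 * real n * exp (2 * s)) * smoothstep (real n + 1 - s)\<bar>
     \<le> 24 * real n * indicator {s. exp (2 * s) < 1 + 2 / real n} s"
  proof (cases "exp (2 * s) < 1 + 2 / real n")
    case True
    have "2 / real n \<le> 2" using assms by (simp add: divide_le_eq)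
    hence "exp (2 * s) \<le> 3" using True by linarith
    hence "\<bar>smoothstep' ?a\<bar> * (2 * real n * exp (2 * s)) * \<bar>smoothstep (real n + 1 - s)\<bar> \<le> 4 * (2 * real n * 3) * 1"
      using smoothstep'_bounds smoothstep_bounds by (intro mult_mono) auto
    thus ?thesis using True by (simp add: abs_mult)
  next
    case False
    hence "1 \<le> ?a" using assms by (simp add: field_simps)
    thus ?thesis by simp
  qed
  have 2: "\<bar>smoothstep ?a * smoothstep' (real n + 1 - s)\<bar> \<le> 1 * 4"
    unfolding abs_mult using smoothstep'_bounds smoothstep_bounds by (intro mult_mono) auto
  from 1 2 show ?thesis unfolding cutoff_profile'_def by linarith
qed

section \<open>Reflection in the unit circle\<close>

lemma ln_diff_le:
  fixes a b :: real
  assumes "0 < a" "0 < b"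
  shows "\<bar>ln a - ln b\<bar> \<le> \<bar>a - b\<bar> * (1 / a + 1 / b)"
proof -
  have *: "ln x - ln y \<le> \<bar>x - y\<bar> * (1 / x + 1 / y)" if "0 < x" "0 < y" for x y :: real
  proof -
    have "ln x - ln y = ln (x / y)" using that by (simp add: ln_div)
    also have "\<dots> \<le> x / y - 1" using that by (intro ln_le_minus_one) auto
    also have "\<dots> = (x - y) * (1 / y)" using that by (simp add: field_simps)
    also have "\<dots> \<le> \<bar>x - y\<bar> * (1 / y)" using that by (intro mult_right_mono) auto
    also have "\<dots> \<le> \<bar>x - y\<bar> * (1 / x + 1 / y)" using that by (intro mult_left_mono) auto
    finally show ?thesis .
  qed
  from *[OF assms] *[OF assms(2,1)] show ?thesis
    by (simp add: abs_minus_commute add.commute abs_le_iff)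
qed

lemma cmod_diff_sq: "(cmod (a - b))\<^sup>2 = (cmod a)\<^sup>2 + (cmod b)\<^sup>2 - 2 * (a \<bullet> b)"
  by (simp add: power2_norm_eq_inner inner_diff inner_commute algebra_simps)

lemma inner_mult_cnj: "(a * h) \<bullet> u = h \<bullet> (cnj a * u)" for a h u :: complex
  by (simp add: inner_complex_def algebra_simps)

lemma cmod_reflect: "cmod (reflect v) = 1 / cmod v"
  by (cases "v = 0") (simp_all add: reflect_def norm_divide norm_mult power2_eq_square)

lemma reflect_identity:
  assumes "v \<noteq> 0"
  shows "(cmod (w - reflect v) * cmod v)\<^sup>2 = (cmod w)\<^sup>2 * (cmod v)\<^sup>2 - 2 * (w \<bullet> v) + 1"
proof -
  have i: "w \<bullet> reflect v = (w \<bullet> v) / (cmod v)\<^sup>2"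
    by (simp add: reflect_def inner_complex_def add_divide_distrib)
  show ?thesis
    unfolding power_mult_distrib cmod_diff_sq[of w "reflect v"] i cmod_reflect using assms
    by (simp add: field_simps power2_eq_square)
qed

text \<open>The difference of the two squares is \<open>(|w|\<^sup>2 - 1) (|v|\<^sup>2 - 1)\<close>. This is the sign of the Green function.\<close>

lemma reflect_dist_ge:
  assumes "1 < cmod w" "1 < cmod v"
  shows "cmod (w - v) \<le> cmod (w - reflect v) * cmod v"
proof -
  have "0 < ((cmod w)\<^sup>2 - 1) * ((cmod v)\<^sup>2 - 1)" using assms by (intro mult_pos_pos) auto
  moreover have "v \<noteq> 0" using assms by auto
  ultimately have "(cmod (w - v))\<^sup>2 \<le> (cmod (w - reflect v) * cmod v)\<^sup>2"
    unfolding reflect_identity[OF \<open>v \<noteq> 0\<close>] cmod_diff_sq[of w v] by (simp add: algebra_simps)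
  thus ?thesis by (rule power2_le_imp_le) simp
qed

lemma reflect_dist_pos:
  assumes "1 < cmod w" "1 < cmod v"
  shows "0 < cmod (w - reflect v)"
proof -
  have "cmod (reflect v) = 1 / cmod v" by (rule cmod_reflect)
  also have "\<dots> < 1" using assms(2) by (simp add: divide_less_eq)
  finally have "cmod (reflect v) < 1" .
  hence "w \<noteq> reflect v" using assms by auto
  thus ?thesis by simp
qed

text \<open>The image charge is never much closer than the charge itself: for \<open>|v| \<ge> 2\<close> it lies in the disc of
  radius \<open>1/2\<close>, and otherwise \<open>reflect_dist_ge\<close> loses a factor of at most \<open>2\<close>.\<close>

lemma inverse_reflect_dist_le:
  assumes "1 < cmod w" "1 < cmod v" "w \<noteq> v"
  shows "1 / cmod (w - reflect v) \<le> 2 + 2 / cmod (w - v)"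
proof -
  show ?thesis
  proof (cases "2 \<le> cmod v")
    case True
    have "cmod (reflect v) = 1 / cmod v" by (rule cmod_reflect)
    also have "\<dots> \<le> 1 / 2" using True by (intro divide_left_mono) auto
    finally have "1 / 2 \<le> cmod (w - reflect v)" using norm_triangle_ineq2[of w "reflect v"] assms by linarith
    hence "1 / cmod (w - reflect v) \<le> 1 / (1/2)" by (intro divide_left_mono) auto
    hence "1 / cmod (w - reflect v) \<le> 2" by simp
    moreover have "0 \<le> 2 / cmod (w - v)" by simp
    ultimately show ?thesis by linarith
  next
    case 2: False
    have "cmod (w - v) \<le> cmod (w - reflect v) * cmod v" by (rule reflect_dist_ge[OF assms(1,2)])
    also have "\<dots> \<le> cmod (w - reflect v) * 2" using 2 by (intro mult_left_mono) auto
    finally have "1 / cmod (w - reflect v) \<le> 2 / cmod (w - v)"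
      using reflect_dist_pos[OF assms(1,2)] assms(3) by (simp add: field_simps)
    thus ?thesis by simp
  qed
qed

section \<open>The Green function of the exterior domain\<close>

text \<open>The facts on the conformal map that the estimates use. The map is assumed to be Borel measurable on the
  whole plane, which is achieved by extending it by zero.\<close>

locale exterior_map =
  fixes D :: "complex set" and T S :: "complex \<Rightarrow> complex" and B :: real
  assumes open_D: "open D"
    and T_measurable [measurable]: "T \<in> borel_measurable borel"
    and T_holomorphic: "T holomorphic_on D"
    and S_holomorphic: "S holomorphic_on {w. 1 < cmod w}"
    and cmod_T: "z \<in> D \<Longrightarrow> 1 < cmod (T z)"
    and S_in_D: "1 < cmod w \<Longrightarrow> S w \<in> D"
    and S_T: "z \<in> D \<Longrightarrow> S (T z) = z"
    and B_ge_1: "1 \<le> B"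
    and deriv_T_le: "z \<in> D \<Longrightarrow> cmod (deriv T z) \<le> B"
    and deriv_S_le: "1 < cmod w \<Longrightarrow> cmod (deriv S w) \<le> B"
begin

lemma D_measurable [measurable]: "D \<in> sets borel"
  using open_D by simp

lemma open_exterior: "open {w::complex. 1 < cmod w}"
  by (intro open_Collect_less continuous_intros)

lemma S_lipschitz_segment:
  assumes "\<And>z. z \<in> closed_segment a b \<Longrightarrow> 1 < cmod z"
  shows "cmod (S a - S b) \<le> B * cmod (a - b)"
proof (rule field_differentiable_bound[OF convex_closed_segment])
  fix z assume "z \<in> closed_segment a b"
  hence z: "1 < cmod z" by (rule assms)
  show "(S has_field_derivative deriv S z) (at z within closed_segment a b)"
    using holomorphic_derivI[OF S_holomorphic open_exterior] z has_field_derivative_at_within by blast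
  show "cmod (deriv S z) \<le> B" by (rule deriv_S_le[OF z])
qed auto

text \<open>The exterior of the disc is not convex, so the mean value inequality is applied along three segments:
  outward from \<open>w\<close> in the direction \<open>v = w / |w|\<close> by \<open>d = |w - w'|\<close>, across to the translate of \<open>w'\<close>, and back.
  For \<open>d \<le> 1\<close> none of them enters the unit disc.\<close>

lemma S_lipschitz:
  assumes "1 < cmod w" "1 < cmod w'" "cmod (w - w') \<le> 1"
  shows "cmod (S w - S w') \<le> 3 * B * cmod (w - w')"
proof -
  define d where "d = cmod (w - w')"
  define v where "v = sgn w"
  have v: "cmod v = 1" using assms(1) by (auto simp: v_def norm_sgn)
  have d: "0 \<le> d" "d \<le> 1" using assms by (auto simp: d_def)
  have wv: "w \<bullet> v = cmod w" using assms(1)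
    by (cases "w = 0") (auto simp: v_def sgn_div_norm power2_norm_eq_inner[symmetric] power2_eq_square field_simps)
  have lower: "cmod w - d \<le> z \<bullet> v" if "z = w \<or> z = w'" for z
  proof -
    have "(w - z) \<bullet> v \<le> cmod (w - z) * cmod v" by (rule norm_cauchy_schwarz)
    also have "\<dots> \<le> d" using that d v by (auto simp: d_def)
    finally show ?thesis using wv by (simp add: inner_diff_left)
  qed
  have up: "1 < cmod (z + of_real s * v)" if z: "z = w \<or> z = w'" and s: "0 \<le> s" for z s
  proof -
    have "0 \<le> z \<bullet> v" using lower[OF z] assms d by linarith
    hence "(cmod z)\<^sup>2 \<le> (cmod (z + s *\<^sub>R v))\<^sup>2" using s
      by (simp add: power2_norm_eq_inner inner_add_left inner_add_right inner_commute)
    hence "cmod z \<le> cmod (z + s *\<^sub>R v)" by (rule power2_le_imp_le) simp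
    thus ?thesis using z assms by (auto simp: scaleR_conv_of_real)
  qed
  let ?a = "w + of_real d * v" and ?b = "w' + of_real d * v"
  have radial: "cmod (S z - S (z + of_real d * v)) \<le> B * d" if z: "z = w \<or> z = w'" for z
  proof -
    have "cmod (S z - S (z + of_real d * v)) \<le> B * cmod (z - (z + of_real d * v))"
    proof (rule S_lipschitz_segment)
      fix y assume "y \<in> closed_segment z (z + of_real d * v)"
      then obtain u where u: "0 \<le> u" "u \<le> 1" "y = (1 - u) *\<^sub>R z + u *\<^sub>R (z + of_real d * v)"
        unfolding closed_segment_def by auto
      hence "y = z + of_real (u * d) * v" by (simp add: scaleR_conv_of_real algebra_simps)
      thus "1 < cmod y" using up[OF z, of "u * d"] u d by simp
    qed
    thus ?thesis using v d by (simp add: norm_mult)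
  qed
  have "cmod (S ?a - S ?b) \<le> B * cmod (?a - ?b)"
  proof (rule S_lipschitz_segment)
    fix y assume "y \<in> closed_segment ?a ?b"
    then obtain u where u: "0 \<le> u" "u \<le> 1" "y = (1 - u) *\<^sub>R ?a + u *\<^sub>R ?b"
      unfolding closed_segment_def by auto
    have "?a \<bullet> v = cmod w + d" using wv v by (simp add: inner_add_left flip: scaleR_conv_of_real power2_norm_eq_inner)
    moreover have "cmod w \<le> ?b \<bullet> v" using lower[of w'] v
      by (simp add: inner_add_left flip: scaleR_conv_of_real power2_norm_eq_inner)
    ultimately have "(1 - u) * cmod w + u * cmod w \<le> (1 - u) * (?a \<bullet> v) + u * (?b \<bullet> v)"
      using u d by (intro add_mono mult_left_mono) auto
    also have "\<dots> = y \<bullet> v" by (simp add: u(3) inner_add_left)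
    also have "\<dots> \<le> cmod y" using norm_cauchy_schwarz[of y v] v by simp
    finally show "1 < cmod y" using assms(1) by (simp add: algebra_simps)
  qed
  hence mid: "cmod (S ?a - S ?b) \<le> B * d" by (simp add: d_def)
  have "S w - S w' = (S w - S ?a) + (S ?a - S ?b) - (S w' - S ?b)" by simp
  hence "cmod (S w - S w') \<le> cmod (S w - S ?a) + cmod (S ?a - S ?b) + cmod (S w' - S ?b)"
    by (metis norm_triangle_ineq norm_triangle_ineq4 add_right_mono order_trans)
  thus ?thesis using radial[of w] radial[of w'] mid by (simp add: d_def)
qed

text \<open>Beyond distance \<open>1\<close> of the images the left side is at most \<open>1\<close>; below it the inverse map is Lipschitz.\<close>

lemma inverse_dist_T_le:
  assumes "x \<in> D" "y \<in> D"
  shows "1 / cmod (T x - T y) \<le> 3 * B * riesz_kernel x y"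
proof (cases "cmod (T x - T y) \<le> 1 \<and> x \<noteq> y")
  case True
  hence "cmod (x - y) \<le> 3 * B * cmod (T x - T y)"
    using S_lipschitz[of "T x" "T y"] cmod_T S_T assms by auto
  moreover have "T x \<noteq> T y" using S_T assms True by metis
  ultimately have "1 / cmod (T x - T y) \<le> 3 * B * (1 / cmod (x - y))"
    using True by (simp add: field_simps)
  also have "\<dots> \<le> 3 * B * riesz_kernel x y"
    using B_ge_1 by (intro mult_left_mono) (auto simp: riesz_kernel_def)
  finally show ?thesis .
next
  case False
  have "1 * 1 \<le> 3 * B * riesz_kernel x y"
    using B_ge_1 riesz_kernel_ge_1 by (intro mult_mono) auto
  moreover have "1 / cmod (T x - T y) \<le> 1" using False by (auto simp: divide_le_eq_1)
  ultimately show ?thesis by linarith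
qed

lemma inverse_dist_sum_le:
  assumes "x \<in> D" "y \<in> D" "x \<noteq> y"
  shows "1 / cmod (T x - T y) + 1 / cmod (T x - reflect (T y)) \<le> 11 * B * riesz_kernel x y"
proof -
  have "1 / cmod (T x - reflect (T y)) \<le> 2 + 2 / cmod (T x - T y)"
    by (rule inverse_reflect_dist_le) (use cmod_T assms S_T in metis)+
  moreover have "1 * 1 \<le> B * riesz_kernel x y"
    using B_ge_1 riesz_kernel_ge_1 by (intro mult_mono) auto
  ultimately show ?thesis using inverse_dist_T_le[OF assms(1,2)] by simp
qed

text \<open>Identifying vectors with complex numbers, the gradient of \<open>log |f|\<close> for holomorphic \<open>f\<close> is the conjugate of \<open>f' / f\<close>.\<close>

lemma GDERIV_ln_dist_T:
  assumes "x \<in> D" "T x \<noteq> c"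
  shows "GDERIV (\<lambda>z. ln (cmod (T z - c))) x :> cnj (deriv T x / (T x - c))"
proof -
  have "(T has_field_derivative deriv T x) (at x)"
    using holomorphic_derivI[OF T_holomorphic open_D assms(1)] .
  hence "((\<lambda>z. T z - c) has_derivative (\<lambda>h. deriv T x * h)) (at x)"
    by (auto simp: has_field_derivative_def intro!: derivative_eq_intros)
  hence "((\<lambda>z. cmod (T z - c)) has_derivative (\<lambda>h. (deriv T x * h) \<bullet> sgn (T x - c))) (at x)"
    using assms by (intro has_derivative_compose[OF _ has_derivative_norm]) auto
  moreover have "(\<lambda>h. (deriv T x * h) \<bullet> sgn (T x - c)) = (\<lambda>h. h \<bullet> (cnj (deriv T x) * sgn (T x - c)))"
    by (simp only: inner_mult_cnj)
  ultimately have "GDERIV (\<lambda>z. cmod (T z - c)) x :> cnj (deriv T x) * sgn (T x - c)"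
    by (simp add: gderiv_def)
  from GDERIV_DERIV_compose[OF this DERIV_ln_divide] assms
  have "GDERIV (\<lambda>z. ln (cmod (T z - c))) x :> (1 / cmod (T x - c)) *\<^sub>R (cnj (deriv T x) * sgn (T x - c))"
    by simp
  moreover have "(1 / cmod (T x - c)) *\<^sub>R (cnj (deriv T x) * sgn (T x - c)) = cnj (deriv T x / (T x - c))"
  proof -
    define u where "u = T x - c"
    have "u \<noteq> 0" using assms by (simp add: u_def)
    hence "u * cnj u = of_real (cmod u) * of_real (cmod u)" "cnj u \<noteq> 0"
      by (simp_all add: complex_norm_square[symmetric] power2_eq_square)
    hence "(1 / cmod u) *\<^sub>R (cnj (deriv T x) * sgn u) = cnj (deriv T x / u)"
      using \<open>u \<noteq> 0\<close> by (simp add: sgn_div_norm scaleR_conv_of_real divide_simps)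
    thus ?thesis unfolding u_def .
  qed
  ultimately show ?thesis by simp
qed

definition log_T :: "complex \<Rightarrow> real" where
  "log_T x = ln (cmod (T x))"

definition grad_log_T :: "complex \<Rightarrow> complex" where
  "grad_log_T x = cnj (deriv T x / T x)"

lemma GDERIV_log_T: "x \<in> D \<Longrightarrow> GDERIV log_T x :> grad_log_T x"
  using GDERIV_ln_dist_T[of x 0] cmod_T[of x] unfolding log_T_def[abs_def] grad_log_T_def by force

lemma log_T_measurable [measurable]: "log_T \<in> borel_measurable borel"
  unfolding log_T_def[abs_def] by measurable

lemma log_T_pos: "x \<in> D \<Longrightarrow> 0 < log_T x"
  using cmod_T[of x] unfolding log_T_def by (intro ln_gt_zero)

text \<open>Since \<open>1 + log |T| \<le> |T|\<close>, the decay of \<open>\<nabla> log |T|\<close> compensates functions of logarithmic growth;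
  this is what makes the cutoff at infinity harmless.\<close>

lemma grad_log_T_le:
  assumes "x \<in> D"
  shows "(1 + log_T x) * cmod (grad_log_T x) \<le> B"
proof -
  have T: "1 < cmod (T x)" using cmod_T assms by simp
  have "1 + log_T x \<le> cmod (T x)" using ln_le_minus_one[of "cmod (T x)"] T unfolding log_T_def by linarith
  hence "(1 + log_T x) * cmod (grad_log_T x) \<le> cmod (T x) * cmod (grad_log_T x)"
    by (intro mult_right_mono) auto
  also have "\<dots> = cmod (deriv T x)" using T by (auto simp: grad_log_T_def norm_divide)
  finally show ?thesis using deriv_T_le[OF assms] by simp
qed

lemma norm_grad_log_T_le: "x \<in> D \<Longrightarrow> cmod (grad_log_T x) \<le> B"
  using grad_log_T_le[of x] log_T_pos[of x] mult_right_mono[of 1 "1 + log_T x" "cmod (grad_log_T x)"] by simp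

definition grad_green :: "complex \<Rightarrow> complex \<Rightarrow> complex" where
  "grad_green x y = (1 / (2 * pi)) *\<^sub>R
     (cnj (deriv T x / (T x - T y)) - cnj (deriv T x / (T x - reflect (T y))))"

lemma T_eq_iff: "x \<in> D \<Longrightarrow> y \<in> D \<Longrightarrow> T x = T y \<longleftrightarrow> x = y"
  using S_T by metis

lemma green_eq:
  assumes "x \<in> D" "y \<in> D" "x \<noteq> y"
  shows "green T x y = 1 / (2 * pi) * (ln (cmod (T x - T y)) - ln (cmod (T x - reflect (T y))) - ln (cmod (T y)))"
proof -
  have "0 < cmod (T x - T y)" "0 < cmod (T x - reflect (T y))" "0 < cmod (T y)"
    using assms T_eq_iff reflect_dist_pos[of "T x" "T y"] cmod_T[of x] cmod_T[of y] by auto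
  thus ?thesis unfolding green_def by (subst ln_div) (auto simp: ln_mult)
qed

lemma GDERIV_green:
  assumes "x \<in> D" "y \<in> D" "x \<noteq> y"
  shows "GDERIV (\<lambda>z. green T z y) x :> grad_green x y"
proof -
  have ne: "T x \<noteq> T y" "T x \<noteq> reflect (T y)"
    using assms T_eq_iff reflect_dist_pos[of "T x" "T y"] cmod_T[of x] cmod_T[of y] by auto
  have "GDERIV (\<lambda>z. ln (cmod (T z - T y)) - ln (cmod (T z - reflect (T y)))) x :>
      cnj (deriv T x / (T x - T y)) - cnj (deriv T x / (T x - reflect (T y)))"
    by (intro GDERIV_diff GDERIV_ln_dist_T assms ne)
  from GDERIV_diff[OF this GDERIV_const[of "ln (cmod (T y))"]]
  have "GDERIV (\<lambda>z. ln (cmod (T z - T y)) - ln (cmod (T z - reflect (T y))) - ln (cmod (T y))) x :>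
      cnj (deriv T x / (T x - T y)) - cnj (deriv T x / (T x - reflect (T y)))" by simp
  from GDERIV_mult[OF GDERIV_const this, of "1 / (2 * pi)"]
  have "GDERIV (\<lambda>z. 1 / (2 * pi) * (ln (cmod (T z - T y)) - ln (cmod (T z - reflect (T y))) - ln (cmod (T y)))) x :> grad_green x y"
    by (simp add: grad_green_def)
  thus ?thesis unfolding gderiv_def
  proof (rule has_derivative_transform_within_open)
    show "open (D - {y})" using open_D by auto
  qed (use assms green_eq in auto)
qed

lemma norm_grad_green_le:
  assumes "x \<in> D" "y \<in> D" "x \<noteq> y"
  shows "cmod (grad_green x y) \<le> 2 * B\<^sup>2 * riesz_kernel x y"
proof -
  have "cmod (grad_green x y) \<le> 1 / (2 * pi) * (cmod (deriv T x) / cmod (T x - T y) + cmod (deriv T x) / cmod (T x - reflect (T y)))"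
    unfolding grad_green_def
    by (simp, intro divide_right_mono order_trans[OF norm_triangle_ineq4]) (simp_all add: norm_divide flip: complex_cnj_diff)
  also have "\<dots> = 1 / (2 * pi) * (cmod (deriv T x) * (1 / cmod (T x - T y) + 1 / cmod (T x - reflect (T y))))"
    by (simp add: algebra_simps)
  also have "\<dots> \<le> 1 / (2 * 3) * (B * (11 * B * riesz_kernel x y))"
    using B_ge_1 pi_gt3 deriv_T_le assms inverse_dist_sum_le[OF assms]
    by (intro mult_mono divide_left_mono) auto
  also have "\<dots> \<le> 2 * B\<^sup>2 * riesz_kernel x y"
  proof -
    have "0 \<le> B\<^sup>2 * riesz_kernel x y" using riesz_kernel_ge_1[of x y] by auto
    thus ?thesis by (simp add: power2_eq_square)
  qed
  finally show ?thesis .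
qed

text \<open>A difference bound that holds for every \<open>y\<close> outside \<open>{x, x'}\<close>, however close, is what differentiation under the
  integral sign needs at the singularity.\<close>

lemma green_diff_le:
  assumes "x \<in> D" "x' \<in> D" "y \<in> D" "y \<noteq> x" "y \<noteq> x'"
    and seg: "closed_segment x x' \<subseteq> D"
  shows "\<bar>green T x' y - green T x y\<bar> \<le> 2 * B\<^sup>2 * cmod (x' - x) * (riesz_kernel x y + riesz_kernel x' y)"
proof -
  have Tl: "cmod (T x' - T x) \<le> B * cmod (x' - x)"
  proof (rule field_differentiable_bound[OF convex_closed_segment])
    fix z assume "z \<in> closed_segment x x'"
    hence z: "z \<in> D" using seg by auto
    show "(T has_field_derivative deriv T z) (at z within closed_segment x x')"
      using holomorphic_derivI[OF T_holomorphic open_D z] has_field_derivative_at_within by blast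
    show "cmod (deriv T z) \<le> B" by (rule deriv_T_le[OF z])
  qed auto
  have *: "\<bar>ln (cmod (T x' - c)) - ln (cmod (T x - c))\<bar> \<le> cmod (T x' - T x) * (1 / cmod (T x' - c) + 1 / cmod (T x - c))"
    if "0 < cmod (T x' - c)" "0 < cmod (T x - c)" for c
  proof -
    have "\<bar>cmod (T x' - c) - cmod (T x - c)\<bar> \<le> cmod (T x' - T x)"
      using norm_triangle_ineq3[of "T x' - c" "T x - c"] by simp
    hence "\<bar>cmod (T x' - c) - cmod (T x - c)\<bar> * (1 / cmod (T x' - c) + 1 / cmod (T x - c))
       \<le> cmod (T x' - T x) * (1 / cmod (T x' - c) + 1 / cmod (T x - c))" by (intro mult_right_mono) auto
    thus ?thesis using ln_diff_le[OF that] by linarith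
  qed
  have pos: "0 < cmod (T z - T y)" "0 < cmod (T z - reflect (T y))" if "z = x \<or> z = x'" for z
    using that assms T_eq_iff reflect_dist_pos[of "T z" "T y"] cmod_T[of z] cmod_T[of y] by auto
  let ?d = "cmod (T x' - T x)"
  let ?s = "\<lambda>z. 1 / cmod (T z - T y) + 1 / cmod (T z - reflect (T y))"
  have "\<bar>green T x' y - green T x y\<bar> = 1 / (2 * pi) *
     \<bar>(ln (cmod (T x' - T y)) - ln (cmod (T x - T y))) - (ln (cmod (T x' - reflect (T y))) - ln (cmod (T x - reflect (T y))))\<bar>"
    using assms by (simp add: green_eq flip: right_diff_distrib diff_divide_distrib)
  also have "\<dots> \<le> 1 / (2 * pi) * (?d * (?s x' + ?s x))"
  proof (rule mult_left_mono)
    show "\<bar>(ln (cmod (T x' - T y)) - ln (cmod (T x - T y))) - (ln (cmod (T x' - reflect (T y))) - ln (cmod (T x - reflect (T y))))\<bar> \<le> ?d * (?s x' + ?s x)"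
      using *[OF pos(1)[OF disjI2[OF refl]] pos(1)[OF disjI1[OF refl]]]
        *[OF pos(2)[OF disjI2[OF refl]] pos(2)[OF disjI1[OF refl]]]
      by (simp only: distrib_left)
  qed auto
  also have "\<dots> \<le> 1 / (2 * 3) * ((B * cmod (x' - x)) * (11 * B * riesz_kernel x' y + 11 * B * riesz_kernel x y))"
    using Tl assms B_ge_1 pi_gt3
    by (intro mult_mono divide_left_mono add_mono inverse_dist_sum_le) auto
  also have "\<dots> \<le> 2 * B\<^sup>2 * cmod (x' - x) * (riesz_kernel x y + riesz_kernel x' y)"
  proof -
    have "0 \<le> B\<^sup>2 * cmod (x' - x) * (riesz_kernel x y + riesz_kernel x' y)"
      using riesz_kernel_ge_1[of x y] riesz_kernel_ge_1[of x' y] by (intro mult_nonneg_nonneg) auto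
    thus ?thesis by (simp add: power2_eq_square algebra_simps)
  qed
  finally show ?thesis .
qed

lemma green_commute:
  assumes "x \<in> D" "y \<in> D"
  shows "green T x y = green T y x"
proof -
  have nz: "T x \<noteq> 0" "T y \<noteq> 0" using cmod_T assms by force+
  have "(cmod (T x - reflect (T y)) * cmod (T y))\<^sup>2 = (cmod (T y - reflect (T x)) * cmod (T x))\<^sup>2"
    unfolding reflect_identity[OF nz(1)] reflect_identity[OF nz(2)] by (simp add: inner_commute)
  hence "cmod (T x - reflect (T y)) * cmod (T y) = cmod (T y - reflect (T x)) * cmod (T x)"
    by (rule power2_eq_imp_eq) auto
  thus ?thesis unfolding green_def by (simp add: norm_minus_commute)
qed

lemma green_le_0:
  assumes "x \<in> D" "y \<in> D"
  shows "green T x y \<le> 0"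
proof -
  let ?q = "cmod (T x - T y) / (cmod (T x - reflect (T y)) * cmod (T y))"
  have "0 < cmod (T x - reflect (T y)) * cmod (T y)"
    using reflect_dist_pos[of "T x" "T y"] cmod_T[of x] cmod_T[of y] assms by (intro mult_pos_pos) auto
  hence "?q \<le> 1" using reflect_dist_ge[of "T x" "T y"] cmod_T assms by simp
  moreover have "0 \<le> ?q" by simp
  ultimately have "ln ?q \<le> 0" by (cases "?q = 0") auto
  thus ?thesis unfolding green_def by (intro mult_nonneg_nonpos) auto
qed

text \<open>The source of the coefficient \<open>m\<close> in the final estimate: up to the integrable singularity, \<open>- G\<close> is at most
  \<open>(log |T x| + log |T y|) / (2 \<pi>)\<close>.\<close>

lemma green_lower_bound:
  assumes "x \<in> D" "y \<in> D"
  shows "- green T x y \<le> 1 / (2 * pi) * (log_T x + log_T y + 4 * B * riesz_kernel x y)"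
proof (cases "x = y")
  case True
  have "0 \<le> B * riesz_kernel x y" using B_ge_1 riesz_kernel_ge_1[of x y] by simp
  thus ?thesis using True log_T_pos[OF assms(1)] log_T_pos[OF assms(2)] by (simp add: green_def)
next
  case False
  have T: "1 < cmod (T x)" "1 < cmod (T y)" using cmod_T assms by auto
  have pos: "0 < cmod (T x - T y)" "0 < cmod (T x - reflect (T y))"
    using assms False T_eq_iff reflect_dist_pos[of "T x" "T y"] T by auto
  have "cmod (reflect (T y)) * cmod (T y) = 1" using T by (auto simp: cmod_reflect)
  moreover have "cmod (T x - reflect (T y)) * cmod (T y) \<le> (cmod (T x) + cmod (reflect (T y))) * cmod (T y)"
    by (intro mult_right_mono norm_triangle_ineq4) auto
  ultimately have "cmod (T x - reflect (T y)) * cmod (T y) \<le> cmod (T x) * cmod (T y) + 1"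
    by (simp add: algebra_simps)
  also have "\<dots> \<le> 2 * (cmod (T x) * cmod (T y))"
    using mult_mono[of 1 "cmod (T x)" 1 "cmod (T y)"] T by simp
  finally have "ln (cmod (T x - reflect (T y)) * cmod (T y)) \<le> ln (2 * (cmod (T x) * cmod (T y)))"
    using mult_pos_pos[OF pos(2), of "cmod (T y)"] T(2) by (intro ln_mono) linarith+
  hence 1: "ln (cmod (T x - reflect (T y))) + ln (cmod (T y)) \<le> ln 2 + log_T x + log_T y"
  proof -
    have "0 < cmod (T x)" "0 < cmod (T y)" using T by linarith+
    thus ?thesis using \<open>ln (cmod (T x - reflect (T y)) * cmod (T y)) \<le> _\<close> pos(2)
      by (simp add: ln_mult log_T_def)
  qed
  have 2: "- ln (cmod (T x - T y)) \<le> 1 / cmod (T x - T y)"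
    using ln_le_minus_one[of "1 / cmod (T x - T y)"] pos by (simp add: ln_div)
  have "1 \<le> B * riesz_kernel x y"
    using mult_mono[of 1 B 1 "riesz_kernel x y"] B_ge_1 riesz_kernel_ge_1[of x y] by simp
  moreover have "ln (2::real) \<le> 1" using ln_le_minus_one[of 2] by simp
  ultimately have "ln (cmod (T x - reflect (T y))) + ln (cmod (T y)) - ln (cmod (T x - T y))
      \<le> log_T x + log_T y + 4 * B * riesz_kernel x y"
    using 1 2 inverse_dist_T_le[OF assms] by linarith
  hence "1 / (2 * pi) * (ln (cmod (T x - reflect (T y))) + ln (cmod (T y)) - ln (cmod (T x - T y)))
      \<le> 1 / (2 * pi) * (log_T x + log_T y + 4 * B * riesz_kernel x y)"
    by (intro mult_left_mono) auto
  thus ?thesis unfolding green_eq[OF assms False] by (simp add: algebra_simps)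
qed

section \<open>Cutoffs of the exterior domain\<close>

definition strip :: "nat \<Rightarrow> complex set" where
  "strip n = {x\<in>D. (cmod (T x))\<^sup>2 < 1 + 2 / real n}"

text \<open>The annulus \<open>1 < |w|\<^sup>2 < 1 + 2 / n\<close> is covered by \<open>n\<close> discs of radius \<open>8 / n\<close> centred at roots of unity.
  By \<open>S_lipschitz\<close> the inverse map sends each piece into a disc of radius \<open>48 B / n\<close>; this needs pieces of diameter
  at most \<open>1\<close>, hence \<open>n \<ge> 16\<close>.\<close>

lemma strip_area:
  "\<exists>C\<ge>0. \<forall>n\<ge>16. emeasure lborel (strip n) \<le> ennreal (C / real n)"
proof (intro exI[of _ "pi * (48 * B)\<^sup>2"] conjI allI impI)
  show "0 \<le> pi * (48 * B)\<^sup>2" by simp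
  fix n :: nat assume n: "16 \<le> n"
  define \<zeta> where "\<zeta> j = cis (2 * pi * real j / real n)" for j
  define U where "U j = {x\<in>D. cmod (T x - \<zeta> j) \<le> 8 / real n}" for j
  have U: "\<exists>p. U j \<subseteq> cball p (48 * B / real n)" for j
  proof (cases "U j = {}")
    case False
    then obtain p where p: "p \<in> U j" by auto
    have "cmod (p - x) \<le> 48 * B / real n" if x: "x \<in> U j" for x
    proof -
      have d: "cmod (T p - T x) \<le> 16 / real n"
        using p x norm_triangle_ineq4[of "T p - \<zeta> j" "T x - \<zeta> j"] by (simp add: U_def)
      also have "\<dots> \<le> 1" using n by simp
      finally have "cmod (S (T p) - S (T x)) \<le> 3 * B * cmod (T p - T x)"
        using p x cmod_T by (intro S_lipschitz) (auto simp: U_def)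
      also have "\<dots> \<le> 3 * B * (16 / real n)" using d B_ge_1 by (intro mult_left_mono) auto
      finally show ?thesis using p x S_T by (simp add: U_def)
    qed
    thus ?thesis by (intro exI[of _ p]) (auto simp: dist_norm)
  qed auto
  then obtain p where p: "\<And>j. U j \<subseteq> cball (p j) (48 * B / real n)" by metis
  have "strip n \<subseteq> (\<Union>j<n. cball (p j) (48 * B / real n))"
  proof
    fix x assume "x \<in> strip n"
    hence x: "x \<in> D" "(cmod (T x))\<^sup>2 < 1 + 2 / real n" by (auto simp: strip_def)
    define w where "w = T x"
    have "1 + 2 / real n \<le> (1 + 1 / real n)\<^sup>2" using n by (simp add: power2_eq_square field_simps)
    hence "(cmod w)\<^sup>2 < (1 + 1 / real n)\<^sup>2" using x unfolding w_def by linarith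
    hence w1: "cmod w < 1 + 1 / real n" by (rule power_less_imp_less_base) auto
    have w: "1 < cmod w" using cmod_T x by (simp add: w_def)
    define \<theta> where "\<theta> = Arg2pi w"
    have \<theta>: "0 \<le> \<theta>" "\<theta> < 2 * pi" by (auto simp: \<theta>_def Arg2pi_ge_0 Arg2pi_lt_2pi)
    have wc: "w = of_real (cmod w) * cis \<theta>" using Arg2pi[of w] by (simp add: \<theta>_def cis_conv_exp is_Arg_def)
    define j where "j = nat \<lfloor>\<theta> * real n / (2 * pi)\<rfloor>"
    have fl: "real j \<le> \<theta> * real n / (2 * pi)" "\<theta> * real n / (2 * pi) < real j + 1"
      unfolding j_def using \<theta> by (auto simp: of_nat_nat intro!: real_of_int_floor_add_one_gt floor_correct)
    have "\<theta> * real n / (2 * pi) < real n" using \<theta> n by (simp add: field_simps)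
    hence jn: "j < n" using fl by linarith
    have "\<bar>\<theta> - 2 * pi * real j / real n\<bar> \<le> 2 * pi / real n"
    proof -
      have "0 \<le> \<theta> - 2 * pi * real j / real n" using fl(1) n by (simp add: field_simps)
      moreover have "\<theta> - 2 * pi * real j / real n = (\<theta> * real n / (2 * pi) - real j) * (2 * pi / real n)"
        using n by (simp add: field_simps)
      moreover have "(\<theta> * real n / (2 * pi) - real j) * (2 * pi / real n) \<le> 1 * (2 * pi / real n)"
        using fl(2) by (intro mult_right_mono) auto
      ultimately show ?thesis by linarith
    qed
    moreover have "cmod (cis \<theta> - \<zeta> j) \<le> \<bar>\<theta> - 2 * pi * real j / real n\<bar>"
    proof -
      define a where "a = 2 * pi * real j / real n"
      have "cis \<theta> - cis a = cis a * (cis (\<theta> - a) - 1)" by (simp add: algebra_simps cis_mult)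
      hence "cmod (cis \<theta> - cis a) = cmod (cis (\<theta> - a) - 1)" by (simp add: norm_mult)
      also have "\<dots> \<le> \<bar>\<theta> - a\<bar>" using dist_exp_i_1[of "\<theta> - a"] abs_sin_x_le_abs_x[of "(\<theta> - a) / 2"]
          by (simp add: cis_conv_exp)
      finally show ?thesis by (simp add: \<zeta>_def a_def)
    qed
    moreover have "cmod (w - cis \<theta>) = cmod w - 1"
    proof -
      have "w - cis \<theta> = of_real (cmod w - 1) * cis \<theta>" using wc by (simp add: algebra_simps)
      hence "cmod (w - cis \<theta>) = \<bar>cmod w - 1\<bar>" by (metis norm_mult norm_cis norm_of_real mult.right_neutral)
      thus ?thesis using w by simp
    qed
    moreover have "cmod (w - \<zeta> j) \<le> cmod (w - cis \<theta>) + cmod (cis \<theta> - \<zeta> j)"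
      using norm_triangle_ineq[of "w - cis \<theta>" "cis \<theta> - \<zeta> j"] by simp
    ultimately have "cmod (w - \<zeta> j) \<le> 1 / real n + 2 * pi / real n" using w1 by linarith
    also have "\<dots> \<le> 8 / real n"
      using n pi_approx by (simp add: divide_right_mono flip: add_divide_distrib)
    finally have "x \<in> U j" using x by (simp add: U_def w_def)
    thus "x \<in> (\<Union>j<n. cball (p j) (48 * B / real n))" using p jn by blast
  qed
  hence "emeasure lborel (strip n) \<le> emeasure lborel (\<Union>j<n. cball (p j) (48 * B / real n))"
    by (intro emeasure_mono) auto
  also have "\<dots> \<le> (\<Sum>j<n. emeasure lborel (cball (p j) (48 * B / real n)))"
    by (intro emeasure_subadditive_finite) auto
  also have "\<dots> = (\<Sum>j<n. ennreal (pi * (48 * B / real n)\<^sup>2))"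
    using B_ge_1 by (simp add: emeasure_cball unit_ball_vol_2)
  also have "\<dots> = ennreal (real n * (pi * (48 * B / real n)\<^sup>2))"
    by (simp add: ennreal_of_nat_eq_real_of_nat ennreal_mult)
  also have "real n * (pi * (48 * B / real n)\<^sup>2) = pi * (48 * B)\<^sup>2 / real n"
    using n by (simp add: power2_eq_square field_simps)
  finally show "emeasure lborel (strip n) \<le> ennreal (pi * (48 * B)\<^sup>2 / real n)" .
qed

definition cutoff :: "nat \<Rightarrow> complex \<Rightarrow> real" where
  "cutoff n x = (if x \<in> D then cutoff_profile n (log_T x) else 0)"

definition grad_cutoff :: "nat \<Rightarrow> complex \<Rightarrow> complex" where
  "grad_cutoff n x = (if x \<in> D then cutoff_profile' n (log_T x) *\<^sub>R grad_log_T x else 0)"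

text \<open>The preimage of a closed annulus under the conformal map, written as an image under its inverse so that
  compactness is immediate.\<close>

definition cutoff_support :: "nat \<Rightarrow> complex set" where
  "cutoff_support n = S ` {w. 1 + 1 / real n \<le> (cmod w)\<^sup>2 \<and> cmod w \<le> exp (real n + 1)}"

lemma cutoff_support:
  assumes "1 \<le> n"
  shows "compact (cutoff_support n)" "cutoff_support n \<subseteq> D"
    "x \<notin> cutoff_support n \<Longrightarrow> cutoff n x = 0" "x \<notin> cutoff_support n \<Longrightarrow> grad_cutoff n x = 0"
proof -
  let ?A = "{w::complex. 1 + 1 / real n \<le> (cmod w)\<^sup>2 \<and> cmod w \<le> exp (real n + 1)}"
  have A: "?A \<subseteq> {w. 1 < cmod w}"
  proof safe
    fix w :: complex assume "1 + 1 / real n \<le> (cmod w)\<^sup>2"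
    moreover have "0 < 1 / real n" using assms by simp
    ultimately have "1\<^sup>2 < (cmod w)\<^sup>2" by (simp only: power_one)
    thus "1 < cmod w" by (rule power_less_imp_less_base) simp
  qed
  have "compact ?A"
  proof (rule compact_eq_bounded_closed[THEN iffD2], intro conjI)
    show "bounded ?A" by (rule boundedI[where B = "exp (real n + 1)"]) auto
    show "closed ?A" by (intro closed_Collect_conj closed_Collect_le continuous_intros)
  qed
  moreover have "continuous_on ?A S"
    using holomorphic_on_imp_continuous_on[OF S_holomorphic] A by (rule continuous_on_subset)
  ultimately show "compact (cutoff_support n)"
    unfolding cutoff_support_def by (intro compact_continuous_image)
  show "cutoff_support n \<subseteq> D" unfolding cutoff_support_def using A S_in_D by auto
  have *: "cutoff n x = 0 \<and> grad_cutoff n x = 0" if "x \<notin> cutoff_support n"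
  proof (cases "x \<in> D")
    case True
    have T: "1 < cmod (T x)" using cmod_T True by simp
    have e: "exp (2 * log_T x) = (cmod (T x))\<^sup>2" "exp (log_T x) = cmod (T x)"
      using order.strict_trans[OF zero_less_one T] by (simp_all only: log_T_def exp_double exp_ln)
    have "T x \<notin> ?A" using that S_T[OF True] unfolding cutoff_support_def by force
    hence "real n * (exp (2 * log_T x) - 1) - 1 \<le> 0 \<or> real n + 1 - log_T x \<le> 0"
    proof -
      consider "(cmod (T x))\<^sup>2 < 1 + 1 / real n" | "exp (real n + 1) < cmod (T x)"
        using \<open>T x \<notin> ?A\<close> by auto
      thus ?thesis
      proof cases
        case 1
        hence "real n * (exp (2 * log_T x) - 1) \<le> 1" unfolding e using assms by (simp add: field_simps)
        thus ?thesis by simp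
      next
        case 2
        hence "real n + 1 < log_T x" unfolding e(2)[symmetric] by simp
        thus ?thesis by simp
      qed
    qed
    thus ?thesis by (auto simp: cutoff_def grad_cutoff_def cutoff_profile_def cutoff_profile'_def)
  qed (auto simp: cutoff_def grad_cutoff_def)
  show "x \<notin> cutoff_support n \<Longrightarrow> cutoff n x = 0" "x \<notin> cutoff_support n \<Longrightarrow> grad_cutoff n x = 0"
    using * by auto
qed

lemma GDERIV_cutoff_D: "x \<in> D \<Longrightarrow> GDERIV (cutoff n) x :> grad_cutoff n x"
proof -
  assume x: "x \<in> D"
  have "GDERIV (\<lambda>x. cutoff_profile n (log_T x)) x :> grad_cutoff n x"
    using GDERIV_DERIV_compose[OF GDERIV_log_T[OF x] DERIV_cutoff_profile] x by (simp add: grad_cutoff_def)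
  thus ?thesis unfolding gderiv_def
    by (rule has_derivative_transform_within_open[OF _ open_D x]) (auto simp: cutoff_def)
qed

lemma cutoff_bounds: "0 \<le> cutoff n x" "cutoff n x \<le> 1"
  unfolding cutoff_def cutoff_profile_def
  using smoothstep_bounds by (auto intro!: mult_le_one)

lemma norm_grad_cutoff_le:
  assumes "x \<in> D" "1 \<le> n"
  shows "(1 + log_T x) * cmod (grad_cutoff n x) \<le> B * (24 * real n * indicator (strip n) x + 4)"
proof -
  have e: "exp (2 * log_T x) = (cmod (T x))\<^sup>2"
    using cmod_T[OF assms(1)] order.strict_trans[OF zero_less_one cmod_T[OF assms(1)]]
    by (simp only: log_T_def exp_double exp_ln)
  have "(1 + log_T x) * cmod (grad_cutoff n x) = ((1 + log_T x) * cmod (grad_log_T x)) * \<bar>cutoff_profile' n (log_T x)\<bar>"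
    using assms by (simp add: grad_cutoff_def)
  also have "\<dots> \<le> B * (24 * real n * indicator {s. exp (2 * s) < 1 + 2 / real n} (log_T x) + 4)"
    using B_ge_1 log_T_pos[OF assms(1)]
    by (intro mult_mono grad_log_T_le cutoff_profile'_le assms) auto
  also have "indicator {s. exp (2 * s) < 1 + 2 / real n} (log_T x) = (indicator (strip n) x :: real)"
    using assms e by (auto simp: indicator_def strip_def)
  finally show ?thesis .
qed

lemma cutoff_eventually_1:
  assumes "compact K" "K \<subseteq> D"
  shows "\<forall>\<^sub>F n in sequentially. \<forall>x\<in>K. cutoff n x = 1 \<and> grad_cutoff n x = 0"
proof (cases "K = {}")
  case False
  have "continuous_on K log_T"
    using GDERIV_continuous[OF GDERIV_log_T] assms by (auto intro!: continuous_at_imp_continuous_on)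
  then obtain a b where a: "a \<in> K" "\<And>x. x \<in> K \<Longrightarrow> log_T a \<le> log_T x" and b: "\<And>x. x \<in> K \<Longrightarrow> log_T x \<le> log_T b"
    using continuous_attains_inf[OF assms(1) False] continuous_attains_sup[OF assms(1) False] by metis
  have "0 < exp (2 * log_T a) - 1" using log_T_pos a assms by auto
  then obtain N1 where N1: "2 / (exp (2 * log_T a) - 1) < real N1" using reals_Archimedean2 by blast
  obtain N2 where N2: "log_T b < real N2" using reals_Archimedean2 by blast
  have "\<forall>x\<in>K. cutoff n x = 1 \<and> grad_cutoff n x = 0" if n: "n \<ge> max N1 N2" for n
  proof
    fix x assume x: "x \<in> K"
    have "2 \<le> real n * (exp (2 * log_T a) - 1)"
    proof -
      have "2 / (exp (2 * log_T a) - 1) < real n" using N1 n by (meson max.boundedE of_nat_mono order_less_le_trans)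
      thus ?thesis using \<open>0 < exp (2 * log_T a) - 1\<close> by (simp add: divide_less_eq)
    qed
    also have "\<dots> \<le> real n * (exp (2 * log_T x) - 1)" using a(2)[OF x] by (intro mult_left_mono) auto
    finally have 1: "1 \<le> real n * (exp (2 * log_T x) - 1) - 1" by simp
    have "real N2 \<le> real n" using n by simp
    hence 2: "1 \<le> real n + 1 - log_T x" using b[OF x] N2 by linarith
    show "cutoff n x = 1 \<and> grad_cutoff n x = 0"
      using 1 2 x assms by (auto simp: cutoff_def grad_cutoff_def cutoff_profile_def cutoff_profile'_def)
  qed
  thus ?thesis unfolding eventually_sequentially by blast
qed auto

section \<open>Green potentials of compactly supported densities\<close>

definition compact_density :: "(complex \<Rightarrow> real) \<Rightarrow> bool" where
  "compact_density g \<longleftrightarrow> g \<in> borel_measurable borel \<and> (\<exists>M. \<forall>y. \<bar>g y\<bar> \<le> M) \<and>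
     (\<exists>K. compact K \<and> K \<subseteq> D \<and> (\<forall>y. y \<notin> K \<longrightarrow> g y = 0))"

lemma compact_densityI:
  assumes "g \<in> borel_measurable borel" "\<And>y. \<bar>g y\<bar> \<le> M" "compact K" "K \<subseteq> D" "\<And>y. y \<notin> K \<Longrightarrow> g y = 0"
  shows "compact_density g"
  using assms unfolding compact_density_def by blast

lemma compact_density_measurable: "compact_density g \<Longrightarrow> g \<in> borel_measurable borel"
  by (simp add: compact_density_def)

lemma compact_density_off_D: "compact_density g \<Longrightarrow> y \<notin> D \<Longrightarrow> g y = 0"
  unfolding compact_density_def by blast

lemma integrable_mult_compact_density:
  assumes "compact_density g" "f \<in> borel_measurable borel"
    "\<And>K. compact K \<Longrightarrow> K \<subseteq> D \<Longrightarrow> \<exists>C. \<forall>y\<in>K. \<bar>f y\<bar> \<le> C"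
  shows "integrable lborel (\<lambda>y. f y * g y)"
proof -
  have [measurable]: "g \<in> borel_measurable borel" "f \<in> borel_measurable borel"
    using assms by (auto simp: compact_density_def)
  obtain M K where M: "\<And>y. \<bar>g y\<bar> \<le> M" and K: "compact K" "K \<subseteq> D" "\<And>y. y \<notin> K \<Longrightarrow> g y = 0"
    using assms(1) unfolding compact_density_def by blast
  obtain C where C: "\<And>y. y \<in> K \<Longrightarrow> \<bar>f y\<bar> \<le> C" using assms(3)[OF K(1,2)] by blast
  have "integrable lborel (\<lambda>y. (\<bar>C\<bar> * M) * indicator K y)"
    using K by (intro integrable_mult_right integrable_real_indicator emeasure_compact_finite) (auto intro: borel_compact)
  thus ?thesis
  proof (rule Bochner_Integration.integrable_bound)
    show "AE y in lborel. norm (f y * g y) \<le> norm ((\<bar>C\<bar> * M) * indicator K y)"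
    proof (rule AE_I2)
      fix y show "norm (f y * g y) \<le> norm ((\<bar>C\<bar> * M) * indicator K y)"
      proof (cases "y \<in> K")
        case True
        have "\<bar>f y\<bar> * \<bar>g y\<bar> \<le> \<bar>C\<bar> * \<bar>M\<bar>" using C[OF True] M[of y] by (intro mult_mono) auto
        thus ?thesis using True by (simp add: abs_mult)
      qed (simp add: K)
    qed
  qed measurable
qed

lemma integrable_compact_density: "compact_density g \<Longrightarrow> integrable lborel g"
  using integrable_mult_compact_density[of g "\<lambda>_. 1"] by auto

lemma bounded_on_compact:
  fixes f :: "complex \<Rightarrow> real"
  assumes "\<And>x. x \<in> D \<Longrightarrow> isCont f x" "compact K" "K \<subseteq> D"
  shows "\<exists>C. \<forall>y\<in>K. \<bar>f y\<bar> \<le> C"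
proof -
  have "continuous_on K f" using assms by (auto intro!: continuous_at_imp_continuous_on)
  hence "bounded (f ` K)" using assms(2) by (intro compact_imp_bounded compact_continuous_image)
  thus ?thesis unfolding bounded_iff by (metis imageI real_norm_def)
qed

lemma integrable_log_T_mult: "compact_density g \<Longrightarrow> integrable lborel (\<lambda>y. log_T y * g y)"
  by (intro integrable_mult_compact_density bounded_on_compact)
    (auto intro: GDERIV_continuous[OF GDERIV_log_T])

lemma compact_density_diff:
  assumes "compact_density f" "compact_density g"
  shows "compact_density (\<lambda>y. f y - g y)"
proof -
  obtain M K where M: "\<And>y. \<bar>f y\<bar> \<le> M" and K: "compact K" "K \<subseteq> D" "\<And>y. y \<notin> K \<Longrightarrow> f y = 0"
    using assms(1) unfolding compact_density_def by blast
  obtain M' K' where M': "\<And>y. \<bar>g y\<bar> \<le> M'" and K': "compact K'" "K' \<subseteq> D" "\<And>y. y \<notin> K' \<Longrightarrow> g y = 0"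
    using assms(2) unfolding compact_density_def by blast
  show ?thesis
  proof (rule compact_densityI)
    show "\<bar>f y - g y\<bar> \<le> M + M'" for y using M[of y] M'[of y] by linarith
    show "compact (K \<union> K')" "K \<union> K' \<subseteq> D" using K K' by auto
  qed (use assms K K' in \<open>auto simp: compact_density_def\<close>)
qed

lemma compact_density_abs: "compact_density g \<Longrightarrow> compact_density (\<lambda>y. \<bar>g y\<bar>)"
  unfolding compact_density_def by auto

lemma compact_density_indicator:
  assumes "compact_density g" "A \<in> sets borel"
  shows "compact_density (\<lambda>y. indicator A y * g y)"
proof -
  obtain M K where M: "\<And>y. \<bar>g y\<bar> \<le> M" and K: "compact K" "K \<subseteq> D" "\<And>y. y \<notin> K \<Longrightarrow> g y = 0"
    using assms(1) unfolding compact_density_def by blast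
  have [measurable]: "g \<in> borel_measurable borel" "A \<in> sets borel"
    using assms by (auto simp: compact_density_def)
  show ?thesis
  proof (rule compact_densityI[OF _ _ K(1,2)])
    show "\<bar>indicator A y * g y\<bar> \<le> M" for y using M[of y] by (auto simp: indicator_def split: if_splits)
  qed (use K in auto)
qed

lemma integrable_riesz_kernel_density:
  assumes "compact_density g" shows "integrable lborel (\<lambda>y. riesz_kernel x y * \<bar>g y\<bar>)"
proof -
  obtain M where M: "\<And>y. \<bar>g y\<bar> \<le> M" using assms unfolding compact_density_def by blast
  show ?thesis by (rule integrable_riesz_kernel[OF integrable_compact_density[OF assms] M, of 1]) simp
qed

lemma green_measurable [measurable]:
  "(\<lambda>y. green T x y) \<in> borel_measurable borel"
  "(\<lambda>z. green T (fst z) (snd z)) \<in> borel_measurable (borel \<Otimes>\<^sub>M borel)"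
  unfolding green_def[abs_def] reflect_def by measurable

lemma abs_green_le:
  assumes "x \<in> D" "y \<in> D"
  shows "\<bar>green T x y\<bar> \<le> 1 / (2 * pi) * (log_T x + log_T y + 4 * B * riesz_kernel x y)"
  using green_lower_bound[OF assms] green_le_0[OF assms] by simp

lemma
  assumes g: "compact_density g" and x: "x \<in> D" and M: "\<And>y. \<bar>g y\<bar> \<le> M"
  shows integrable_green_mult: "integrable lborel (\<lambda>y. green T x y * g y)"
    and integral_abs_green_le: "(LBINT y. \<bar>green T x y * g y\<bar>) \<le>
      1 / (2 * pi) * (log_T x * (LBINT y. \<bar>g y\<bar>) + (LBINT y. log_T y * \<bar>g y\<bar>)
        + 4 * B * (2 * (LBINT y. \<bar>g y\<bar>) + 4 * pi * M))"
proof -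
  have [measurable]: "g \<in> borel_measurable borel" using g by (rule compact_density_measurable)
  let ?b = "\<lambda>y. 1 / (2 * pi) * (log_T x * \<bar>g y\<bar> + log_T y * \<bar>g y\<bar> + 4 * B * (riesz_kernel x y * \<bar>g y\<bar>))"
  note i = integrable_abs[OF integrable_compact_density[OF g]] integrable_log_T_mult[OF compact_density_abs[OF g]]
    integrable_riesz_kernel_density[OF g, of x]
  have ib: "integrable lborel ?b"
    by (intro integrable_mult_right Bochner_Integration.integrable_add i)
  have le: "\<bar>green T x y * g y\<bar> \<le> ?b y" for y
  proof (cases "y \<in> D")
    case True
    have "\<bar>green T x y\<bar> * \<bar>g y\<bar> \<le> 1 / (2 * pi) * (log_T x + log_T y + 4 * B * riesz_kernel x y) * \<bar>g y\<bar>"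
      by (intro mult_right_mono abs_green_le x True) auto
    thus ?thesis by (simp add: abs_mult algebra_simps)
  qed (simp add: compact_density_off_D[OF g])
  show int: "integrable lborel (\<lambda>y. green T x y * g y)"
  proof (rule Bochner_Integration.integrable_bound[OF ib])
    show "AE y in lborel. norm (green T x y * g y) \<le> norm (?b y)"
      using le by (intro AE_I2) (metis abs_ge_self order_trans real_norm_def)
  qed measurable
  have "(LBINT y. \<bar>green T x y * g y\<bar>) \<le> integral\<^sup>L lborel ?b"
    by (intro integral_mono ib integrable_abs int le)
  also have "\<dots> = 1 / (2 * pi) * (log_T x * (LBINT y. \<bar>g y\<bar>) + (LBINT y. log_T y * \<bar>g y\<bar>)
        + 4 * B * (LBINT y. riesz_kernel x y * \<bar>g y\<bar>))"
    using i by (simp add: Bochner_Integration.integral_add del: times_divide_eq_left)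
  also have "\<dots> \<le> 1 / (2 * pi) * (log_T x * (LBINT y. \<bar>g y\<bar>) + (LBINT y. log_T y * \<bar>g y\<bar>)
        + 4 * B * (2 * (LBINT y. \<bar>g y\<bar>) + 4 * pi * M))"
    using integral_riesz_kernel_le[OF integrable_compact_density[OF g] M, of 1 x] B_ge_1
    by (intro mult_left_mono add_left_mono) auto
  finally show "(LBINT y. \<bar>green T x y * g y\<bar>) \<le>
      1 / (2 * pi) * (log_T x * (LBINT y. \<bar>g y\<bar>) + (LBINT y. log_T y * \<bar>g y\<bar>)
        + 4 * B * (2 * (LBINT y. \<bar>g y\<bar>) + 4 * pi * M))" .
qed

definition potential :: "(complex \<Rightarrow> real) \<Rightarrow> complex \<Rightarrow> real" where
  "potential g x = (LBINT y. green T x y * g y)"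

definition grad_potential :: "(complex \<Rightarrow> real) \<Rightarrow> complex \<Rightarrow> complex" where
  "grad_potential g x = (LBINT y. g y *\<^sub>R grad_green x y)"

lemma potential_measurable:
  assumes "compact_density g" shows "potential g \<in> borel_measurable borel"
proof -
  have [measurable]: "g \<in> borel_measurable borel" using assms by (rule compact_density_measurable)
  have "(\<lambda>x. LBINT y. green T x y * g y) \<in> borel_measurable borel"
    by (intro lborel.borel_measurable_lebesgue_integral) (simp add: split_beta')
  thus ?thesis unfolding potential_def[abs_def] .
qed

lemma integrable_green_density:
  assumes "compact_density g" "x \<in> D"
  shows "integrable lborel (\<lambda>y. green T x y * g y)"
proof -
  obtain M where "\<And>y. \<bar>g y\<bar> \<le> M" using assms unfolding compact_density_def by blast
  with assms show ?thesis by (rule integrable_green_mult)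
qed

text \<open>The potential of a compactly supported density grows at most logarithmically, which makes stream functions
  admissible test functions.\<close>

lemma potential_growth:
  assumes g: "compact_density g"
  shows "\<exists>A. \<forall>x\<in>D. (LBINT y. \<bar>green T x y * g y\<bar>) \<le> A * (1 + log_T x)"
proof -
  obtain M where M: "\<And>y. \<bar>g y\<bar> \<le> M" using assms unfolding compact_density_def by blast
  define m where "m = (LBINT y. \<bar>g y\<bar>)"
  define c where "c = \<bar>(LBINT y. log_T y * \<bar>g y\<bar>) + 4 * B * (2 * m + 4 * pi * M)\<bar>"
  show ?thesis
  proof (intro exI ballI)
    fix x assume x: "x \<in> D"
    have m: "0 \<le> m" unfolding m_def by simp
    have "(LBINT y. \<bar>green T x y * g y\<bar>) \<le> 1 / (2 * pi) * (log_T x * m + c)"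
      using integral_abs_green_le[OF g x M] unfolding m_def[symmetric] c_def
      by (rule order_trans) (intro mult_left_mono, auto)
    also have "\<dots> \<le> 1 / (2 * pi) * ((m + c) * (1 + log_T x))"
      using m log_T_pos[OF x] by (intro mult_left_mono) (auto simp: algebra_simps c_def)
    finally show "(LBINT y. \<bar>green T x y * g y\<bar>) \<le> (1 / (2 * pi) * (m + c)) * (1 + log_T x)"
      by (simp add: mult.assoc)
  qed
qed

lemma abs_potential_le: "\<bar>potential g x\<bar> \<le> (LBINT y. \<bar>green T x y * g y\<bar>)"
  unfolding potential_def by (rule integral_abs_bound)

text \<open>A bound that is uniform in \<open>x\<close>: the singularity of the kernel may sit anywhere with respect to the disc of integration.\<close>

lemma riesz_small_ball:
  assumes "compact_density g" "\<And>y. \<bar>g y\<bar> \<le> M" "0 < \<rho>"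
  shows "(LBINT y. riesz_kernel x y * \<bar>indicator (ball x0 \<rho>) y * g y\<bar>) \<le> pi * M * \<rho> * (\<rho> + 5)"
proof -
  let ?g = "\<lambda>y. indicator (ball x0 \<rho>) y * g y"
  have M: "0 \<le> M" using assms(2)[of 0] by linarith
  have d: "compact_density ?g" by (rule compact_density_indicator[OF assms(1)]) simp
  have "(LBINT y. \<bar>?g y\<bar>) \<le> (LBINT y. M * indicator (ball x0 \<rho>) y)"
  proof (rule integral_mono)
    show "integrable lborel (\<lambda>y. M * indicator (ball x0 \<rho>) y)"
      by (intro integrable_mult_right integrable_real_indicator emeasure_bounded_finite) auto
    show "integrable lborel (\<lambda>y. \<bar>?g y\<bar>)" using integrable_abs[OF integrable_compact_density[OF d]] .
  qed (use assms(2) in \<open>auto simp: indicator_def\<close>)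
  also have "\<dots> = M * (pi * \<rho>\<^sup>2)"
    using emeasure_ball_complex[of \<rho> x0] assms(3) by (simp add: measure_def)
  finally have m: "(LBINT y. \<bar>?g y\<bar>) \<le> M * (pi * \<rho>\<^sup>2)" .
  have "(LBINT y. riesz_kernel x y * \<bar>?g y\<bar>) \<le> (1 + 1 / \<rho>) * (LBINT y. \<bar>?g y\<bar>) + 4 * pi * \<rho> * M"
    using assms(2) M assms(3) by (intro integral_riesz_kernel_le integrable_compact_density[OF d]) (auto simp: indicator_def)
  also have "\<dots> \<le> (1 + 1 / \<rho>) * (M * (pi * \<rho>\<^sup>2)) + 4 * pi * \<rho> * M"
    using assms(3) by (intro add_right_mono mult_left_mono m) auto
  also have "\<dots> = pi * M * \<rho> * (\<rho> + 5)" using assms(3) by (simp add: field_simps power2_eq_square)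
  finally show ?thesis .
qed

lemma grad_green_measurable [measurable]: "(\<lambda>y. grad_green x y) \<in> borel_measurable borel"
proof -
  have [measurable]: "cnj \<in> borel_measurable borel"
    by (intro borel_measurable_continuous_onI continuous_intros)
  show ?thesis unfolding grad_green_def[abs_def] reflect_def by measurable
qed

lemma
  assumes g: "compact_density g" and x: "x \<in> D"
  shows integrable_grad_green: "integrable lborel (\<lambda>y. g y *\<^sub>R grad_green x y)"
    and norm_grad_potential_le: "cmod (grad_potential g x) \<le> 2 * B\<^sup>2 * (LBINT y. riesz_kernel x y * \<bar>g y\<bar>)"
proof -
  have [measurable]: "g \<in> borel_measurable borel" using g by (rule compact_density_measurable)
  let ?b = "\<lambda>y. 2 * B\<^sup>2 * (riesz_kernel x y * \<bar>g y\<bar>)"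
  have ib: "integrable lborel ?b" by (intro integrable_mult_right integrable_riesz_kernel_density g)
  have le: "AE y in lborel. cmod (g y *\<^sub>R grad_green x y) \<le> ?b y"
    using AE_lborel_singleton[of x]
  proof eventually_elim
    case (elim y)
    show ?case
    proof (cases "y \<in> D")
      case True
      have "cmod (grad_green x y) * \<bar>g y\<bar> \<le> 2 * B\<^sup>2 * riesz_kernel x y * \<bar>g y\<bar>"
        using elim by (intro mult_right_mono norm_grad_green_le x True) auto
      thus ?thesis by (simp add: mult_ac)
    qed (simp add: compact_density_off_D[OF g])
  qed
  show "integrable lborel (\<lambda>y. g y *\<^sub>R grad_green x y)"
    by (rule Bochner_Integration.integrable_bound[OF ib]) (use le in auto)
  have "cmod (grad_potential g x) \<le> (LBINT y. ?b y)"
    unfolding grad_potential_def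
    by (rule order_trans[OF integral_norm_bound integral_mono_AE[OF integrable_norm ib le]]) fact
  thus "cmod (grad_potential g x) \<le> 2 * B\<^sup>2 * (LBINT y. riesz_kernel x y * \<bar>g y\<bar>)"
    by simp
qed

lemma grad_potential_diff:
  assumes "compact_density f" "compact_density g" "x \<in> D"
  shows "grad_potential (\<lambda>y. f y - g y) x = grad_potential f x - grad_potential g x"
  unfolding grad_potential_def using integrable_grad_green assms
  by (simp add: scaleR_diff_left)

text \<open>Differentiation under the integral sign. The difference quotients of the kernel have no common integrable
  majorant, because their singularity moves with the increment. Their contribution from a small disc of radius \<open>\<rho>\<close> around \<open>x\<close> is
  \<open>O(\<rho>)\<close> uniformly in the increment by \<open>riesz_small_ball\<close>; outside of this disc dominated convergence applies.\<close>

lemma GDERIV_potential: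
  assumes g: "compact_density g" and x: "x \<in> D"
  shows "GDERIV (potential g) x :> grad_potential g x"
proof -
  have [measurable]: "g \<in> borel_measurable borel" using g by (rule compact_density_measurable)
  obtain M where M: "\<And>y. \<bar>g y\<bar> \<le> M" using g unfolding compact_density_def by blast
  hence M0: "0 \<le> M" using abs_ge_zero order_trans by blast
  obtain r where r: "0 < r" "ball x r \<subseteq> D" using open_D x open_contains_ball by blast
  have "(\<lambda>n. norm (potential g (X n) - potential g x - (X n - x) \<bullet> grad_potential g x) / norm (X n - x)) \<longlonglongrightarrow> 0"
    if X: "\<And>n. X n \<noteq> x" "X \<longlonglongrightarrow> x" for X
  proof -
    let ?r = "\<lambda>n y. green T (X n) y - green T x y - (X n - x) \<bullet> grad_green x y" and ?e = "\<lambda>n. potential g (X n) - potential g x - (X n - x) \<bullet> grad_potential g x"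
    define Q where "Q n y = \<bar>(?r n y) * g y\<bar> / cmod (X n - x)" for n y
    have Q_measurable [measurable]: "Q n \<in> borel_measurable borel" for n unfolding Q_def by measurable
    define near where "near n \<longleftrightarrow> X n \<in> ball x r" for n
    have ev_near: "\<forall>\<^sub>F n in sequentially. near n"
      using tendstoD[OF X(2) r(1)] by (simp add: near_def dist_commute)
    have Qle: "AE y in lborel. Q n y \<le> 2 * B\<^sup>2 * ((2 * riesz_kernel x y + riesz_kernel (X n) y) * \<bar>g y\<bar>)" if n: "near n" for n
      using AE_lborel_singleton[of x] AE_lborel_singleton[of "X n"]
    proof eventually_elim
      case (elim y)
      show ?case
      proof (cases "y \<in> D")
        case True
        have XD: "X n \<in> D" "closed_segment x (X n) \<subseteq> D"
          using n r closed_segment_subset[of x "ball x r" "X n"] by (auto simp: near_def)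
        let ?d = "cmod (X n - x)"
        have d: "0 < ?d" using X by simp
        have "\<bar>green T (X n) y - green T x y\<bar> \<le> 2 * B\<^sup>2 * ?d * (riesz_kernel x y + riesz_kernel (X n) y)"
          using elim True XD x by (intro green_diff_le) auto
        moreover have "\<bar>(X n - x) \<bullet> grad_green x y\<bar> \<le> ?d * (2 * B\<^sup>2 * riesz_kernel x y)"
          using elim by (intro order_trans[OF Cauchy_Schwarz_ineq2] mult_left_mono norm_grad_green_le x True) auto
        ultimately have "\<bar>?r n y\<bar> \<le>
            ?d * (2 * B\<^sup>2 * (2 * riesz_kernel x y + riesz_kernel (X n) y))"
          by (simp add: algebra_simps)
        hence "\<bar>?r n y\<bar> * \<bar>g y\<bar> \<le>
            ?d * (2 * B\<^sup>2 * (2 * riesz_kernel x y + riesz_kernel (X n) y)) * \<bar>g y\<bar>"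
          by (intro mult_right_mono) auto
        thus ?thesis using d by (simp add: Q_def abs_mult divide_le_eq mult_ac)
      qed (simp add: compact_density_off_D[OF g] Q_def)
    qed
    have ibound: "integrable lborel (\<lambda>y. 2 * B\<^sup>2 * ((2 * riesz_kernel x y + riesz_kernel (X n) y) * \<bar>f y\<bar>))"
      if f: "compact_density f" for n f
    proof -
      have "integrable lborel (\<lambda>y. 2 * B\<^sup>2 * (2 * (riesz_kernel x y * \<bar>f y\<bar>) + riesz_kernel (X n) y * \<bar>f y\<bar>))"
        by (intro integrable_mult_right Bochner_Integration.integrable_add integrable_riesz_kernel_density f)
      thus ?thesis by (simp add: algebra_simps)
    qed
    have Q0: "0 \<le> Q n y" for n y unfolding Q_def by simp
    have Qint: "integrable lborel (Q n)" if n: "near n" for n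
      using Qle[OF n] by (intro Bochner_Integration.integrable_bound[OF ibound[OF g, of n]])
        (auto elim!: eventually_mono intro: order_trans Q0 simp: abs_of_nonneg[OF Q0])
    have main: "norm (?e n) / norm (X n - x) \<le> integral\<^sup>L lborel (Q n)"
      if n: "near n" for n
    proof -
      have XD: "X n \<in> D" using n r by (auto simp: near_def)
      have "(X n - x) \<bullet> grad_potential g x = (LBINT y. (X n - x) \<bullet> (g y *\<^sub>R grad_green x y))"
        unfolding grad_potential_def by (rule integral_inner_right[symmetric]) (rule integrable_grad_green[OF g x])
      hence "?e n =
          (LBINT y. (?r n y) * g y)"
        unfolding potential_def
        using integrable_green_density[OF g] XD x integrable_inner_right[OF integrable_grad_green[OF g x], of "X n - x"]
        by (simp add: left_diff_distrib mult.commute[of "g _"])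
      hence "norm (?e n) \<le>
         (LBINT y. \<bar>(?r n y) * g y\<bar>)"
        using integral_abs_bound by simp
      hence "norm (?e n) / norm (X n - x) \<le>
         (LBINT y. \<bar>(?r n y) * g y\<bar>) / norm (X n - x)"
        by (intro divide_right_mono) auto
      thus ?thesis unfolding Q_def by simp
    qed
    have far: "(\<lambda>n. LBINT y. indicator (- ball x \<rho>) y * Q n y) \<longlonglongrightarrow> 0" if \<rho>: "0 < \<rho>" for \<rho>
    proof -
      have [measurable]: "- ball x \<rho> \<in> sets borel" by simp
      have ev: "\<forall>\<^sub>F n in sequentially. near n \<and> dist (X n) x < \<rho> / 2"
        using ev_near tendstoD[OF X(2), of "\<rho> / 2"] \<rho> by (auto intro: eventually_conj)
      then obtain N where N: "\<And>n. N \<le> n \<Longrightarrow> near n \<and> dist (X n) x < \<rho> / 2"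
        unfolding eventually_sequentially by blast
      have "(\<lambda>n. LBINT y. indicator (- ball x \<rho>) y * Q (n + N) y) \<longlonglongrightarrow> (\<integral>y. (0::real) \<partial>(lborel::complex measure))"
      proof (rule integral_dominated_convergence)
        show "integrable lborel (\<lambda>y. 2 * B\<^sup>2 * ((3 + 4 / \<rho>) * \<bar>g y\<bar>))"
          by (intro integrable_mult_right integrable_abs integrable_compact_density g)
        show "AE y in lborel. norm (indicator (- ball x \<rho>) y * Q (n + N) y) \<le> 2 * B\<^sup>2 * ((3 + 4 / \<rho>) * \<bar>g y\<bar>)" for n
          using Qle[OF conjunct1[OF N[of "n + N"]], OF le_add2]
        proof eventually_elim
          case (elim y)
          show ?case
          proof (cases "y \<in> ball x \<rho>")
            case False
            hence "\<rho> \<le> cmod (x - y)" by (simp add: dist_norm)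
            moreover have "cmod (X (n + N) - x) < \<rho> / 2" using N[of "n + N"] by (simp add: dist_norm)
            ultimately have "\<rho> / 2 \<le> cmod (X (n + N) - y)"
              using norm_triangle_ineq2[of "x - y" "x - X (n + N)"] by (simp add: norm_minus_commute)
            hence 1: "1 / cmod (X (n + N) - y) \<le> 1 / (\<rho> / 2)" using \<rho> by (intro divide_left_mono) (auto intro!: mult_pos_pos)
            have 2: "1 / cmod (x - y) \<le> 1 / \<rho>" using \<open>\<rho> \<le> _\<close> \<rho> by (intro divide_left_mono) (auto intro!: mult_pos_pos)
            have "2 * riesz_kernel x y + riesz_kernel (X (n + N)) y \<le> 3 + 4 / \<rho>"
              using 1 2 by (simp add: riesz_kernel_def)
            hence "2 * B\<^sup>2 * ((2 * riesz_kernel x y + riesz_kernel (X (n + N)) y) * \<bar>g y\<bar>) \<le> 2 * B\<^sup>2 * ((3 + 4 / \<rho>) * \<bar>g y\<bar>)"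
              by (intro mult_left_mono mult_right_mono) auto
            thus ?thesis using elim False Q0[of "n + N" y] by simp
          qed (use \<rho> in auto)
        qed
        show "AE y in lborel. (\<lambda>n. indicator (- ball x \<rho>) y * Q (n + N) y) \<longlonglongrightarrow> 0"
        proof (rule AE_I2)
          fix y
          show "(\<lambda>n. indicator (- ball x \<rho>) y * Q (n + N) y) \<longlonglongrightarrow> 0"
          proof (cases "y \<in> D \<and> y \<noteq> x")
            case True
            have "((\<lambda>z. norm (green T z y - green T x y - (z - x) \<bullet> grad_green x y) / norm (z - x)) \<longlongrightarrow> 0) (at x)"
              using GDERIV_green[OF x] True unfolding gderiv_def has_derivative_iff_norm by auto
            hence "(\<lambda>n. norm (?r n y) / norm (X n - x)) \<longlonglongrightarrow> 0"
              unfolding tendsto_at_iff_sequentially using X by (auto simp: comp_def)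
            from tendsto_mult_left[OF LIMSEQ_ignore_initial_segment[OF this, of N], of "indicator (- ball x \<rho>) y * \<bar>g y\<bar>"]
            show ?thesis by (simp add: Q_def abs_mult mult_ac)
          next
            case False
            thus ?thesis using \<rho> compact_density_off_D[OF g] by (auto simp: Q_def)
          qed
        qed
      qed auto
      thus ?thesis using LIMSEQ_offset[of _ N 0] by simp
    qed
    show ?thesis
    proof (rule LIMSEQ_I)
      fix e :: real assume e: "0 < e"
      define c where "c = 2 * B\<^sup>2 * (3 * (pi * M * 6))"
      have c: "0 \<le> c" using M0 by (simp add: c_def)
      \<comment> \<open>Chosen so that \<open>c \<rho> \<le> e / 2\<close>; \<open>\<rho> \<le> 1\<close> turns \<open>\<rho> + 5\<close> into \<open>6\<close>.\<close>
      define \<rho> where "\<rho> = min 1 (e / (2 * (c + 1)))"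
      have \<rho>: "0 < \<rho>" "\<rho> \<le> 1" using e c by (auto simp: \<rho>_def)
      have "c * \<rho> \<le> c * (e / (2 * (c + 1)))" using c by (intro mult_left_mono) (auto simp: \<rho>_def)
      also have "\<dots> = (c / (c + 1)) * (e / 2)" by (simp add: field_simps)
      also have "\<dots> \<le> 1 * (e / 2)" using c e by (intro mult_right_mono) auto
      finally have c\<rho>: "c * \<rho> \<le> e / 2" by simp
      have [measurable]: "ball x \<rho> \<in> sets borel" by simp
      have nearint: "(LBINT y. indicator (ball x \<rho>) y * Q n y) \<le> c * \<rho>" if n: "near n" for n
      proof -
        let ?g = "\<lambda>y. indicator (ball x \<rho>) y * g y"
        have gi: "compact_density ?g" by (rule compact_density_indicator[OF g]) simp
        have "(LBINT y. indicator (ball x \<rho>) y * Q n y) \<le>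
            (LBINT y. 2 * B\<^sup>2 * ((2 * riesz_kernel x y + riesz_kernel (X n) y) * \<bar>?g y\<bar>))"
        proof (rule integral_mono_AE)
          show "integrable lborel (\<lambda>y. indicator (ball x \<rho>) y * Q n y)"
            using integrable_mult_indicator[OF _ Qint[OF n], of "ball x \<rho>"] by simp
          show "AE y in lborel. indicator (ball x \<rho>) y * Q n y \<le> 2 * B\<^sup>2 * ((2 * riesz_kernel x y + riesz_kernel (X n) y) * \<bar>?g y\<bar>)"
            using Qle[OF n] by eventually_elim (auto simp: indicator_def)
        qed (rule ibound[OF gi])
        also have "\<dots> = 2 * B\<^sup>2 * (2 * (LBINT y. riesz_kernel x y * \<bar>?g y\<bar>) + (LBINT y. riesz_kernel (X n) y * \<bar>?g y\<bar>))"
          using integrable_riesz_kernel_density[OF gi] by (simp add: distrib_right mult.assoc)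
        also have "\<dots> \<le> 2 * B\<^sup>2 * (2 * (pi * M * \<rho> * (\<rho> + 5)) + pi * M * \<rho> * (\<rho> + 5))"
          by (intro mult_left_mono add_mono riesz_small_ball[OF g M \<rho>(1)]) auto
        also have "\<dots> = 2 * B\<^sup>2 * (3 * (pi * M * \<rho> * (\<rho> + 5)))" by simp
        also have "\<dots> \<le> 2 * B\<^sup>2 * (3 * (pi * M * \<rho> * 6))"
          using M0 \<rho> by (intro mult_left_mono) auto
        also have "\<dots> = c * \<rho>" by (simp add: c_def)
        finally show ?thesis .
      qed
      have "\<forall>\<^sub>F n in sequentially. near n \<and> (LBINT y. indicator (- ball x \<rho>) y * Q n y) < e / 2"
        using ev_near order_tendstoD(2)[OF far[OF \<rho>(1)], of "e / 2"] e by (auto intro: eventually_conj)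
      then obtain N where N: "\<And>n. N \<le> n \<Longrightarrow> near n \<and> (LBINT y. indicator (- ball x \<rho>) y * Q n y) < e / 2"
        unfolding eventually_sequentially by blast
      have "norm (?e n) / norm (X n - x) < e" if n: "N \<le> n" for n
      proof -
        have nn: "near n" using N n by blast
        have "integral\<^sup>L lborel (Q n) = (LBINT y. indicator (ball x \<rho>) y * Q n y + indicator (- ball x \<rho>) y * Q n y)"
          by (rule Bochner_Integration.integral_cong) (auto simp: indicator_def)
        also have "\<dots> = (LBINT y. indicator (ball x \<rho>) y * Q n y) + (LBINT y. indicator (- ball x \<rho>) y * Q n y)"
          using integrable_mult_indicator[OF _ Qint[OF nn], of "ball x \<rho>"] integrable_mult_indicator[OF _ Qint[OF nn], of "- ball x \<rho>"]
          by (intro Bochner_Integration.integral_add) auto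
        also have "\<dots> < e" using nearint[OF nn] c\<rho> N[OF n] by linarith
        finally show ?thesis using main[OF nn] by linarith
      qed
      thus "\<exists>N. \<forall>n\<ge>N. norm (norm (?e n) / norm (X n - x) - 0) < e"
        by auto
    qed
  qed
  thus ?thesis unfolding gderiv_def has_derivative_iff_norm tendsto_at_iff_sequentially
    by (auto simp: comp_def bounded_linear_inner_left)
qed

text \<open>Fubini's theorem and the symmetry of the Green function.\<close>

lemma potential_symmetric:
  assumes f: "compact_density f" and g: "compact_density g"
  shows "(LBINT x. potential f x * g x) = (LBINT x. potential g x * f x)"
proof -
  have [measurable]: "f \<in> borel_measurable borel" "g \<in> borel_measurable borel"
    using f g by (auto intro: compact_density_measurable)
  let ?h = "\<lambda>(x, y). green T x y * f y * g x"
  obtain A where A: "\<And>x. x \<in> D \<Longrightarrow> (LBINT y. \<bar>green T x y * f y\<bar>) \<le> A * (1 + log_T x)"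
    using potential_growth[OF f] by blast
  have "integrable (lborel \<Otimes>\<^sub>M lborel) ?h"
  proof (rule lborel_pair.Fubini_integrable)
    show "?h \<in> borel_measurable (lborel \<Otimes>\<^sub>M lborel)" unfolding split_beta' by measurable
    show "AE x in lborel. integrable lborel (\<lambda>y. ?h (x, y))"
    proof (rule AE_I2)
      fix x show "integrable lborel (\<lambda>y. ?h (x, y))"
        using integrable_green_density[OF f, of x] compact_density_off_D[OF g, of x] by (cases "x \<in> D") auto
    qed
    have m: "(\<lambda>x. LBINT y. norm (?h (x, y))) \<in> borel_measurable lborel"
      by (intro lborel.borel_measurable_lebesgue_integral) (simp add: split_beta')
    have "integrable lborel (\<lambda>x. (A * (1 + log_T x)) * \<bar>g x\<bar>)"
    proof -
      have "integrable lborel (\<lambda>x. A * \<bar>g x\<bar> + A * (log_T x * \<bar>g x\<bar>))"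
        by (intro Bochner_Integration.integrable_add integrable_mult_right integrable_abs integrable_compact_density g integrable_log_T_mult compact_density_abs)
      thus ?thesis by (simp add: algebra_simps)
    qed
    thus "integrable lborel (\<lambda>x. LBINT y. norm (?h (x, y)))"
    proof (rule Bochner_Integration.integrable_bound[OF _ m], intro AE_I2)
      fix x
      show "norm (LBINT y. norm (?h (x, y))) \<le> norm ((A * (1 + log_T x)) * \<bar>g x\<bar>)"
      proof (cases "x \<in> D")
        case True
        have "(LBINT y. norm (?h (x, y))) = (LBINT y. \<bar>green T x y * f y\<bar>) * \<bar>g x\<bar>"
          by (simp add: abs_mult)
        also have "\<dots> \<le> (A * (1 + log_T x)) * \<bar>g x\<bar>" by (intro mult_right_mono A True) auto
        finally have "(LBINT y. norm (?h (x, y))) \<le> norm ((A * (1 + log_T x)) * \<bar>g x\<bar>)"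
          by (rule order_trans) simp
        thus ?thesis by simp
      qed (simp add: compact_density_off_D[OF g])
    qed
  qed
  hence "(LBINT x. (LBINT y. green T x y * f y * g x)) = (LBINT y. (LBINT x. green T x y * f y * g x))"
    using lborel_pair.Fubini_integral[of "\<lambda>x y. green T x y * f y * g x"] by simp
  also have "\<dots> = (LBINT y. potential g y * f y)"
  proof (rule Bochner_Integration.integral_cong[OF refl])
    fix y :: complex
    have "(LBINT x. green T x y * f y * g x) = (LBINT x. (green T y x * g x) * f y)"
    proof (rule Bochner_Integration.integral_cong[OF refl])
      fix x show "green T x y * f y * g x = (green T y x * g x) * f y"
        using green_commute[of x y] compact_density_off_D[OF g, of x] compact_density_off_D[OF f, of y]
        by (cases "x \<in> D \<and> y \<in> D") auto
    qed
    thus "(LBINT x. green T x y * f y * g x) = potential g y * f y" by (simp add: potential_def)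
  qed
  finally show ?thesis by (simp add: potential_def)
qed

lemma integrable_potential_mult:
  assumes "compact_density f" "compact_density g"
  shows "integrable lborel (\<lambda>x. potential f x * g x)"
  by (intro integrable_mult_compact_density bounded_on_compact potential_measurable assms)
    (auto intro: GDERIV_continuous[OF GDERIV_potential[OF assms(1)]])

text \<open>The lower bound for the Green function, integrated twice: each of \<open>log |T x|\<close> and \<open>log |T y|\<close> contributes one
  product of the mass and the logarithmic moment.\<close>

lemma self_energy_bounds:
  assumes g: "compact_density g" and nonneg: "\<And>y. 0 \<le> g y" and M: "\<And>y. g y \<le> M"
  defines "\<mu> \<equiv> (LBINT y. g y)"
  shows "(LBINT x. potential g x * g x) \<le> 0"
    and "- (LBINT x. potential g x * g x) \<le>
       2 * \<mu> * (1 / (2 * pi) * (LBINT y. log_T y * g y)) + 4 * B * (2 * \<mu> + 4 * pi * M) * \<mu> / (2 * pi)"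
proof -
  have "potential g x * g x \<le> 0" for x
  proof (cases "x \<in> D")
    case True
    have "green T x y * g y \<le> 0" for y
      using green_le_0[OF True, of y] nonneg[of y] compact_density_off_D[OF g, of y]
      by (cases "y \<in> D") (auto intro: mult_nonpos_nonneg)
    hence "potential g x \<le> 0" unfolding potential_def by (rule integral_nonpos)
    thus ?thesis using nonneg by (intro mult_nonpos_nonneg)
  qed (simp add: compact_density_off_D[OF g])
  thus "(LBINT x. potential g x * g x) \<le> 0" by (rule integral_nonpos)
  define \<Lambda> where "\<Lambda> = (LBINT y. log_T y * g y)"
  define c where "c = 4 * B * (2 * \<mu> + 4 * pi * M)"
  have le: "- (potential g x * g x) \<le> 1 / (2 * pi) * (\<mu> * (log_T x * g x) + (\<Lambda> + c) * g x)" for x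
  proof (cases "x \<in> D")
    case True
    have "- potential g x \<le> 1 / (2 * pi) * (log_T x * \<mu> + \<Lambda> + c)"
      using abs_potential_le[of g x] integral_abs_green_le[OF g True, of M] nonneg M
      by (simp add: \<Lambda>_def c_def \<mu>_def)
    hence "- potential g x * g x \<le> 1 / (2 * pi) * (log_T x * \<mu> + \<Lambda> + c) * g x"
      using nonneg by (intro mult_right_mono) auto
    thus ?thesis by (simp add: algebra_simps add_divide_distrib)
  qed (simp add: compact_density_off_D[OF g])
  have "- (LBINT x. potential g x * g x) = (LBINT x. - (potential g x * g x))" by simp
  also have "\<dots> \<le> (LBINT x. 1 / (2 * pi) * (\<mu> * (log_T x * g x) + (\<Lambda> + c) * g x))"
    by (intro integral_mono le integrable_mult_right Bochner_Integration.integrable_add Bochner_Integration.integrable_minus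
      integrable_potential_mult g integrable_log_T_mult integrable_compact_density)
  also have "\<dots> = 1 / (2 * pi) * (\<mu> * \<Lambda> + (\<Lambda> + c) * \<mu>)"
    using integrable_log_T_mult[OF g] integrable_compact_density[OF g]
    by (simp add: \<Lambda>_def \<mu>_def del: times_divide_eq_left)
  also have "\<dots> = 2 * \<mu> * (1 / (2 * pi) * \<Lambda>) + c * \<mu> / (2 * pi)"
    by (simp add: field_simps)
  finally show "- (LBINT x. potential g x * g x) \<le>
       2 * \<mu> * (1 / (2 * pi) * (LBINT y. log_T y * g y)) + 4 * B * (2 * \<mu> + 4 * pi * M) * \<mu> / (2 * pi)"
    unfolding \<Lambda>_def c_def .
qed

end

section \<open>Moments of the vorticity\<close>

text \<open>What the moment estimates use of a solution, with the vorticity extended by zero to the plane. The functions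
  \<open>wt\<close> and \<open>gw\<close> are its time derivative and its gradient. Supports are compact for each time separately; the time derivative is
  bounded locally uniformly for positive times. The bounds \<open>M\<close> and \<open>m\<close> for the supremum and the \<open>L\<^sup>1\<close> norm are uniform in time.\<close>

locale vorticity_solution = exterior_map +
  fixes w wt :: "real \<Rightarrow> complex \<Rightarrow> real" and gw :: "real \<Rightarrow> complex \<Rightarrow> complex" and \<alpha> M m :: real
  assumes density: "0 \<le> t \<Longrightarrow> compact_density (w t)"
    and w_le: "0 \<le> t \<Longrightarrow> \<bar>w t x\<bar> \<le> M"
    and w_L1: "0 \<le> t \<Longrightarrow> (LBINT x. \<bar>w t x\<bar>) = m"
    and w_0_nonneg: "0 \<le> w 0 x"
    and w_continuous_space: "0 \<le> t \<Longrightarrow> isCont (w t) x"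
    and w_continuous_time: "continuous_on {0..} (\<lambda>t. w t x)"
    and GDERIV_w: "0 < t \<Longrightarrow> x \<in> D \<Longrightarrow> GDERIV (w t) x :> gw t x"
    and gw_support: "0 < t \<Longrightarrow> \<exists>K C. compact K \<and> K \<subseteq> D \<and> (\<forall>x. x \<notin> K \<longrightarrow> w t x = 0 \<and> gw t x = 0) \<and> (\<forall>x. cmod (gw t x) \<le> C)"
    and DERIV_w: "0 < t \<Longrightarrow> x \<in> D \<Longrightarrow> ((\<lambda>t. w t x) has_real_derivative wt t x) (at t)"
    and wt_le: "compact K \<Longrightarrow> K \<subseteq> D \<Longrightarrow> 0 < a \<Longrightarrow> \<exists>C. \<forall>x\<in>K. \<forall>t\<in>{a..b}. \<bar>wt t x\<bar> \<le> C"
    and vorticity_equation: "0 < t \<Longrightarrow> x \<in> D \<Longrightarrow>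
      wt t x + perp (grad_potential (w t) x + (\<alpha> / (2 * pi)) *\<^sub>R grad_log_T x) \<bullet> gw t x = 0"
begin

lemma w_measurable [measurable]: "0 \<le> t \<Longrightarrow> w t \<in> borel_measurable borel"
  using density compact_density_measurable by blast

lemma M_nonneg: "0 \<le> M"
  using w_le[of 0 0] by linarith

lemma m_nonneg: "0 \<le> m"
  using w_L1[of 0] Bochner_Integration.integral_nonneg[of lborel "\<lambda>x. \<bar>w 0 x\<bar>"] by simp

definition stream_grad :: "real \<Rightarrow> complex \<Rightarrow> complex" where
  "stream_grad t x = grad_potential (w t) x + (\<alpha> / (2 * pi)) *\<^sub>R grad_log_T x"

definition stream_fun :: "real \<Rightarrow> complex \<Rightarrow> real" where
  "stream_fun t x = potential (w t) x + \<alpha> / (2 * pi) * log_T x"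

lemma GDERIV_stream_fun:
  assumes "0 \<le> t" "x \<in> D" shows "GDERIV (stream_fun t) x :> stream_grad t x"
proof -
  have "GDERIV (\<lambda>x. \<alpha> / (2 * pi) * log_T x) x :> (\<alpha> / (2 * pi)) *\<^sub>R grad_log_T x"
    using GDERIV_mult[OF GDERIV_const GDERIV_log_T[OF assms(2)], of "\<alpha> / (2 * pi)"] by simp
  thus ?thesis unfolding stream_fun_def[abs_def] stream_grad_def
    by (intro GDERIV_add GDERIV_potential density assms)
qed

text \<open>A bound for the velocity that is uniform in space and time.\<close>

definition speed :: real where
  "speed = 2 * B\<^sup>2 * (2 * m + 4 * pi * M) + \<bar>\<alpha>\<bar> / (2 * pi) * B"

lemma stream_grad_le:
  assumes "0 \<le> t" "x \<in> D" shows "cmod (stream_grad t x) \<le> speed"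
proof -
  have "cmod (grad_potential (w t) x) \<le> 2 * B\<^sup>2 * (LBINT y. riesz_kernel x y * \<bar>w t y\<bar>)"
    by (rule norm_grad_potential_le[OF density[OF assms(1)] assms(2)])
  also have "\<dots> \<le> 2 * B\<^sup>2 * (2 * m + 4 * pi * M)"
    using integral_riesz_kernel_le[OF integrable_compact_density[OF density[OF assms(1)]] w_le[OF assms(1)], of 1 x]
    unfolding w_L1[OF assms(1)] by (intro mult_left_mono) auto
  finally have "cmod (grad_potential (w t) x) \<le> 2 * B\<^sup>2 * (2 * m + 4 * pi * M)" .
  moreover have "cmod ((\<alpha> / (2 * pi)) *\<^sub>R grad_log_T x) \<le> \<bar>\<alpha>\<bar> / (2 * pi) * B"
    using norm_grad_log_T_le[OF assms(2)] by (simp add: divide_right_mono mult_left_mono)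
  ultimately show ?thesis unfolding stream_grad_def speed_def
    by (rule order_trans[OF norm_triangle_ineq add_mono])
qed

lemma speed_nonneg: "0 \<le> speed"
  unfolding speed_def using M_nonneg m_nonneg B_ge_1 by (intro add_nonneg_nonneg mult_nonneg_nonneg) auto

text \<open>The gradient of the product of the cutoff and \<open>f\<close>, where \<open>f'\<close> is the gradient of \<open>f\<close>.\<close>

definition grad_cut :: "nat \<Rightarrow> (complex \<Rightarrow> real) \<Rightarrow> (complex \<Rightarrow> complex) \<Rightarrow> complex \<Rightarrow> complex" where
  "grad_cut n f f' x = cutoff n x *\<^sub>R f' x + f x *\<^sub>R grad_cutoff n x"

lemma GDERIV_cut:
  assumes "\<And>x. x \<in> D \<Longrightarrow> GDERIV f x :> f' x" "1 \<le> n"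
  shows "GDERIV (\<lambda>x. cutoff n x * f x) x :> (if x \<in> D then grad_cut n f f' x else 0)"
proof (rule GDERIV_extend_by_0[OF open_D _ cutoff_support(1,2)[OF assms(2)]])
  show "GDERIV (\<lambda>x. cutoff n x * f x) x :> grad_cut n f f' x" if "x \<in> D" for x
    unfolding grad_cut_def by (intro GDERIV_mult GDERIV_cutoff_D assms that)
qed (simp add: cutoff_support(3)[OF assms(2)])

lemma cut_measurable:
  assumes "\<And>x. x \<in> D \<Longrightarrow> GDERIV f x :> f' x" "1 \<le> n"
  shows "(\<lambda>x. cutoff n x * f x) \<in> borel_measurable borel"
  by (intro borel_measurable_continuous_onI continuous_at_imp_continuous_on ballI GDERIV_continuous[OF GDERIV_cut[OF assms]])

lemma cut_bounded:
  assumes "\<And>x. x \<in> D \<Longrightarrow> GDERIV f x :> f' x" "1 \<le> n"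
  shows "\<exists>C. \<forall>x. \<bar>cutoff n x * f x\<bar> \<le> C * indicator (cutoff_support n) x"
proof -
  obtain C where C: "\<And>x. x \<in> cutoff_support n \<Longrightarrow> \<bar>cutoff n x * f x\<bar> \<le> C"
    using bounded_on_compact[OF GDERIV_continuous[OF GDERIV_cut[OF assms]] cutoff_support(1,2)[OF assms(2)]] by blast
  have "\<bar>cutoff n x * f x\<bar> \<le> C * indicator (cutoff_support n) x" for x
    using C[of x] cutoff_support(3)[OF assms(2), of x] by (cases "x \<in> cutoff_support n") auto
  thus ?thesis by blast
qed

lemma integrable_cutoff_support:
  fixes C :: real
  assumes "1 \<le> n" shows "integrable lborel (\<lambda>x. C * indicator (cutoff_support n) x)"
  using cutoff_support(1)[OF assms]
  by (intro integrable_mult_right integrable_real_indicator emeasure_compact_finite) (auto intro: borel_compact)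

lemma norm_grad_cut_le:
  assumes f: "\<And>x. x \<in> D \<Longrightarrow> \<bar>f x\<bar> \<le> A * (1 + log_T x)" "\<And>x. x \<in> D \<Longrightarrow> cmod (f' x) \<le> A"
    and x: "x \<in> D" and n: "1 \<le> n" and A: "0 \<le> A"
  shows "cmod (grad_cut n f f' x) \<le> A + A * (B * (24 * real n * indicator (strip n) x + 4))"
proof -
  have "cmod (cutoff n x *\<^sub>R f' x) \<le> 1 * A"
    unfolding norm_scaleR using cutoff_bounds[of n x] f(2)[OF x] by (intro mult_mono) auto
  moreover have "cmod (f x *\<^sub>R grad_cutoff n x) \<le> A * (1 + log_T x) * cmod (grad_cutoff n x)"
    unfolding norm_scaleR real_norm_def by (intro mult_right_mono f(1)[OF x]) auto
  moreover have "A * ((1 + log_T x) * cmod (grad_cutoff n x)) \<le> A * (B * (24 * real n * indicator (strip n) x + 4))"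
    by (intro mult_left_mono norm_grad_cutoff_le x n A)
  ultimately show ?thesis unfolding grad_cut_def
    by (intro order_trans[OF norm_triangle_ineq]) (simp only: mult.assoc mult_1)
qed

lemma wt_measurable_cut:
  assumes t: "0 < t" and f: "\<And>x. x \<in> D \<Longrightarrow> GDERIV f x :> f' x" and n: "1 \<le> n"
  shows "(\<lambda>x. cutoff n x * f x * wt t x) \<in> borel_measurable borel"
proof (rule borel_measurable_LIMSEQ_real)
  note [measurable] = cut_measurable[OF f n]
  fix x
  show "(\<lambda>k. cutoff n x * f x * ((w (t + 1 / real (Suc k)) x - w t x) * real (Suc k))) \<longlonglongrightarrow> cutoff n x * f x * wt t x"
  proof (cases "x \<in> D")
    case True
    have hn: "filterlim (\<lambda>n. 1 / real (Suc n)) (at 0) sequentially"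
      unfolding filterlim_at using LIMSEQ_Suc[OF lim_1_over_n] by auto
    from DERIV_w[OF t True] have "(\<lambda>k. (w (t + 1 / real (Suc k)) x - w t x) / (1 / real (Suc k))) \<longlonglongrightarrow> wt t x"
      unfolding DERIV_def by (rule filterlim_compose[OF _ hn])
    thus ?thesis by (intro tendsto_mult tendsto_const) simp
  qed (simp add: cutoff_def)
next
  fix k show "(\<lambda>x. cutoff n x * f x * ((w (t + 1 / real (Suc k)) x - w t x) * real (Suc k))) \<in> borel_measurable borel"
    using t by (intro borel_measurable_times cut_measurable[OF f n] borel_measurable_diff w_measurable) auto
qed

text \<open>The vorticity equation in weak form at a fixed time: apply \<open>null_lagrangian\<close> to the stream function and to
  the product of the cutoff, \<open>f\<close> and the vorticity.\<close>

lemma integral_cut_time_derivative: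
  assumes t: "0 < t" and f: "\<And>x. x \<in> D \<Longrightarrow> GDERIV f x :> f' x" "\<And>x. x \<in> D \<Longrightarrow> cmod (f' x) \<le> A" and n: "1 \<le> n"
  shows "integrable lborel (\<lambda>x. w t x * (perp (stream_grad t x) \<bullet> grad_cut n f f' x))" (is ?int)
    and "(LBINT x. cutoff n x * f x * wt t x) =
      (LBINT x. w t x * (perp (stream_grad t x) \<bullet> grad_cut n f f' x))" (is ?eq)
proof -
  obtain K Cg where K: "compact K" "K \<subseteq> D" "\<And>x. x \<notin> K \<Longrightarrow> w t x = 0" "\<And>x. x \<notin> K \<Longrightarrow> gw t x = 0"
    and Cg: "\<And>x. cmod (gw t x) \<le> Cg" using gw_support[OF t] by blast
  have A: "0 \<le> A" if "x \<in> D" for x using f(2)[OF that] norm_ge_zero order_trans by blast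
  have wt0: "wt t x = 0" if "x \<in> D" "x \<notin> K" for x using vorticity_equation[OF t that(1)] K(4)[OF that(2)] by simp
  \<comment> \<open>A second cutoff, equal to one on the support of the vorticity, makes the stream function globally Lipschitz
    without changing the integrand.\<close>
  obtain N where N: "1 \<le> N" "\<And>x. x \<in> K \<Longrightarrow> cutoff N x = 1" "\<And>x. x \<in> K \<Longrightarrow> grad_cutoff N x = 0"
    using eventually_conj[OF cutoff_eventually_1[OF K(1,2)] eventually_ge_at_top[of 1]]
    unfolding eventually_sequentially by blast
  define P where "P x = (if x \<in> D then grad_cut N (stream_fun t) (stream_grad t) x else 0)" for x
  define F' where "F' x = (if x \<in> D then (cutoff n x * f x) *\<^sub>R gw t x + w t x *\<^sub>R grad_cut n f f' x else 0)" for x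
  have grad_cutoff_bd: "cmod (grad_cutoff k x) \<le> B * (24 * real k + 4)" if "1 \<le> k" "x \<in> D" for k x
  proof -
    have "1 * cmod (grad_cutoff k x) \<le> (1 + log_T x) * cmod (grad_cutoff k x)"
      using log_T_pos[OF that(2)] by (intro mult_right_mono) auto
    also have "\<dots> \<le> B * (24 * real k * indicator (strip k) x + 4)"
      by (rule norm_grad_cutoff_le[OF that(2,1)])
    also have "\<dots> \<le> B * (24 * real k * 1 + 4)" using B_ge_1
      by (intro mult_left_mono add_right_mono) (auto simp: indicator_def)
    finally show ?thesis by simp
  qed
  have bd: "\<exists>C. \<forall>x. x \<in> D \<longrightarrow> x \<in> K' \<longrightarrow> cmod (grad_cut k h h' x) \<le> C"
    if K': "compact K'" "K' \<subseteq> D" and k: "1 \<le> k" and h: "\<And>x. x \<in> D \<Longrightarrow> GDERIV h x :> h' x" "\<And>x. x \<in> D \<Longrightarrow> cmod (h' x) \<le> Ah" for k h h' Ah K'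
  proof -
    obtain Ch where Ch: "\<And>x. x \<in> K' \<Longrightarrow> \<bar>h x\<bar> \<le> Ch"
      using bounded_on_compact[OF GDERIV_continuous[OF h(1)] K'] by blast
    have "cmod (grad_cut k h h' x) \<le> 1 * Ah + Ch * (B * (24 * real k + 4))" if x: "x \<in> D" "x \<in> K'" for x
    proof -
      have "\<bar>cutoff k x\<bar> * cmod (h' x) \<le> 1 * Ah"
        using cutoff_bounds[of k x] h(2)[OF x(1)] by (intro mult_mono) auto
      moreover have "\<bar>h x\<bar> * cmod (grad_cutoff k x) \<le> Ch * (B * (24 * real k + 4))"
        using Ch[OF x(2)] by (intro mult_mono grad_cutoff_bd k x) auto
      ultimately show ?thesis unfolding grad_cut_def
        by (intro order_trans[OF norm_triangle_ineq]) simp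
    qed
    thus ?thesis by blast
  qed
  obtain C1 where C1: "\<And>x. x \<in> D \<Longrightarrow> x \<in> cutoff_support N \<Longrightarrow> cmod (grad_cut N (stream_fun t) (stream_grad t) x) \<le> C1"
    using bd[OF cutoff_support(1,2)[OF N(1)] N(1) GDERIV_stream_fun stream_grad_le] t by (metis less_imp_le)
  obtain C2 where C2: "\<And>x. x \<in> D \<Longrightarrow> x \<in> K \<Longrightarrow> cmod (grad_cut n f f' x) \<le> C2"
    using bd[OF K(1,2) n f] by metis
  have P_le: "cmod (P x) \<le> \<bar>C1\<bar>" for x
  proof (cases "x \<in> D \<and> x \<in> cutoff_support N")
    case True thus ?thesis using C1[of x] by (simp add: P_def)
  next
    case False
    hence "P x = 0" using cutoff_support(3,4)[OF N(1), of x] by (auto simp: P_def grad_cut_def)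
    thus ?thesis by simp
  qed
  obtain Cc where Cc: "\<And>x. \<bar>cutoff n x * f x\<bar> \<le> Cc * indicator (cutoff_support n) x"
    using cut_bounded[OF f(1) n] by blast
  have F'_le: "cmod (F' x) \<le> \<bar>Cc\<bar> * \<bar>Cg\<bar> + M * \<bar>C2\<bar>" for x
  proof (cases "x \<in> K")
    case True
    have "\<bar>cutoff n x * f x\<bar> \<le> \<bar>Cc\<bar>" using Cc[of x] by (cases "x \<in> cutoff_support n") auto
    hence "\<bar>cutoff n x * f x\<bar> * cmod (gw t x) \<le> \<bar>Cc\<bar> * \<bar>Cg\<bar>" using Cg[of x] by (intro mult_mono) auto
    moreover have "\<bar>w t x\<bar> * cmod (grad_cut n f f' x) \<le> M * \<bar>C2\<bar>"
      using w_le[of t x] t C2[of x] True K(2) M_nonneg by (intro mult_mono) auto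
    ultimately show ?thesis using True K(2) unfolding F'_def
      by (auto intro!: order_trans[OF norm_triangle_ineq] add_mono simp: abs_mult)
  next
    case False
    hence "F' x = 0" using K by (simp add: F'_def)
    thus ?thesis using M_nonneg by simp
  qed
  obtain R where R: "\<And>x. x \<in> K \<Longrightarrow> cmod x \<le> R" using compact_imp_bounded[OF K(1)] bounded_iff by metis
  have GP: "GDERIV (\<lambda>x. cutoff N x * stream_fun t x) x :> P x" for x
    unfolding P_def by (rule GDERIV_cut[OF GDERIV_stream_fun N(1)]) (use t in auto)
  have GF: "GDERIV (\<lambda>x. cutoff n x * f x * w t x) x :> F' x" for x
    unfolding F'_def
  proof (rule GDERIV_extend_by_0[OF open_D _ K(1,2)])
    fix x assume x: "x \<in> D"
    have "GDERIV (\<lambda>x. cutoff n x * f x) x :> grad_cut n f f' x"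
      using GDERIV_cut[OF f(1) n, of x] x by simp
    thus "GDERIV (\<lambda>x. cutoff n x * f x * w t x) x :> (cutoff n x * f x) *\<^sub>R gw t x + w t x *\<^sub>R grad_cut n f f' x"
      by (intro GDERIV_mult GDERIV_w t x)
  qed (simp add: K(3))
  have null: "integrable lborel (\<lambda>x. perp (P x) \<bullet> F' x)" "(LBINT x. perp (P x) \<bullet> F' x) = 0"
    using null_lagrangian[OF GP P_le GF F'_le, of R] R K(3) by (metis linorder_not_le mult_zero_right)+
  let ?c = "\<lambda>x. cutoff n x * f x * wt t x" and ?d = "\<lambda>x. w t x * (perp (stream_grad t x) \<bullet> grad_cut n f f' x)"
  have split: "?d x = perp (P x) \<bullet> F' x + ?c x" for x
  proof (cases "x \<in> K")
    case True
    hence x: "x \<in> D" using K by auto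
    have "P x = stream_grad t x" using x N(2,3)[OF True] by (simp add: P_def grad_cut_def)
    moreover have "wt t x = - (perp (stream_grad t x) \<bullet> gw t x)"
      using vorticity_equation[OF t x] by (simp add: stream_grad_def)
    ultimately show ?thesis using x by (simp add: F'_def inner_add_right)
  next
    case False
    show ?thesis
    proof (cases "x \<in> D")
      case True
      thus ?thesis using False K wt0 by (simp add: F'_def)
    next
      case False2: False
      thus ?thesis using False K by (simp add: F'_def cutoff_def)
    qed
  qed
  obtain Cw where Cw: "\<forall>x\<in>cutoff_support n. \<forall>s\<in>{t..t}. \<bar>wt s x\<bar> \<le> Cw"
    using wt_le[OF cutoff_support(1,2)[OF n] t] by blast
  have ic: "integrable lborel ?c"
  proof (rule Bochner_Integration.integrable_bound[OF integrable_cutoff_support[OF n, of "\<bar>Cc\<bar> * \<bar>Cw\<bar>"]])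
    show "?c \<in> borel_measurable lborel" using wt_measurable_cut[OF t f(1) n] by simp
    show "AE x in lborel. norm (?c x) \<le> norm ((\<bar>Cc\<bar> * \<bar>Cw\<bar>) * indicator (cutoff_support n) x)"
    proof (rule AE_I2)
      fix x
      show "norm (?c x) \<le> norm ((\<bar>Cc\<bar> * \<bar>Cw\<bar>) * indicator (cutoff_support n) x)"
      proof (cases "x \<in> cutoff_support n")
        case True
        have "\<bar>cutoff n x * f x\<bar> * \<bar>wt t x\<bar> \<le> \<bar>Cc\<bar> * \<bar>Cw\<bar>"
          using Cc[of x] bspec[OF Cw True] True by (intro mult_mono) auto
        thus ?thesis using True by (simp add: abs_mult)
      qed (simp add: cutoff_support(3)[OF n])
    qed
  qed
  show ?int unfolding split using null(1) ic by (rule Bochner_Integration.integrable_add)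
  show ?eq unfolding split using null ic by simp
qed

text \<open>On the compact support of the cutoff the time derivative of the vorticity is bounded near \<open>t\<close>, which dominates the
  difference quotients.\<close>

lemma DERIV_integral_cut:
  assumes t: "0 < t" and f: "\<And>x. x \<in> D \<Longrightarrow> GDERIV f x :> f' x" and n: "1 \<le> n"
  shows "((\<lambda>t. LBINT x. cutoff n x * f x * w t x) has_real_derivative (LBINT x. cutoff n x * f x * wt t x)) (at t)"
proof -
  let ?c = "\<lambda>x. cutoff n x * f x"
  obtain Cc where Cc: "\<And>x. \<bar>?c x\<bar> \<le> Cc * indicator (cutoff_support n) x"
    using cut_bounded[OF f n] by blast
  obtain Cw where Cw: "\<And>x s. x \<in> cutoff_support n \<Longrightarrow> s \<in> {t/2..2*t} \<Longrightarrow> \<bar>wt s x\<bar> \<le> Cw"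
    using wt_le[OF cutoff_support(1)[OF n] cutoff_support(2)[OF n] half_gt_zero[OF t], of "2*t"] by blast
  have int: "integrable lborel (\<lambda>x. ?c x * w s x)" if s: "0 \<le> s" for s
    by (intro integrable_mult_compact_density density s cut_measurable[OF f n]
      bounded_on_compact[OF GDERIV_continuous[OF GDERIV_cut[OF f n]]])
  let ?I = "\<lambda>s. LBINT x. ?c x * w s x" and ?d = "LBINT x. ?c x * wt t x"
  have "((\<lambda>s. (?I s - ?I t) / (s - t)) \<longlongrightarrow> ?d) (at t)"
    unfolding tendsto_at_iff_sequentially comp_def
  proof safe
    fix X :: "nat \<Rightarrow> real" assume X: "\<forall>i. X i \<in> UNIV - {t}" "X \<longlonglongrightarrow> t"
    have "\<forall>\<^sub>F i in sequentially. t / 2 < X i \<and> X i < 2 * t"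
      using order_tendstoD[OF X(2), of "t/2"] order_tendstoD[OF X(2), of "2*t"] t by (auto intro: eventually_conj)
    then obtain N where N: "\<And>i. N \<le> i \<Longrightarrow> t / 2 < X i \<and> X i < 2 * t" unfolding eventually_sequentially by blast
    let ?q = "\<lambda>i x. ?c x * ((w (X (i + N)) x - w t x) / (X (i + N) - t))"
    have "(\<lambda>i. LBINT x. ?q i x) \<longlonglongrightarrow> ?d"
    proof (rule integral_dominated_convergence[OF _ _ integrable_cutoff_support[OF n, of "\<bar>Cc\<bar> * \<bar>Cw\<bar>"]])
      show "(\<lambda>x. ?c x * wt t x) \<in> borel_measurable lborel" using wt_measurable_cut[OF t f n] by simp
      show "?q i \<in> borel_measurable lborel" for i
        using cut_measurable[OF f n] N[of "i + N"] t by (auto intro!: borel_measurable_times borel_measurable_divide borel_measurable_diff w_measurable)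
      show "AE x in lborel. (\<lambda>i. ?q i x) \<longlonglongrightarrow> ?c x * wt t x"
      proof (rule AE_I2)
        fix x show "(\<lambda>i. ?q i x) \<longlonglongrightarrow> ?c x * wt t x"
        proof (cases "x \<in> D")
          case True
          have "((\<lambda>s. (w s x - w t x) / (s - t)) \<longlongrightarrow> wt t x) (at t)"
            using DERIV_w[OF t True] unfolding has_field_derivative_iff .
          hence "(\<lambda>i. (w (X i) x - w t x) / (X i - t)) \<longlonglongrightarrow> wt t x"
            using X unfolding tendsto_at_iff_sequentially comp_def by auto
          from LIMSEQ_ignore_initial_segment[OF this, of N] show ?thesis by (intro tendsto_mult tendsto_const)
        qed (simp add: cutoff_def)
      qed
      show "AE x in lborel. norm (?q i x) \<le> \<bar>Cc\<bar> * \<bar>Cw\<bar> * indicator (cutoff_support n) x" for i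
      proof (rule AE_I2)
        fix x show "norm (?q i x) \<le> \<bar>Cc\<bar> * \<bar>Cw\<bar> * indicator (cutoff_support n) x"
        proof (cases "x \<in> cutoff_support n")
          case True
          hence x: "x \<in> D" using cutoff_support(2)[OF n] by auto
          have "norm (w (X (i + N)) x - w t x) \<le> Cw * norm (X (i + N) - t)"
          proof (rule field_differentiable_bound[of "{t/2..2*t}" "\<lambda>s. w s x" "\<lambda>s. wt s x"])
            fix s assume s: "s \<in> {t/2..2*t}"
            hence "0 < s" using t by auto
            thus "((\<lambda>s. w s x) has_field_derivative wt s x) (at s within {t / 2..2 * t})"
              using DERIV_w[OF _ x] has_field_derivative_at_within by blast
            show "norm (wt s x) \<le> Cw" using Cw[OF True s] by simp
          qed (use t N[of "i + N"] in auto)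
          hence "\<bar>(w (X (i + N)) x - w t x) / (X (i + N) - t)\<bar> \<le> \<bar>Cw\<bar>"
            using X by (auto simp: abs_divide divide_le_eq intro: order_trans mult_right_mono)
          hence "\<bar>?c x\<bar> * \<bar>(w (X (i + N)) x - w t x) / (X (i + N) - t)\<bar> \<le> \<bar>Cc\<bar> * \<bar>Cw\<bar>"
            using Cc[of x] True by (intro mult_mono) auto
          thus ?thesis using True by (simp add: abs_mult)
        qed (simp add: cutoff_support(3)[OF n])
      qed
    qed
    moreover have "(LBINT x. ?q i x) = (?I (X (i + N)) - ?I t) / (X (i + N) - t)" for i
    proof -
      have "(LBINT x. ?q i x) = (LBINT x. (?c x * w (X (i + N)) x - ?c x * w t x) / (X (i + N) - t))"
        by (simp add: right_diff_distrib)
      thus ?thesis using int[of t] int[of "X (i + N)"] t N[of "i + N"] by simp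
    qed
    ultimately have "(\<lambda>i. (?I (X (i + N)) - ?I t) / (X (i + N) - t)) \<longlonglongrightarrow> ?d"
      by (simp only:)
    thus "(\<lambda>i. (?I (X i) - ?I t) / (X i - t)) \<longlonglongrightarrow> ?d"
      by (rule LIMSEQ_offset)
  qed
  thus ?thesis unfolding has_field_derivative_iff by simp
qed

lemma continuous_integral_cut:
  assumes f: "\<And>x. x \<in> D \<Longrightarrow> GDERIV f x :> f' x" and n: "1 \<le> n"
  shows "continuous_on {0..} (\<lambda>t. LBINT x. cutoff n x * f x * w t x)"
  unfolding continuous_on_sequentially comp_def
proof safe
  fix X :: "nat \<Rightarrow> real" and t assume X: "\<forall>i. X i \<in> {0..}" "X \<longlonglongrightarrow> t" and t: "0 \<le> t"
  let ?c = "\<lambda>x. cutoff n x * f x"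
  obtain Cc where Cc: "\<And>x. \<bar>?c x\<bar> \<le> Cc * indicator (cutoff_support n) x"
    using cut_bounded[OF f n] by blast
  show "(\<lambda>i. LBINT x. ?c x * w (X i) x) \<longlonglongrightarrow> (LBINT x. ?c x * w t x)"
  proof (rule integral_dominated_convergence[OF _ _ integrable_cutoff_support[OF n, of "\<bar>Cc\<bar> * M"]])
    show "(\<lambda>x. ?c x * w t x) \<in> borel_measurable lborel" "(\<lambda>x. ?c x * w (X i) x) \<in> borel_measurable lborel" for i
      using cut_measurable[OF f n] t X by (auto intro!: borel_measurable_times w_measurable)
    show "AE x in lborel. (\<lambda>i. ?c x * w (X i) x) \<longlonglongrightarrow> ?c x * w t x"
      using w_continuous_time X t unfolding continuous_on_sequentially comp_def
      by (intro AE_I2 tendsto_mult tendsto_const) auto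
    show "AE x in lborel. norm (?c x * w (X i) x) \<le> \<bar>Cc\<bar> * M * indicator (cutoff_support n) x" for i
    proof (rule AE_I2)
      fix x
      have "\<bar>?c x\<bar> * \<bar>w (X i) x\<bar> \<le> (\<bar>Cc\<bar> * indicator (cutoff_support n) x) * M"
        using Cc[of x] w_le[of "X i" x] X M_nonneg by (intro mult_mono) (auto simp: indicator_def)
      thus "norm (?c x * w (X i) x) \<le> \<bar>Cc\<bar> * M * indicator (cutoff_support n) x"
        by (simp add: abs_mult mult_ac)
    qed
  qed
qed

text \<open>At a fixed time the support of the vorticity is compact, so large cutoffs are not seen at all.\<close>

lemma cut_eventually_trivial:
  assumes "0 < t"
  shows "\<forall>\<^sub>F n in sequentially. \<forall>x. w t x * (perp (stream_grad t x) \<bullet> grad_cut n f f' x) = w t x * (perp (stream_grad t x) \<bullet> f' x)"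
proof -
  obtain K where K: "compact K" "K \<subseteq> D" "\<And>x. x \<notin> K \<Longrightarrow> w t x = 0" using gw_support[OF assms] by blast
  show ?thesis using cutoff_eventually_1[OF K(1,2)]
  proof eventually_elim
    case (elim n)
    show ?case
    proof
      fix x show "w t x * (perp (stream_grad t x) \<bullet> grad_cut n f f' x) = w t x * (perp (stream_grad t x) \<bullet> f' x)"
        using elim K(3)[of x] by (cases "x \<in> K") (auto simp: grad_cut_def)
    qed
  qed
qed

lemma integral_cut_eventually:
  assumes "0 \<le> t"
  shows "\<forall>\<^sub>F n in sequentially. (LBINT x. cutoff n x * f x * w t x) = (LBINT x. f x * w t x)"
proof -
  obtain K where K: "compact K" "K \<subseteq> D" "\<And>x. x \<notin> K \<Longrightarrow> w t x = 0"
    using density[OF assms] unfolding compact_density_def by blast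
  show ?thesis using cutoff_eventually_1[OF K(1,2)]
  proof eventually_elim
    case (elim n)
    have "cutoff n x * f x * w t x = f x * w t x" for x
      using elim K(3)[of x] by (cases "x \<in> K") auto
    thus ?case by (simp only:)
  qed
qed

text \<open>The factor \<open>n\<close> of the cutoff gradient meets a strip of area \<open>O(1 / n)\<close>, on which \<open>f\<close>, the velocity and the vorticity
  are bounded; elsewhere the gradient of the cutoff, multiplied by \<open>f\<close>, is bounded and is integrated against the vorticity.\<close>

lemma cut_flux_bounded:
  assumes f: "\<And>x. x \<in> D \<Longrightarrow> GDERIV f x :> f' x" "\<And>x. x \<in> D \<Longrightarrow> \<bar>f x\<bar> \<le> A * (1 + log_T x)" "\<And>x. x \<in> D \<Longrightarrow> cmod (f' x) \<le> A"
    and A: "0 \<le> A"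
  shows "\<exists>C. \<forall>n\<ge>16. \<forall>t>0. \<bar>LBINT x. w t x * (perp (stream_grad t x) \<bullet> grad_cut n f f' x)\<bar> \<le> C"
proof -
  obtain Cs where Cs: "0 \<le> Cs" "\<And>n. 16 \<le> n \<Longrightarrow> emeasure lborel (strip n) \<le> ennreal (Cs / real n)"
    using strip_area by blast
  \<comment> \<open>The three sources of flux: the gradient of \<open>f\<close>, the cutoff at infinity, and the strip at the curve.\<close>
  define E where "E = speed * ((A + 4 * A * B) * m + A * B * 24 * M * Cs)"
  have "\<bar>LBINT x. w t x * (perp (stream_grad t x) \<bullet> grad_cut n f f' x)\<bar> \<le> E" if n: "16 \<le> n" and t: "0 < t" for n t
  proof -
    define s where "s = strip n"
    have s_meas [measurable]: "s \<in> sets borel" unfolding s_def strip_def by measurable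
    have s_fin: "emeasure lborel s < \<infinity>" using Cs(2)[OF n] by (auto simp: s_def intro: le_less_trans)
    have s_area: "measure lborel s \<le> Cs / real n"
      using Cs(2)[OF n] Cs(1) unfolding s_def[symmetric] measure_def by (intro enn2real_leI) auto
    let ?d = "\<lambda>x. w t x * (perp (stream_grad t x) \<bullet> grad_cut n f f' x)"
    let ?b = "\<lambda>x. speed * ((A + 4 * A * B) * \<bar>w t x\<bar> + (A * B * 24 * real n * M) * indicator s x)"
    have t0: "0 \<le> t" using t by simp
    have int: "integrable lborel ?d" by (rule integral_cut_time_derivative(1)[OF t f(1,3)]) (use n in auto)
    have ib: "integrable lborel ?b"
      using s_fin by (intro integrable_mult_right Bochner_Integration.integrable_add integrable_abs
        integrable_compact_density density t0 integrable_real_indicator) auto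
    have le: "\<bar>?d x\<bar> \<le> ?b x" for x
    proof (cases "x \<in> D")
      case True
      have "\<bar>perp (stream_grad t x) \<bullet> grad_cut n f f' x\<bar> \<le> speed * (A + A * (B * (24 * real n * indicator s x + 4)))"
        unfolding s_def using norm_grad_cut_le[of f A f' x n] f True n A stream_grad_le[OF t0 True] speed_nonneg
        by (intro order_trans[OF Cauchy_Schwarz_ineq2] mult_mono) auto
      hence "\<bar>w t x\<bar> * \<bar>perp (stream_grad t x) \<bullet> grad_cut n f f' x\<bar> \<le> \<bar>w t x\<bar> * (speed * (A + A * (B * (24 * real n * indicator s x + 4))))"
        by (intro mult_left_mono) auto
      also have "\<dots> = speed * ((A + 4 * A * B) * \<bar>w t x\<bar> + \<bar>w t x\<bar> * (A * B * 24 * real n) * indicator s x)"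
        by (simp add: algebra_simps)
      also have "\<dots> \<le> speed * ((A + 4 * A * B) * \<bar>w t x\<bar> + M * (A * B * 24 * real n) * indicator s x)"
        using w_le[OF t0, of x] A B_ge_1 speed_nonneg by (intro mult_left_mono add_left_mono mult_right_mono) auto
      finally show ?thesis by (simp add: abs_mult mult_ac)
    next
      case False
      hence "w t x = 0" using compact_density_off_D[OF density[OF t0]] by simp
      thus ?thesis using A B_ge_1 M_nonneg speed_nonneg by simp
    qed
    have "\<bar>integral\<^sup>L lborel ?d\<bar> \<le> (LBINT x. \<bar>?d x\<bar>)" by (rule integral_abs_bound)
    also have "\<dots> \<le> integral\<^sup>L lborel ?b" by (intro integral_mono integrable_abs int ib le)
    also have "\<dots> = speed * ((A + 4 * A * B) * m + (A * B * 24 * real n * M) * measure lborel s)"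
      using integrable_abs[OF integrable_compact_density[OF density[OF t0]]] s_fin w_L1[OF t0] by simp
    also have "\<dots> \<le> speed * ((A + 4 * A * B) * m + (A * B * 24 * real n * M) * (Cs / real n))"
      using A B_ge_1 M_nonneg speed_nonneg by (intro mult_left_mono add_left_mono s_area) auto
    also have "\<dots> = E" using n by (simp add: E_def field_simps)
    finally show ?thesis .
  qed
  thus ?thesis by blast
qed

text \<open>The fundamental theorem of calculus for the moments with cutoff, followed by dominated convergence in time: the time
  derivatives are bounded uniformly in \<open>n\<close> and \<open>t\<close> by \<open>cut_flux_bounded\<close> and converge at each time by
  \<open>cut_eventually_trivial\<close>.\<close>

lemma moment_increment_le:
  assumes f: "\<And>x. x \<in> D \<Longrightarrow> GDERIV f x :> f' x" "\<And>x. x \<in> D \<Longrightarrow> \<bar>f x\<bar> \<le> A * (1 + log_T x)" "\<And>x. x \<in> D \<Longrightarrow> cmod (f' x) \<le> A"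
    and A: "0 \<le> A" and st: "0 \<le> s" "s \<le> t"
    and flux: "\<And>\<tau>. s < \<tau> \<Longrightarrow> \<tau> < t \<Longrightarrow> \<bar>LBINT x. w \<tau> x * (perp (stream_grad \<tau> x) \<bullet> f' x)\<bar> \<le> \<eta>"
    and \<eta>: "0 \<le> \<eta>"
  shows "\<bar>(LBINT x. f x * w t x) - (LBINT x. f x * w s x)\<bar> \<le> \<eta> * (t - s)"
proof -
  define d where "d n \<tau> = (if s < \<tau> \<and> \<tau> < t then LBINT x. w \<tau> x * (perp (stream_grad \<tau> x) \<bullet> grad_cut n f f' x) else 0)" for n \<tau>
  define h where "h \<tau> = (if s < \<tau> \<and> \<tau> < t then LBINT x. w \<tau> x * (perp (stream_grad \<tau> x) \<bullet> f' x) else 0)" for \<tau>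
  define G where "G n t = (LBINT x. cutoff n x * f x * w t x)" for n t
  obtain C where C: "\<And>n t. 16 \<le> n \<Longrightarrow> 0 < t \<Longrightarrow> \<bar>LBINT x. w t x * (perp (stream_grad t x) \<bullet> grad_cut n f f' x)\<bar> \<le> C"
    using cut_flux_bounded[OF f A] by blast
  let ?m = "\<lambda>r. LBINT x. f x * w r x"
  have "(h has_integral (?m t - ?m s)) {s..t}"
  proof (rule has_integral_dominated_convergence)
    fix n :: nat
    \<comment> \<open>The strip is controlled from \<open>n = 16\<close> on.\<close>
    let ?n = "n + 16"
    show "(d ?n has_integral G ?n t - G ?n s) {s..t}"
    proof (rule fundamental_theorem_of_calculus_interior[OF st(2)])
      show "continuous_on {s..t} (G ?n)" unfolding G_def
        by (rule continuous_on_subset[OF continuous_integral_cut[OF f(1)]]) (use st in auto)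
      fix \<tau> assume \<tau>: "\<tau> \<in> {s<..<t}"
      have \<tau>0: "0 < \<tau>" using \<tau> st by auto
      have "(G ?n has_real_derivative (LBINT x. cutoff ?n x * f x * wt \<tau> x)) (at \<tau>)"
        unfolding G_def by (rule DERIV_integral_cut[OF \<tau>0 f(1)]) auto
      also have "(LBINT x. cutoff ?n x * f x * wt \<tau> x) = d ?n \<tau>"
        using integral_cut_time_derivative(2)[OF \<tau>0 f(1,3)] \<tau> by (simp add: d_def)
      finally show "(G ?n has_vector_derivative d ?n \<tau>) (at \<tau>)"
        by (simp add: has_real_derivative_iff_has_vector_derivative)
    qed
    show "\<forall>\<tau>\<in>{s..t}. norm (d ?n \<tau>) \<le> \<bar>C\<bar>"
    proof
      fix \<tau> show "norm (d ?n \<tau>) \<le> \<bar>C\<bar>" using C[of ?n \<tau>] st by (auto simp: d_def)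
    qed
  next
    show "(\<lambda>_. \<bar>C\<bar>) integrable_on {s..t}" by (rule integrable_const_ivl)
    show "\<forall>\<tau>\<in>{s..t}. (\<lambda>n. d (n + 16) \<tau>) \<longlonglongrightarrow> h \<tau>"
    proof
      fix \<tau>
      show "(\<lambda>n. d (n + 16) \<tau>) \<longlonglongrightarrow> h \<tau>"
      proof (cases "s < \<tau> \<and> \<tau> < t")
        case True
        hence "0 < \<tau>" using st by auto
        from cut_eventually_trivial[OF this, of f f'] have "\<forall>\<^sub>F n in sequentially. d n \<tau> = h \<tau>"
          by eventually_elim (simp only: d_def h_def)
        hence "(\<lambda>n. d n \<tau>) \<longlonglongrightarrow> h \<tau>" by (rule tendsto_eventually)
        thus ?thesis by (rule LIMSEQ_ignore_initial_segment)
      qed (auto simp: d_def h_def)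
    qed
    have "(\<lambda>n. G n t - G n s) \<longlonglongrightarrow> ?m t - ?m s"
      unfolding G_def using integral_cut_eventually[of t f] integral_cut_eventually[of s f] st
      by (intro tendsto_diff tendsto_eventually) auto
    thus "(\<lambda>n. G (n + 16) t - G (n + 16) s) \<longlonglongrightarrow> ?m t - ?m s"
      by (rule LIMSEQ_ignore_initial_segment)
  qed
  hence "norm (?m t - ?m s) \<le> \<eta> * measure lborel (cbox s t)"
    using flux \<eta> by (intro has_integral_bound[of \<eta> h]) (auto simp: h_def)
  thus ?thesis using st by simp
qed

section \<open>Conservation of mass, sign and energy\<close>

text \<open>Constant test functions have no flux.\<close>

lemma mass_conserved:
  assumes t: "0 \<le> t" shows "(LBINT x. w t x) = (LBINT x. w 0 x)"
proof -
  have "\<bar>(LBINT x. 1 * w t x) - (LBINT x. 1 * w 0 x)\<bar> \<le> 0 * (t - 0)"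
    by (rule moment_increment_le[where f' = "\<lambda>_. 0" and A = 1])
      (use t log_T_pos in \<open>auto simp: GDERIV_const less_imp_le\<close>)
  thus ?thesis by simp
qed

text \<open>The integrals of \<open>w t\<close> and of its absolute value are both conserved and agree at time zero.\<close>

lemma w_nonneg:
  assumes t: "0 \<le> t" shows "0 \<le> w t x"
proof (rule ccontr)
  assume "\<not> 0 \<le> w t x"
  have i: "integrable lborel (w t)" by (intro integrable_compact_density density t)
  have "(LBINT x. w t x) = (LBINT x. \<bar>w t x\<bar>)"
    using mass_conserved[OF t] w_L1[of 0] w_L1[OF t] w_0_nonneg by simp
  hence "(LBINT x. \<bar>w t x\<bar> - w t x) = 0" using i by simp
  hence "AE x in lborel. \<bar>w t x\<bar> - w t x = 0"
    using i by (subst (asm) integral_nonneg_eq_0_iff_AE) auto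
  hence "AE x in lborel. x \<notin> {x. w t x < 0}" by eventually_elim auto
  moreover have op: "open {x. w t x < 0}"
    using w_continuous_space[OF t] by (intro open_Collect_less continuous_at_imp_continuous_on) auto
  ultimately have "emeasure lborel {x. w t x < 0} = 0"
    by (subst (asm) AE_iff_measurable[OF _ refl]) (auto simp: )
  hence "{x. w t x < 0} \<in> null_sets lebesgue"
    using op by (auto intro!: null_setsI null_sets_completionI)
  hence "negligible {x. w t x < 0}" by (simp add: negligible_iff_null_sets)
  moreover have "x \<in> {x. w t x < 0}" using \<open>\<not> 0 \<le> w t x\<close> by simp
  ultimately show False using open_not_negligible[OF op] by blast
qed

text \<open>Pointwise continuity in time and conservation of the \<open>L\<^sup>1\<close> norm, combined by Scheffe's lemma. This
  replaces uniform control of the supports.\<close>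

lemma L1_continuous:
  assumes s: "0 \<le> s"
  shows "((\<lambda>t. LBINT x. \<bar>w t x - w s x\<bar>) \<longlongrightarrow> 0) (at s within {0..})"
  unfolding tendsto_at_iff_sequentially comp_def
proof safe
  fix X :: "nat \<Rightarrow> real" assume X: "\<forall>i. X i \<in> {0..} - {s}" "X \<longlonglongrightarrow> s"
  have X0: "0 \<le> X i" for i using X by auto
  have i: "integrable lborel (w t)" if "0 \<le> t" for t using that by (intro integrable_compact_density density)
  have nn: "(\<integral>\<^sup>+x. norm (w t x) \<partial>lborel) = ennreal m" if "0 \<le> t" for t
    using nn_integral_eq_integral[OF integrable_abs[OF i[OF that]]] w_L1[OF that] by simp
  have "(\<lambda>n. \<integral>\<^sup>+x. norm (w (X n) x - w s x) \<partial>lborel) \<longlonglongrightarrow> 0"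
  proof (rule Scheffe_lemma2)
    show "w (X n) \<in> borel_measurable lborel" for n using w_measurable[OF X0] by simp
    show "integrable lborel (w s)" by (rule i[OF s])
    show "AE x in lborel. (\<lambda>n. w (X n) x) \<longlonglongrightarrow> w s x"
      using w_continuous_time X0 X(2) s unfolding continuous_on_sequentially comp_def by (intro AE_I2) auto
    show "(\<integral>\<^sup>+x. norm (w (X n) x) \<partial>lborel) \<le> (\<integral>\<^sup>+x. norm (w s x) \<partial>lborel)" for n
      using nn[OF X0] nn[OF s] by simp
  qed
  moreover have "(\<integral>\<^sup>+x. norm (w (X n) x - w s x) \<partial>lborel) = ennreal (LBINT x. \<bar>w (X n) x - w s x\<bar>)" for n
    using nn_integral_eq_integral[of lborel "\<lambda>x. \<bar>w (X n) x - w s x\<bar>"] i[OF X0] i[OF s] by simp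
  ultimately have "(\<lambda>n. ennreal (LBINT x. \<bar>w (X n) x - w s x\<bar>)) \<longlonglongrightarrow> ennreal 0" by simp
  thus "(\<lambda>n. LBINT x. \<bar>w (X n) x - w s x\<bar>) \<longlonglongrightarrow> 0"
    by (subst (asm) tendsto_ennreal_iff) auto
qed

text \<open>First choose the radius \<open>\<rho>\<close> in \<open>integral_riesz_kernel_le\<close> so that the bounded part contributes at most \<open>e / 2\<close>,
  then the \<open>L\<^sup>1\<close> distance.\<close>

lemma grad_potential_small:
  assumes e: "0 < e"
  shows "\<exists>\<delta>>0. \<forall>s\<ge>0. \<forall>t\<ge>0. \<forall>x\<in>D. (LBINT x. \<bar>w t x - w s x\<bar>) < \<delta> \<longrightarrow>
      cmod (grad_potential (w t) x - grad_potential (w s) x) \<le> e"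
proof -
  define k where "k = 2 * B\<^sup>2"
  have k: "0 < k" using B_ge_1 by (simp add: k_def)
  \<comment> \<open>The summand \<open>1\<close> avoids division by zero when \<open>M = 0\<close>.\<close>
  define \<rho> where "\<rho> = e / (2 * (k * (8 * pi * M) + 1))"
  have "0 \<le> k * (8 * pi * M)" using k M_nonneg by simp
  hence \<rho>: "0 < \<rho>" unfolding \<rho>_def using e by (intro divide_pos_pos mult_pos_pos add_nonneg_pos) auto
  have "k * (8 * pi * M) * \<rho> \<le> (k * (8 * pi * M) + 1) * \<rho>" using \<rho> by simp
  also have "\<dots> = e / 2"
  proof -
    have half: "c * (e / (2 * c)) = e / 2" if "c \<noteq> 0" for c :: real using that by simp
    show ?thesis unfolding \<rho>_def by (rule half) (use \<open>0 \<le> k * (8 * pi * M)\<close> in linarith)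
  qed
  finally have 2: "k * (4 * pi * \<rho> * (2 * M)) \<le> e / 2" by (simp add: mult_ac)
  define \<delta> where "\<delta> = e / (2 * (k * (1 + 1 / \<rho>)))"
  have pos: "0 < k * (1 + 1 / \<rho>)" using k \<rho> by (simp add: add_pos_pos)
  show ?thesis
  proof (intro exI[of _ \<delta>] conjI allI impI ballI)
    show "0 < \<delta>" unfolding \<delta>_def by (rule divide_pos_pos[OF e mult_pos_pos[OF _ pos]]) simp
    fix s t :: real and x assume st: "0 \<le> s" "0 \<le> t" and x: "x \<in> D" and less: "(LBINT x. \<bar>w t x - w s x\<bar>) < \<delta>"
    have d: "compact_density (\<lambda>x. w t x - w s x)" by (intro compact_density_diff density st)
    have wd: "\<bar>w t y - w s y\<bar> \<le> 2 * M" for y using w_le[OF st(1), of y] w_le[OF st(2), of y] by linarith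
    have "cmod (grad_potential (w t) x - grad_potential (w s) x) \<le> k * (LBINT y. riesz_kernel x y * \<bar>w t y - w s y\<bar>)"
      using norm_grad_potential_le[OF d x] grad_potential_diff[OF density density x] st by (simp add: k_def)
    also have "\<dots> \<le> k * ((1 + 1 / \<rho>) * (LBINT y. \<bar>w t y - w s y\<bar>) + 4 * pi * \<rho> * (2 * M))"
      using k by (intro mult_left_mono integral_riesz_kernel_le[OF integrable_compact_density[OF d] wd \<rho>]) simp
    also have "\<dots> \<le> k * ((1 + 1 / \<rho>) * \<delta> + 4 * pi * \<rho> * (2 * M))"
      using k \<rho> less by (intro mult_left_mono add_right_mono) auto
    also have "\<dots> = e / 2 + k * (4 * pi * \<rho> * (2 * M))"
    proof -
      have half: "c * (e / (2 * c)) = e / 2" if "c \<noteq> 0" for c :: real using that by simp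
      have "k * (1 + 1 / \<rho>) * \<delta> = e / 2" unfolding \<delta>_def by (rule half) (use pos in linarith)
      hence "k * ((1 + 1 / \<rho>) * \<delta>) = e / 2" by (simp only: mult.assoc)
      thus ?thesis by (simp only: distrib_left[of k "(1 + 1 / \<rho>) * \<delta>"])
    qed
    also have "\<dots> \<le> e" using 2 by simp
    finally show "cmod (grad_potential (w t) x - grad_potential (w s) x) \<le> e" .
  qed
qed

text \<open>The half accounts for the symmetry of the pair interaction; the harmonic part acts like an external potential.\<close>

definition energy :: "real \<Rightarrow> real" where
  "energy t = 1 / 2 * (LBINT x. potential (w t) x * w t x) + \<alpha> / (2 * pi) * (LBINT x. log_T x * w t x)"

text \<open>The quadratic form of a symmetric kernel satisfies \<open>Q t - Q s = \<integral> (\<psi> s + \<psi> t) (w t - w s)\<close>, so the energy difference is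
  that of a moment with a test function that does not depend on the running time.\<close>

lemma energy_diff:
  assumes s: "0 \<le> s" and t: "0 \<le> t"
  defines "f \<equiv> \<lambda>x. (stream_fun s x + stream_fun t x) / 2"
  shows "energy t - energy s = (LBINT x. f x * w t x) - (LBINT x. f x * w s x)"
proof -
  note i = integrable_potential_mult[OF density[OF s] density[OF s]] integrable_potential_mult[OF density[OF s] density[OF t]]
     integrable_potential_mult[OF density[OF t] density[OF s]] integrable_potential_mult[OF density[OF t] density[OF t]]
     integrable_log_T_mult[OF density[OF s]] integrable_log_T_mult[OF density[OF t]]
  have e: "(LBINT x. f x * w r x) = 1 / 2 * (LBINT x. potential (w s) x * w r x)
     + 1 / 2 * (LBINT x. potential (w t) x * w r x) + \<alpha> / (2 * pi) * (LBINT x. log_T x * w r x)"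
    if "r = s \<or> r = t" for r
  proof -
    have "(LBINT x. f x * w r x) = (LBINT x. 1 / 2 * (potential (w s) x * w r x)
     + 1 / 2 * (potential (w t) x * w r x) + \<alpha> / (2 * pi) * (log_T x * w r x))"
      by (rule Bochner_Integration.integral_cong[OF refl]) (simp add: f_def stream_fun_def distrib_right add_divide_distrib)
    also have "\<dots> = 1 / 2 * (LBINT x. potential (w s) x * w r x)
     + 1 / 2 * (LBINT x. potential (w t) x * w r x) + \<alpha> / (2 * pi) * (LBINT x. log_T x * w r x)"
    proof -
      have "integrable lborel (\<lambda>x. potential (w s) x * w r x)" "integrable lborel (\<lambda>x. potential (w t) x * w r x)"
        "integrable lborel (\<lambda>x. log_T x * w r x)" using that i by blast+
      thus ?thesis
        by (simp only: Bochner_Integration.integral_add Bochner_Integration.integrable_add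
          integrable_mult_right integral_mult_right_zero)
    qed
    finally show ?thesis .
  qed
  show ?thesis unfolding e[OF disjI1[OF refl]] e[OF disjI2[OF refl]] energy_def
    using potential_symmetric[OF density[OF s] density[OF t]] by simp
qed

lemma stream_fun_growth:
  assumes "0 \<le> t"
  shows "\<exists>A\<ge>0. \<forall>x\<in>D. \<bar>stream_fun t x\<bar> \<le> A * (1 + log_T x)"
proof -
  obtain A where A: "\<And>x. x \<in> D \<Longrightarrow> (LBINT y. \<bar>green T x y * w t y\<bar>) \<le> A * (1 + log_T x)"
    using potential_growth[OF density[OF assms]] by blast
  define k where "k = \<bar>\<alpha> / (2 * pi)\<bar>"
  have "\<bar>stream_fun t x\<bar> \<le> (\<bar>A\<bar> + k) * (1 + log_T x)" if x: "x \<in> D" for x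
  proof -
    have "\<bar>potential (w t) x\<bar> \<le> A * (1 + log_T x)" using abs_potential_le A[OF x] by (rule order_trans)
    also have "\<dots> \<le> \<bar>A\<bar> * (1 + log_T x)" using log_T_pos[OF x] by (intro mult_right_mono) auto
    finally have "\<bar>potential (w t) x\<bar> \<le> \<bar>A\<bar> * (1 + log_T x)" .
    moreover have "\<bar>\<alpha> / (2 * pi) * log_T x\<bar> \<le> k * (1 + log_T x)"
      unfolding abs_mult k_def using log_T_pos[OF x] by (intro mult_left_mono) auto
    ultimately show ?thesis unfolding stream_fun_def distrib_right
      by (rule order_trans[OF abs_triangle_ineq add_mono])
  qed
  moreover have "0 \<le> \<bar>A\<bar> + k" by (simp add: k_def)
  ultimately show ?thesis by blast
qed

text \<open>The flux of \<open>f = (\<Psi> s + \<Psi> t) / 2\<close> at time \<open>\<tau>\<close> equals that of \<open>f - \<Psi> \<tau>\<close>, because the velocity at time \<open>\<tau>\<close> is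
  orthogonal to the gradient of \<open>\<Psi> \<tau>\<close>. The harmonic parts cancel in this difference.\<close>

lemma energy_increment_le:
  assumes s: "0 \<le> s" and t: "s \<le> t" and e: "0 \<le> e"
    and close: "\<And>\<tau> x. s < \<tau> \<Longrightarrow> \<tau> < t \<Longrightarrow> x \<in> D \<Longrightarrow> cmod (grad_potential (w s) x - grad_potential (w \<tau>) x) \<le> e"
       "\<And>\<tau> x. s < \<tau> \<Longrightarrow> \<tau> < t \<Longrightarrow> x \<in> D \<Longrightarrow> cmod (grad_potential (w t) x - grad_potential (w \<tau>) x) \<le> e"
  shows "\<bar>energy t - energy s\<bar> \<le> (m * speed * e) * (t - s)"
proof -
  have t0: "0 \<le> t" using s t by simp
  define f where "f = (\<lambda>x. (stream_fun s x + stream_fun t x) / 2)"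
  define f' where "f' = (\<lambda>x. (1 / 2) *\<^sub>R (stream_grad s x + stream_grad t x))"
  obtain A1 where A1: "0 \<le> A1" "\<And>x. x \<in> D \<Longrightarrow> \<bar>stream_fun s x\<bar> \<le> A1 * (1 + log_T x)" using stream_fun_growth[OF s] by blast
  obtain A2 where A2: "0 \<le> A2" "\<And>x. x \<in> D \<Longrightarrow> \<bar>stream_fun t x\<bar> \<le> A2 * (1 + log_T x)" using stream_fun_growth[OF t0] by blast
  define A where "A = A1 + A2 + speed"
  have "\<bar>(LBINT x. f x * w t x) - (LBINT x. f x * w s x)\<bar> \<le> (m * speed * e) * (t - s)"
  proof (rule moment_increment_le[where f' = f' and A = A])
    show "0 \<le> A" using A1(1) A2(1) speed_nonneg by (simp add: A_def)
    fix x assume x: "x \<in> D"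
    show "GDERIV f x :> f' x"
      using GDERIV_mult[OF GDERIV_const[of "1/2"] GDERIV_add[OF GDERIV_stream_fun[OF s x] GDERIV_stream_fun[OF t0 x]]]
      by (simp add: f_def f'_def)
    have "\<bar>f x\<bar> \<le> \<bar>stream_fun s x\<bar> + \<bar>stream_fun t x\<bar>" by (simp add: f_def)
    also have "\<dots> \<le> (A1 + A2) * (1 + log_T x)" using A1(2)[OF x] A2(2)[OF x] by (simp add: distrib_right)
    also have "\<dots> \<le> A * (1 + log_T x)"
      using log_T_pos[OF x] speed_nonneg by (intro mult_right_mono) (auto simp: A_def)
    finally show "\<bar>f x\<bar> \<le> A * (1 + log_T x)" .
    have "cmod (f' x) \<le> speed"
      using norm_triangle_ineq[of "stream_grad s x" "stream_grad t x"] stream_grad_le[OF s x] stream_grad_le[OF t0 x]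
      by (simp add: f'_def)
    thus "cmod (f' x) \<le> A" using A1(1) A2(1) by (simp add: A_def)
  next
    fix \<tau> assume \<tau>: "s < \<tau>" "\<tau> < t"
    hence \<tau>0: "0 \<le> \<tau>" using s by simp
    let ?d = "\<lambda>x. w \<tau> x * (perp (stream_grad \<tau> x) \<bullet> f' x)"
    have le: "\<bar>?d x\<bar> \<le> speed * e * \<bar>w \<tau> x\<bar>" for x
    proof (cases "x \<in> D")
      case True
      \<comment> \<open>The velocity is tangent to the level lines of the stream function.\<close>
      have "perp (stream_grad \<tau> x) \<bullet> stream_grad \<tau> x = 0" by (simp only: perp_inner) simp
      hence shift: "perp (stream_grad \<tau> x) \<bullet> f' x = perp (stream_grad \<tau> x) \<bullet> (f' x - stream_grad \<tau> x)"
        by (simp only: inner_diff_right diff_zero)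
      have "f' x - stream_grad \<tau> x = (1 / 2) *\<^sub>R ((grad_potential (w s) x - grad_potential (w \<tau>) x) + (grad_potential (w t) x - grad_potential (w \<tau>) x))"
        by (simp add: f'_def stream_grad_def algebra_simps flip: scaleR_add_left)
      hence near: "cmod (f' x - stream_grad \<tau> x) \<le> e"
        using norm_triangle_le[OF add_mono[OF close(1)[OF \<tau> True] close(2)[OF \<tau> True]]] by simp
      have "cmod (perp (stream_grad \<tau> x)) * cmod (f' x - stream_grad \<tau> x) \<le> speed * e"
        using stream_grad_le[OF \<tau>0 True] speed_nonneg near by (intro mult_mono) auto
      hence "\<bar>perp (stream_grad \<tau> x) \<bullet> f' x\<bar> \<le> speed * e"
        unfolding shift using Cauchy_Schwarz_ineq2[of "perp (stream_grad \<tau> x)" "f' x - stream_grad \<tau> x"] by linarith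
      hence "\<bar>w \<tau> x\<bar> * \<bar>perp (stream_grad \<tau> x) \<bullet> f' x\<bar> \<le> \<bar>w \<tau> x\<bar> * (speed * e)" by (intro mult_left_mono) auto
      thus ?thesis by (simp add: abs_mult mult_ac)
    next
      case False
      thus ?thesis using compact_density_off_D[OF density[OF \<tau>0]] by simp
    qed
    have ib: "integrable lborel (\<lambda>x. speed * e * \<bar>w \<tau> x\<bar>)"
      by (intro integrable_mult_right integrable_abs integrable_compact_density density \<tau>0)
    show "\<bar>LBINT x. ?d x\<bar> \<le> m * speed * e"
    proof (cases "integrable lborel ?d")
      case True
      have "\<bar>LBINT x. ?d x\<bar> \<le> (LBINT x. \<bar>?d x\<bar>)" by (rule integral_abs_bound)
      also have "\<dots> \<le> (LBINT x. speed * e * \<bar>w \<tau> x\<bar>)" by (intro integral_mono integrable_abs True ib le)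
      also have "\<dots> = m * speed * e" using w_L1[OF \<tau>0] by (simp add: mult_ac)
      finally show ?thesis .
    next
      case False
      thus ?thesis using m_nonneg speed_nonneg e by (simp add: not_integrable_integral_eq)
    qed
  qed (use s t e m_nonneg speed_nonneg in auto)
  thus ?thesis unfolding energy_diff[OF s t0] f_def .
qed

text \<open>Shortly before and after \<open>s\<close> all vorticities are close in \<open>L\<^sup>1\<close>, hence all velocities are uniformly close, and
  \<open>energy_increment_le\<close> shows that the increment of the energy is of smaller order than that of time.\<close>

lemma energy_conserved:
  assumes t: "0 \<le> t" shows "energy t = energy 0"
proof -
  have "(energy has_derivative (\<lambda>_. 0)) (at s within {0..})" if s: "s \<in> {0..}" for s
  proof -
    have s0: "0 \<le> s" using s by simp
    have "((\<lambda>t. norm (energy t - energy s - 0) / norm (t - s)) \<longlongrightarrow> 0) (at s within {0..})"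
    proof (rule tendstoI)
      fix e :: real assume e: "0 < e"
      define e' where "e' = e / (2 * (m * speed + 1))"
      have ms: "0 \<le> m * speed" using m_nonneg speed_nonneg by simp
      have e': "0 < e'" using e ms by (simp add: e'_def)
      have "m * speed * e' \<le> (m * speed + 1) * e'" using e' by simp
      also have "\<dots> < e" using e ms by (simp add: e'_def divide_simps)
      finally have le: "m * speed * e' < e" .
      obtain \<delta> where \<delta>: "0 < \<delta>" "\<And>s t x. 0 \<le> s \<Longrightarrow> 0 \<le> t \<Longrightarrow> x \<in> D \<Longrightarrow> (LBINT x. \<bar>w t x - w s x\<bar>) < \<delta> \<Longrightarrow>
          cmod (grad_potential (w t) x - grad_potential (w s) x) \<le> e'"
        using grad_potential_small[OF e'] by blast
      from order_tendstoD(2)[OF L1_continuous[OF s0], of "\<delta> / 2"] \<delta>(1)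
      obtain r where r: "0 < r" "\<And>t. 0 \<le> t \<Longrightarrow> t \<noteq> s \<Longrightarrow> dist t s < r \<Longrightarrow> (LBINT x. \<bar>w t x - w s x\<bar>) < \<delta> / 2"
        unfolding eventually_at by auto
      have r': "(LBINT x. \<bar>w t x - w s x\<bar>) < \<delta> / 2" if "0 \<le> t" "dist t s < r" for t
        using r(2)[of t] that \<delta>(1) by (cases "t = s") auto
      have i: "integrable lborel (w t)" if "0 \<le> t" for t using that by (intro integrable_compact_density density)
      have pair: "(LBINT x. \<bar>w a x - w b x\<bar>) < \<delta>" if "0 \<le> a" "0 \<le> b" "dist a s < r" "dist b s < r" for a b
      proof -
        have "(LBINT x. \<bar>w a x - w b x\<bar>) \<le> (LBINT x. \<bar>w a x - w s x\<bar> + \<bar>w b x - w s x\<bar>)"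
          using i[OF that(1)] i[OF that(2)] i[OF s0]
          by (intro integral_mono Bochner_Integration.integrable_add integrable_abs Bochner_Integration.integrable_diff) auto
        also have "\<dots> = (LBINT x. \<bar>w a x - w s x\<bar>) + (LBINT x. \<bar>w b x - w s x\<bar>)"
          using i[OF that(1)] i[OF that(2)] i[OF s0] by simp
        also have "\<dots> < \<delta>" using r'[OF that(1,3)] r'[OF that(2,4)] by simp
        finally show ?thesis .
      qed
      have inc: "\<bar>energy b - energy a\<bar> \<le> (m * speed * e') * (b - a)"
        if "0 \<le> a" "a \<le> b" "dist a s < r" "dist b s < r" for a b
      proof (rule energy_increment_le[OF that(1,2) less_imp_le[OF e']])
        fix \<tau> x assume \<tau>: "a < \<tau>" "\<tau> < b" and x: "x \<in> D"
        have \<tau>': "0 \<le> \<tau>" "dist \<tau> s < r" using \<tau> that by (auto simp: dist_real_def)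
        show "cmod (grad_potential (w a) x - grad_potential (w \<tau>) x) \<le> e'"
          by (intro \<delta>(2) pair \<tau>' x that)
        show "cmod (grad_potential (w b) x - grad_potential (w \<tau>) x) \<le> e'"
          using that by (intro \<delta>(2) pair \<tau>' x) auto
      qed
      show "\<forall>\<^sub>F t in at s within {0..}. dist (norm (energy t - energy s - 0) / norm (t - s)) 0 < e"
        unfolding eventually_at
      proof (intro exI[of _ r] conjI ballI impI)
        fix t assume t: "t \<in> {0..}" "t \<noteq> s \<and> dist t s < r"
        have "\<bar>energy t - energy s\<bar> \<le> (m * speed * e') * \<bar>t - s\<bar>"
        proof (cases "s \<le> t")
          case True
          thus ?thesis using inc[of s t] t s0 r(1) by simp
        next
          case False
          thus ?thesis using inc[of t s] t s0 r(1) by (simp add: abs_minus_commute)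
        qed
        hence "\<bar>energy t - energy s\<bar> / \<bar>t - s\<bar> \<le> m * speed * e'" using t by (simp add: divide_le_eq)
        thus "dist (norm (energy t - energy s - 0) / norm (t - s)) 0 < e" using le by simp
      qed (rule r(1))
    qed
    thus ?thesis unfolding has_derivative_iff_norm by simp
  qed
  from has_derivative_zero_unique[OF convex_real_interval(1) this, of t 0] t show ?thesis by simp
qed

lemma log_moment_bounded:
  assumes "\<alpha> < 0 \<or> m < \<alpha>"
  shows "\<exists>C. \<forall>t\<ge>0. 1 / (2 * pi) * (LBINT x. log_T x * w t x) \<le> C"
proof -
  define L where "L t = 1 / (2 * pi) * (LBINT x. log_T x * w t x)" for t
  define P where "P t = (LBINT x. potential (w t) x * w t x)" for t
  define c where "c = 4 * B * (2 * m + 4 * pi * M) * m / (2 * pi)"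
  have E: "energy 0 = 1 / 2 * P t + \<alpha> * L t" if "0 \<le> t" for t
    using energy_conserved[OF that] by (simp add: energy_def L_def P_def)
  have mass: "(LBINT x. w t x) = m" if "0 \<le> t" for t
    using w_L1[OF that] w_nonneg[OF that] by simp
  have P: "P t \<le> 0" "- P t \<le> 2 * m * L t + c" if t: "0 \<le> t" for t
  proof -
    have le: "w t y \<le> M" for y using w_le[OF t, of y] by simp
    note b = self_energy_bounds[OF density[OF t] w_nonneg[OF t] le]
    show "P t \<le> 0" unfolding P_def by (rule b(1))
    show "- P t \<le> 2 * m * L t + c" using b(2) unfolding P_def L_def c_def mass[OF t] .
  qed
  from assms show ?thesis
  proof
    assume \<alpha>: "\<alpha> < 0"
    have "L t \<le> energy 0 / \<alpha>" if "0 \<le> t" for t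
    proof -
      have "energy 0 \<le> \<alpha> * L t" using E[OF that] P(1)[OF that] by simp
      thus ?thesis using \<alpha> by (simp add: neg_le_divide_eq mult.commute)
    qed
    thus ?thesis unfolding L_def by blast
  next
    assume \<alpha>: "m < \<alpha>"
    have "L t \<le> (energy 0 + c / 2) / (\<alpha> - m)" if "0 \<le> t" for t
    proof -
      have "(\<alpha> - m) * L t \<le> energy 0 + c / 2" using E[OF that] P(2)[OF that] by (simp add: algebra_simps)
      thus ?thesis using \<alpha> by (simp add: pos_le_divide_eq mult.commute)
    qed
    thus ?thesis unfolding L_def by blast
  qed
qed

end

section \<open>The supremum norm as a limit of moments\<close>

lemma integrable_continuous_compact_support:
  fixes f :: "complex \<Rightarrow> real"
  assumes "continuous_on UNIV f" "compact K" "\<And>x. x \<notin> K \<Longrightarrow> f x = 0"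
  shows "integrable lborel f"
proof -
  have "integrable lborel (\<lambda>x. indicator K x *\<^sub>R f x)"
    by (rule borel_integrable_compact[OF assms(2) continuous_on_subset[OF assms(1)]]) auto
  moreover have "(\<lambda>x. indicator K x *\<^sub>R f x) = f" using assms(3) by (auto simp: indicator_def fun_eq_iff)
  ultimately show ?thesis by (simp only:)
qed

text \<open>If \<open>|f| > d > c\<close> held on a nonempty open set \<open>U\<close>, the moments of \<open>f\<close> would grow at least like
  \<open>d ^ n |U|\<close>, those of \<open>g\<close> at most like \<open>c ^ n\<close>.\<close>

lemma sup_bound_of_moments:
  fixes f g :: "complex \<Rightarrow> real"
  assumes f: "continuous_on UNIV f" "compact K" "\<And>x. x \<notin> K \<Longrightarrow> f x = 0"
    and g: "continuous_on UNIV g" "compact K'" "\<And>x. x \<notin> K' \<Longrightarrow> g x = 0"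
    and c: "\<And>x. \<bar>g x\<bar> \<le> c"
    and moments: "\<And>n::nat. 1 \<le> n \<Longrightarrow> (LBINT x. \<bar>f x\<bar> ^ n) = (LBINT x. \<bar>g x\<bar> ^ n)"
  shows "\<bar>f x\<bar> \<le> c"
proof (rule ccontr)
  assume "\<not> \<bar>f x\<bar> \<le> c"
  define d where "d = (c + \<bar>f x\<bar>) / 2"
  have d: "c < d" "d < \<bar>f x\<bar>" using \<open>\<not> \<bar>f x\<bar> \<le> c\<close> by (auto simp: d_def)
  have c0: "0 \<le> c" using c[of 0] by linarith
  have d0: "0 < d" using c0 d by simp
  define U where "U = {x. d < \<bar>f x\<bar>}"
  have U: "open U" unfolding U_def using f(1) by (intro open_Collect_less continuous_intros) auto
  have UK: "U \<subseteq> K" using f(3) d0 by (force simp: U_def)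
  have U_fin: "emeasure lborel U < \<infinity>"
    using emeasure_mono[OF UK, of lborel] emeasure_compact_finite[OF f(2)] f(2) borel_compact
    by (auto intro: le_less_trans)
  have [measurable]: "U \<in> sets borel" using U by simp
  have K': "K' \<in> sets borel" "emeasure lborel K' < \<infinity>" using emeasure_compact_finite[OF g(2)] g(2) borel_compact by auto
  have bound: "measure lborel U \<le> (c / d) ^ n * measure lborel K'" if n: "1 \<le> n" for n
  proof -
    have fi: "integrable lborel (\<lambda>x. \<bar>f x\<bar> ^ n)"
      by (rule integrable_continuous_compact_support[OF _ f(2)]) (use f n in \<open>auto intro!: continuous_intros\<close>)
    have gi: "integrable lborel (\<lambda>x. \<bar>g x\<bar> ^ n)"
      by (rule integrable_continuous_compact_support[OF _ g(2)]) (use g n in \<open>auto intro!: continuous_intros\<close>)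
    have "d ^ n * measure lborel U = (LBINT x. d ^ n * indicator U x)" by simp
    also have "\<dots> \<le> (LBINT x. \<bar>f x\<bar> ^ n)"
    proof (rule integral_mono[OF _ fi])
      show "integrable lborel (\<lambda>x. d ^ n * indicator U x)"
        using U_fin by (intro integrable_mult_right integrable_real_indicator) auto
      show "d ^ n * indicator U x \<le> \<bar>f x\<bar> ^ n" for x
        using d0 by (auto simp: U_def indicator_def intro!: power_mono)
    qed
    also have "\<dots> = (LBINT x. \<bar>g x\<bar> ^ n)" by (rule moments[OF n])
    also have "\<dots> \<le> (LBINT x. c ^ n * indicator K' x)"
    proof (rule integral_mono[OF gi])
      show "integrable lborel (\<lambda>x. c ^ n * indicator K' x)"
        using K' by (intro integrable_mult_right integrable_real_indicator) auto
      show "\<bar>g x\<bar> ^ n \<le> c ^ n * indicator K' x" for x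
        using g(3)[of x] c[of x] n by (cases "x \<in> K'") (auto simp: zero_power intro!: power_mono)
    qed
    also have "\<dots> = c ^ n * measure lborel K'" by simp
    finally show ?thesis using d0 by (simp add: power_divide field_simps)
  qed
  have "(\<lambda>n. (c / d) ^ n * measure lborel K') \<longlonglongrightarrow> 0 * measure lborel K'"
    using c0 d0 d by (intro tendsto_mult LIMSEQ_power_zero tendsto_const) auto
  hence "measure lborel U \<le> 0"
    using bound by (intro LIMSEQ_le_const[where X = "\<lambda>n. (c / d) ^ n * measure lborel K'"]) auto
  hence "emeasure lborel U = 0" using U_fin by (simp add: measure_le_0_iff emeasure_eq_ennreal_measure)
  hence "U \<in> null_sets lebesgue" by (auto intro!: null_sets_completionI)
  hence "negligible U" by (simp add: negligible_iff_null_sets)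
  moreover have "x \<in> U" using d by (simp add: U_def)
  ultimately show False using open_not_negligible[OF U] by blast
qed

section \<open>From smooth solutions to the moment bound\<close>

lemma Lp_norm_eq_iff:
  assumes "1 \<le> p"
  shows "Lp_norm D p f = Lp_norm D p g \<longleftrightarrow> (LINT x:D|lborel. \<bar>f x\<bar> powr p) = (LINT x:D|lborel. \<bar>g x\<bar> powr p)"
proof -
  have inj: "a = b" if "0 \<le> a" "0 \<le> b" "a powr (1 / p) = b powr (1 / p)" for a b :: real
  proof -
    have "(a powr (1 / p)) powr p = (b powr (1 / p)) powr p" using that(3) by simp
    thus ?thesis using assms that(1,2) by (simp add: powr_powr)
  qed
  have nonneg: "0 \<le> (LINT x:D|lborel. \<bar>h x\<bar> powr p)" for h :: "complex \<Rightarrow> real"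
    unfolding set_lebesgue_integral_def by (intro Bochner_Integration.integral_nonneg) auto
  show ?thesis unfolding Lp_norm_def using inj[OF nonneg nonneg] by metis
qed

lemma set_lebesgue_integral_zero_extension:
  fixes f :: "complex \<Rightarrow> real"
  shows "(LINT x:D|lborel. f x) = (LBINT x. (if x \<in> D then f x else 0))"
  unfolding set_lebesgue_integral_def by (rule Bochner_Integration.integral_cong) auto

lemma nabla_perp_eq: "GDERIV f x :> g \<Longrightarrow> nabla_perp f x = perp g"
  by (simp add: nabla_perp_def GDERIV_imp_grad)

text \<open>First order smoothness in space and time splits into a spatial gradient and a time derivative, both of which are read off from one
  jointly continuous derivative.\<close>

lemma smooth_vorticity_derivatives:
  fixes D :: "complex set"
  assumes D: "open D" and smooth: "smooth_on (D \<times> {0<..}) (\<lambda>(x, t). \<omega> x t)"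
  obtains fd :: "complex \<times> real \<Rightarrow> complex \<times> real \<Rightarrow> real" where "\<And>v. v \<in> Basis \<Longrightarrow> continuous_on (D \<times> {0<..}) (\<lambda>z. fd z v)"
    "\<And>x t. x \<in> D \<Longrightarrow> 0 < t \<Longrightarrow>
       GDERIV (\<lambda>y. \<omega> y t) x :> Complex (fd (x, t) (1, 0)) (fd (x, t) (\<i>, 0))"
    "\<And>x t. x \<in> D \<Longrightarrow> 0 < t \<Longrightarrow> (\<omega> x has_real_derivative fd (x, t) (0, 1)) (at t)"
proof -
  define f where "f = (\<lambda>(x, t). \<omega> x t)"
  define fd where "fd z = frechet_derivative f (at z)" for z
  have op: "open (D \<times> {0<..} :: (complex \<times> real) set)" using D by (intro open_Times) auto
  have C1: "Ck_on (Suc 0) (D \<times> {0<..}) f" using smooth unfolding smooth_on_def f_def by (rule spec)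
  have diff: "f differentiable_on D \<times> {0<..}" using C1 unfolding Ck_on.simps by (rule conjunct1)
  have cont: "continuous_on (D \<times> {0<..}) (\<lambda>z. fd z v)" if "v \<in> Basis" for v
    using bspec[OF conjunct2[OF C1[unfolded Ck_on.simps]] that] unfolding fd_def .
  have der: "(f has_derivative fd (x, t)) (at (x, t))" if "x \<in> D" "0 < t" for x t
  proof -
    have "f differentiable at (x, t)"
      using differentiable_on_eq_differentiable_at[OF op] diff that by blast
    thus ?thesis unfolding fd_def by (rule frechet_derivative_works[THEN iffD1])
  qed
  show thesis
  proof (rule that[of fd])
    fix x t assume x: "x \<in> D" and t: "0 < (t::real)"
    have lin: "linear (fd (x, t))" using der[OF x t] by (rule has_derivative_linear)
    have space: "((\<lambda>y. f (y, t)) has_derivative (\<lambda>h. fd (x, t) (h, 0))) (at x)"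
      by (rule has_derivative_compose[OF has_derivative_Pair[OF has_derivative_ident has_derivative_const] der[OF x t]])
    have "fd (x, t) (h, 0) = h \<bullet> Complex (fd (x, t) (1, 0)) (fd (x, t) (\<i>, 0))" for h
    proof -
      have h: "(h, 0::real) = Re h *\<^sub>R (1, 0) + Im h *\<^sub>R (\<i>, 0)"
        by (simp add: prod_eq_iff complex_eq_iff)
      show ?thesis
        unfolding h linear_add[OF lin] linear_scale[OF lin] inner_complex_def complex.sel real_scaleR_def
        by (rule refl)
    qed
    hence "(\<lambda>h. fd (x, t) (h, 0)) = (\<lambda>h. h \<bullet> Complex (fd (x, t) (1, 0)) (fd (x, t) (\<i>, 0)))"
      by (rule ext)
    with space show "GDERIV (\<lambda>y. \<omega> y t) x :> Complex (fd (x, t) (1, 0)) (fd (x, t) (\<i>, 0))"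
      unfolding gderiv_def f_def by (simp only: prod.case)
    have time: "((\<lambda>s. f (x, s)) has_derivative (\<lambda>h. fd (x, t) (0, h))) (at t)"
      by (rule has_derivative_compose[OF has_derivative_Pair[OF has_derivative_const has_derivative_ident] der[OF x t]])
    have "fd (x, t) (0, h) = fd (x, t) (0, 1) * h" for h
    proof -
      have "fd (x, t) (h *\<^sub>R (0, 1)) = h *\<^sub>R fd (x, t) (0, 1)" by (rule linear_scale[OF lin])
      thus ?thesis by simp
    qed
    hence "(\<lambda>h. fd (x, t) (0, h)) = (*) (fd (x, t) (0, 1))" by (rule ext)
    with time show "(\<omega> x has_real_derivative fd (x, t) (0, 1)) (at t)"
      unfolding has_field_derivative_def f_def by (simp only: prod.case)
  qed (rule cont)
qed

lemma exterior_conformal_map_imp_exterior_map: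
  assumes D: "open (outside \<Gamma>)" and T: "exterior_conformal_map \<Gamma> T"
  defines "T0 \<equiv> \<lambda>z. if z \<in> outside \<Gamma> then T z else 0"
  shows "\<exists>B. exterior_map (outside \<Gamma>) T0 (inv_into (outside \<Gamma>) T) B"
proof -
  let ?D = "outside \<Gamma>" and ?S = "inv_into (outside \<Gamma>) T"
  from T have bij: "bij_betw T ?D {z. 1 < cmod z}" and hol: "T holomorphic_on ?D" and
    holS: "?S holomorphic_on {z. 1 < cmod z}" and bT: "bounded (deriv T ` ?D)"
    and bS: "bounded (deriv ?S ` {z. 1 < cmod z})"
    unfolding exterior_conformal_map_def biholomorphic_def Let_def by auto
  obtain B1 B2 where B1: "\<And>z. z \<in> ?D \<Longrightarrow> cmod (deriv T z) \<le> B1"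
    and B2: "\<And>z. 1 < cmod z \<Longrightarrow> cmod (deriv ?S z) \<le> B2"
    using bT bS unfolding bounded_iff by (metis (no_types, lifting) image_eqI mem_Collect_eq)
  have "exterior_map ?D T0 ?S (max 1 (max B1 B2))"
  proof
    have "(\<lambda>z. indicator ?D z *\<^sub>R T z) \<in> borel_measurable borel"
      using D holomorphic_on_imp_continuous_on[OF hol] by (intro borel_measurable_continuous_on_indicator) auto
    moreover have "(\<lambda>z. indicator ?D z *\<^sub>R T z) = T0" by (auto simp: T0_def fun_eq_iff)
    ultimately show "T0 \<in> borel_measurable borel" by simp
    show "T0 holomorphic_on ?D" using hol by (rule holomorphic_transform) (simp add: T0_def)
    show "cmod (deriv T0 z) \<le> max 1 (max B1 B2)" if z: "z \<in> ?D" for z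
    proof -
      have "deriv T0 z = deriv T z"
        using D z by (intro deriv_cong_ev refl) (auto simp: T0_def eventually_nhds)
      thus ?thesis using B1[OF z] by simp
    qed
    show "cmod (deriv ?S w) \<le> max 1 (max B1 B2)" if "1 < cmod w" for w using B2[OF that] by simp
    show "1 < cmod (T0 z)" if "z \<in> ?D" for z using bij_betwE[OF bij] that by (simp add: T0_def)
    show "?S w \<in> ?D" if "1 < cmod w" for w using bij_betwE[OF bij_betw_inv_into[OF bij]] that by simp
    show "?S (T0 z) = z" if "z \<in> ?D" for z using bij_betw_inv_into_left[OF bij that] that by (simp add: T0_def)
  qed (use D holS in auto)
  thus ?thesis by blast
qed

theorem theorem6:
  fixes \<Gamma> :: "complex set" and T :: "complex \<Rightarrow> complex"
    and \<omega>0 :: "complex \<Rightarrow> real" and \<omega> :: "complex \<Rightarrow> real \<Rightarrow> real" and \<alpha> m :: real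
  assumes "smooth_Jordan_curve \<Gamma>"
    and "exterior_conformal_map \<Gamma> T"
    and "smooth_on (outside \<Gamma>) \<omega>0"
    and "compactly_supported_in (outside \<Gamma>) \<omega>0"
    and "\<forall>x\<in>outside \<Gamma>. 0 \<le> \<omega>0 x"
    and "m = (LINT x:outside \<Gamma>|lborel. \<omega>0 x)"
    and "global_smooth_solution (outside \<Gamma>) T \<alpha> \<omega>0 \<omega>"
    and "\<alpha> < 0 \<or> \<alpha> > m"
  shows "\<exists>M>0. \<forall>t\<ge>0. log_moment (outside \<Gamma>) T \<omega> t \<le> M"
proof -
  define D where "D = outside \<Gamma>"
  have "compact \<Gamma>" using assms(1) unfolding smooth_Jordan_curve_def
    by (metis compact_path_image simple_path_imp_path)
  hence open_D: "open D" unfolding D_def by (intro open_outside compact_imp_closed)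
  define T0 where "T0 z = (if z \<in> D then T z else 0)" for z
  obtain B where "exterior_map D T0 (inv_into D T) B"
    using exterior_conformal_map_imp_exterior_map[OF _ assms(2)] open_D unfolding T0_def[abs_def] D_def by blast
  then interpret E: exterior_map D T0 "inv_into D T" B .
  note sol = assms(7)[folded D_def, unfolded global_smooth_solution_def exterior_vorticity_problem_def]
  have cont: "continuous_on (D \<times> {0..}) (\<lambda>(x, t). \<omega> x t)"
    and supp: "\<And>t. 0 \<le> t \<Longrightarrow> compactly_supported_in D (\<lambda>x. \<omega> x t)"
    and Lp: "\<And>t p. 0 \<le> t \<Longrightarrow> 1 \<le> p \<Longrightarrow> Lp_norm D p (\<lambda>x. \<omega> x t) = Lp_norm D p \<omega>0"
    and pde: "\<And>x t. x \<in> D \<Longrightarrow> 0 < t \<Longrightarrow> deriv (\<omega> x) t + velocity D T \<alpha> \<omega> x t \<bullet> grad (\<lambda>y. \<omega> y t) x = 0"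
    and init: "\<And>x. x \<in> D \<Longrightarrow> \<omega> x 0 = \<omega>0 x"
    using sol by blast+
  obtain fd :: "complex \<times> real \<Rightarrow> complex \<times> real \<Rightarrow> real" where fd_cont: "\<And>v. v \<in> Basis \<Longrightarrow> continuous_on (D \<times> {0<..}) (\<lambda>z. fd z v)"
    and fd_space: "\<And>x t. x \<in> D \<Longrightarrow> 0 < t \<Longrightarrow>
       GDERIV (\<lambda>y. \<omega> y t) x :> Complex (fd (x, t) (1, 0)) (fd (x, t) (\<i>, 0))"
    and fd_time: "\<And>x t. x \<in> D \<Longrightarrow> 0 < t \<Longrightarrow> (\<omega> x has_real_derivative fd (x, t) (0, 1)) (at t)"
    using smooth_vorticity_derivatives[OF open_D, of \<omega>] sol by blast
  define w where "w t x = (if x \<in> D then \<omega> x t else 0)" for t x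
  define gw where "gw t x = (if x \<in> D then Complex (fd (x, t) (1, 0)) (fd (x, t) (\<i>, 0)) else 0)" for t x
  define wt where "wt t x = fd (x, t) (0, 1)" for t x
  have w_supp: "\<exists>K. compact K \<and> K \<subseteq> D \<and> (\<forall>x. x \<notin> K \<longrightarrow> w t x = 0)" if "0 \<le> t" for t
    using supp[OF that] unfolding compactly_supported_in_def w_def by auto
  have w_cont_D: "isCont (w t) x" if t: "0 \<le> t" and x: "x \<in> D" for t x
  proof -
    have "continuous_on D (\<lambda>y. (\<lambda>(x, t). \<omega> x t) (y, t))"
      by (rule continuous_on_compose2[OF cont]) (use t in \<open>auto intro!: continuous_intros\<close>)
    hence "continuous_on D (w t)" by (rule continuous_on_eq) (simp add: w_def)
    thus ?thesis using x open_D continuous_on_eq_continuous_at by blast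
  qed
  have w_cont: "isCont (w t) x" if t: "0 \<le> t" for t x
  proof (cases "x \<in> D")
    case False
    obtain K where K: "compact K" "K \<subseteq> D" "\<And>x. x \<notin> K \<Longrightarrow> w t x = 0" using w_supp[OF t] by blast
    have "continuous_on (- K) (w t)" by (rule continuous_on_eq[of _ "\<lambda>_. 0"]) (use K in auto)
    moreover have "open (- K)" using K(1) by (simp add: compact_imp_closed open_Compl)
    ultimately show ?thesis using False K(2) continuous_on_eq_continuous_at by blast
  qed (rule w_cont_D[OF t])
  have w_contU: "continuous_on UNIV (w t)" if "0 \<le> t" for t
    using w_cont[OF that] by (simp add: continuous_at_imp_continuous_on)
  have w0: "w 0 x = (if x \<in> D then \<omega>0 x else 0)" for x using init by (simp add: w_def)
  obtain K0 where K0: "compact K0" "K0 \<subseteq> D" "\<And>x. x \<notin> K0 \<Longrightarrow> w 0 x = 0" using w_supp[of 0] by auto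
  have "bounded (w 0 ` K0)" by (intro compact_imp_bounded compact_continuous_image continuous_on_subset[OF w_contU] K0) auto
  then obtain M0 where "\<forall>x\<in>K0. \<bar>w 0 x\<bar> \<le> M0" unfolding bounded_iff by auto
  hence M0: "\<bar>w 0 x\<bar> \<le> \<bar>M0\<bar>" for x using K0(3)[of x] by (cases "x \<in> K0") auto
  have moments: "(LBINT x. \<bar>w t x\<bar> ^ n) = (LBINT x. \<bar>w 0 x\<bar> ^ n)" if t: "0 \<le> t" and n: "1 \<le> n" for t and n :: nat
  proof -
    have n1: "1 \<le> real n" using n by simp
    have "(LINT x:D|lborel. \<bar>\<omega> x t\<bar> powr real n) = (LINT x:D|lborel. \<bar>\<omega>0 x\<bar> powr real n)"
      using Lp[OF t n1] unfolding Lp_norm_eq_iff[OF n1] .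
    moreover have "(if x \<in> D then \<bar>\<omega> x t\<bar> powr real n else 0) = \<bar>w t x\<bar> ^ n"
      "(if x \<in> D then \<bar>\<omega>0 x\<bar> powr real n else 0) = \<bar>w 0 x\<bar> ^ n" for x
      using n init[of x] by (auto simp: w_def powr_realpow' zero_power)
    ultimately show ?thesis unfolding set_lebesgue_integral_zero_extension by simp
  qed
  \<comment> \<open>The supremum norm is controlled because all moments of integer order are conserved.\<close>
  have w_le: "\<bar>w t x\<bar> \<le> \<bar>M0\<bar>" if t: "0 \<le> t" for t x
  proof -
    obtain K where K: "compact K" "K \<subseteq> D" "\<And>x. x \<notin> K \<Longrightarrow> w t x = 0" using w_supp[OF t] by blast
    show ?thesis
      by (rule sup_bound_of_moments[OF w_contU[OF t] K(1,3) w_contU K0(1,3) M0 moments[OF t]]) auto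
  qed
  have density: "E.compact_density (w t)" if t: "0 \<le> t" for t
  proof -
    obtain K where K: "compact K" "K \<subseteq> D" "\<And>x. x \<notin> K \<Longrightarrow> w t x = 0" using w_supp[OF t] by blast
    show ?thesis
      by (rule E.compact_densityI[OF borel_measurable_continuous_onI[OF w_contU[OF t]] w_le[OF t] K])
  qed
  have w0_nonneg: "0 \<le> w 0 x" for x using assms(5) by (simp add: w0 D_def)
  have mass: "(LBINT x. \<bar>w 0 x\<bar>) = m"
    using w0_nonneg unfolding assms(6) set_lebesgue_integral_zero_extension D_def[symmetric] by (simp flip: w0)
  have Dw: "GDERIV (w t) x :> gw t x" if "0 < t" "x \<in> D" for t x
  proof -
    have "GDERIV (\<lambda>y. \<omega> y t) x :> gw t x" using fd_space[OF that(2,1)] that by (simp add: gw_def)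
    thus ?thesis unfolding gderiv_def
      by (rule has_derivative_transform_within_open[OF _ open_D that(2)]) (simp add: w_def)
  qed
  have stream: "nabla_perp (\<lambda>y. stream D T \<omega> y t) x = perp (E.grad_potential (w t) x)"
    if t: "0 \<le> t" and x: "x \<in> D" for t x
  proof (rule nabla_perp_eq)
    have "stream D T \<omega> y t = E.potential (w t) y" if "y \<in> D" for y
      unfolding stream_def set_lebesgue_integral_zero_extension E.potential_def
      by (rule Bochner_Integration.integral_cong) (use that in \<open>auto simp: w_def green_def T0_def\<close>)
    with E.GDERIV_potential[OF density[OF t] x] show "GDERIV (\<lambda>y. stream D T \<omega> y t) x :> E.grad_potential (w t) x"
      unfolding gderiv_def by (elim has_derivative_transform_within_open[OF _ open_D x]) simp
  qed
  have harmonic: "harmonic_field T x = (1 / (2 * pi)) *\<^sub>R perp (E.grad_log_T x)" if x: "x \<in> D" for x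
  proof -
    have "GDERIV (\<lambda>y. ln (cmod (T y))) x :> E.grad_log_T x"
      using E.GDERIV_log_T[OF x] unfolding gderiv_def
      by (rule has_derivative_transform_within_open[OF _ open_D x]) (simp add: E.log_T_def T0_def)
    thus ?thesis unfolding harmonic_field_def by (simp add: nabla_perp_eq)
  qed
  have basis: "(1, 0) \<in> (Basis :: (complex \<times> real) set)" "(\<i>, 0) \<in> (Basis :: (complex \<times> real) set)"
    "(0, 1) \<in> (Basis :: (complex \<times> real) set)"
    by (simp_all add: Basis_prod_def Basis_complex_def)
  have perp_lin: "perp (a + c *\<^sub>R b) = perp a + c *\<^sub>R perp b" for a b c
    by (simp add: perp_def complex_eq_iff)
  have "vorticity_solution D T0 (inv_into D T) B w wt gw \<alpha> \<bar>M0\<bar> m"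
  proof
    fix t :: real and x
    show "0 \<le> t \<Longrightarrow> E.compact_density (w t)" by (rule density)
    show "0 \<le> t \<Longrightarrow> \<bar>w t x\<bar> \<le> \<bar>M0\<bar>" by (rule w_le)
    show "0 \<le> t \<Longrightarrow> (LBINT x. \<bar>w t x\<bar>) = m" using moments[of t 1] mass by simp
    show "0 \<le> w 0 x" by (rule w0_nonneg)
    show "0 \<le> t \<Longrightarrow> isCont (w t) x" by (rule w_cont)
    show "continuous_on {0..} (\<lambda>t. w t x)"
    proof (cases "x \<in> D")
      case True
      have "continuous_on {0..} (\<lambda>t. (\<lambda>(x, t). \<omega> x t) (x, t))"
        by (rule continuous_on_compose2[OF cont]) (use True in \<open>auto intro!: continuous_intros\<close>)
      thus ?thesis using True by (simp add: w_def)
    qed (simp add: w_def)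
    show "0 < t \<Longrightarrow> x \<in> D \<Longrightarrow> GDERIV (w t) x :> gw t x" by (rule Dw)
    show "0 < t \<Longrightarrow> x \<in> D \<Longrightarrow> ((\<lambda>t. w t x) has_real_derivative wt t x) (at t)"
      using fd_time[of x t] by (simp add: w_def wt_def)
    show "0 < t \<Longrightarrow> x \<in> D \<Longrightarrow> wt t x + perp (E.grad_potential (w t) x + (\<alpha> / (2 * pi)) *\<^sub>R E.grad_log_T x) \<bullet> gw t x = 0"
    proof -
      assume t: "0 < t" and x: "x \<in> D"
      have "deriv (\<omega> x) t = wt t x" using fd_time[OF x t] by (simp add: wt_def DERIV_imp_deriv)
      moreover have "grad (\<lambda>y. \<omega> y t) x = gw t x" using GDERIV_imp_grad[OF fd_space[OF x t]] x by (simp add: gw_def)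
      moreover have "velocity D T \<alpha> \<omega> x t = perp (E.grad_potential (w t) x + (\<alpha> / (2 * pi)) *\<^sub>R E.grad_log_T x)"
        unfolding velocity_def perp_lin using stream[of t x] harmonic[OF x] t x by simp
      ultimately show ?thesis using pde[OF x t] by simp
    qed
  next
    fix t :: real assume t: "0 < t"
    obtain K where K: "compact K" "K \<subseteq> D" "\<And>x. x \<notin> K \<Longrightarrow> w t x = 0" using w_supp[of t] t by auto
    have "gw t x = 0" if "x \<notin> K" for x
    proof (cases "x \<in> D")
      case True
      have "((w t) has_derivative (\<lambda>h. h \<bullet> 0)) (at x)"
      proof (rule has_derivative_transform_within_open)
        show "((\<lambda>_. 0) has_derivative (\<lambda>h. h \<bullet> 0)) (at x)" by simp
        show "open (- K)" using K(1) by (simp add: compact_imp_closed open_Compl)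
      qed (use that K in auto)
      hence "grad (w t) x = 0" by (intro GDERIV_imp_grad) (simp add: gderiv_def)
      thus ?thesis using GDERIV_imp_grad[OF Dw[OF t True]] by simp
    qed (simp add: gw_def)
    moreover have "\<exists>C. \<forall>x\<in>K. cmod (gw t x) \<le> C"
    proof -
      have c: "continuous_on K (\<lambda>x. fd (x, t) v)" if "v \<in> Basis" for v
        by (rule continuous_on_compose2[OF fd_cont[OF that]]) (use K t in \<open>auto intro!: continuous_intros\<close>)
      have "continuous_on K (\<lambda>x. Complex (fd (x, t) (1, 0)) (fd (x, t) (\<i>, 0)))"
        unfolding Complex_eq by (intro continuous_intros c basis)
      hence "continuous_on K (gw t)" by (rule continuous_on_eq) (use K in \<open>auto simp: gw_def\<close>)
      hence "bounded (gw t ` K)" using K(1) by (intro compact_imp_bounded compact_continuous_image)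
      thus ?thesis unfolding bounded_iff by auto
    qed
    ultimately obtain C where "\<And>x. x \<notin> K \<Longrightarrow> gw t x = 0" "\<And>x. x \<in> K \<Longrightarrow> cmod (gw t x) \<le> C" by blast
    hence "cmod (gw t x) \<le> \<bar>C\<bar>" "x \<notin> K \<Longrightarrow> gw t x = 0" for x by (cases "x \<in> K"; force)+
    thus "\<exists>K C. compact K \<and> K \<subseteq> D \<and> (\<forall>x. x \<notin> K \<longrightarrow> w t x = 0 \<and> gw t x = 0) \<and> (\<forall>x. cmod (gw t x) \<le> C)"
      using K by blast
  next
    fix K and a b :: real assume K: "compact K" "K \<subseteq> D" and a: "0 < a"
    have "continuous_on (K \<times> {a..b}) (\<lambda>z. fd z (0, 1))"
      by (rule continuous_on_subset[OF fd_cont[OF basis(3)]]) (use K a in auto)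
    hence "bounded ((\<lambda>z. fd z (0, 1)) ` (K \<times> {a..b}))"
      using K(1) by (intro compact_imp_bounded compact_continuous_image compact_Times) auto
    thus "\<exists>C. \<forall>x\<in>K. \<forall>t\<in>{a..b}. \<bar>wt t x\<bar> \<le> C" unfolding bounded_iff by (auto simp: wt_def)
  qed
  then interpret V: vorticity_solution D T0 "inv_into D T" B w wt gw \<alpha> "\<bar>M0\<bar>" m .
  obtain C where C: "\<And>t. 0 \<le> t \<Longrightarrow> 1 / (2 * pi) * (LBINT x. E.log_T x * w t x) \<le> C"
    using V.log_moment_bounded assms(8) by blast
  have "log_moment (outside \<Gamma>) T \<omega> t = 1 / (2 * pi) * (LBINT x. E.log_T x * w t x)" for t
    unfolding log_moment_def D_def[symmetric] set_lebesgue_integral_zero_extension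
    by (intro arg_cong2[where f = "(*)"] refl Bochner_Integration.integral_cong)
      (auto simp: w_def E.log_T_def T0_def)
  hence "log_moment (outside \<Gamma>) T \<omega> t \<le> max 1 C" if "0 \<le> t" for t using C[OF that] by simp
  thus ?thesis by (intro exI[of _ "max 1 C"]) auto
qed

end
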